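(* Let $\kappa$ be a field, $G$ a group and $\sigma\in pm(G)$ a factor set such that the space $\Omega_\sigma$ is discrete. Let $\psi:\kappa_{par}^{\sigma}G\to\mathcal{R}^\sigma(G)$ be the (well-defined, unique) homomorphism of $\kappa$-algebras such that $$\psi([g]^\sigma)=\sum_{A\in\Omega_\sigma,\ A\ni g^{-1}}(g,A)\qquad\text{for all } g\in G.$$ Then $\psi$ is an isomorphism of algebras.
   Context: Algebras are associative and unital, and homomorphisms preserve the unit. A partial projective $\sigma$-representation of $G$ in a unital $\kappa$-algebra $R$ (with $1_R\neq 0$) is a map $\Gamma:G\to R$ for which there is a function $\sigma:G\times G\to\kappa$ (called the factor set) such that for all $g,h\in G$: (i) if $\sigma(g,h)=0$ then $\Gamma(g^{-1})\Gamma(gh)=0$ and $\Gamma(gh)\Gamma(h^{-1})=0$; (ii) if $\Gamma(g)\Gamma(h)=0$ then $\sigma(g,h)=0$; (iii) $\Gamma(1_G)=1_R$; (iv) $\Gamma(g^{-1})\Gamma(g)\Gamma(h)=\sigma(g,h)\Gamma(g^{-1})\Gamma(gh)$; (v) $\Gamma(g)\Gamma(h)\Gamma(h^{-1})=\sigma(g,h)\Gamma(gh)\Gamma(h^{-1})$. The set of all factor sets of $G$ (over all such $R$ and $\Gamma$) is $pm(G)$. For $\sigma\in pm(G)$, the twisted partial group algebra $\kappa_{par}^{\sigma}G$ is the universal $\kappa$-algebra generated by symbols $[g]^\sigma$ ($g\in G$) subject to, for all $g,h\in G$: $\sigma(g,h)=0\Rightarrow [g^{-1}]^\sigma[gh]^\sigma=[gh]^\sigma[h^{-1}]^\sigma=0$;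 $[g^{-1}]^\sigma[g]^\sigma[h]^\sigma=\sigma(g,h)[g^{-1}]^\sigma[gh]^\sigma$; $[g]^\sigma[h]^\sigma[h^{-1}]^\sigma=\sigma(g,h)[gh]^\sigma[h^{-1}]^\sigma$; $[g]^\sigma[1_G]^\sigma=[1_G]^\sigma[g]^\sigma=[g]^\sigma$. Let $\Omega=\{\xi\subseteq G:1\in\xi\}$, identified with $\prod_{g\in G\setminus\{1\}}\{0,1\}$ and given the product topology. The $\sigma$-prohibitions of type I are the sets $\{h,hg,hgs\}$ with $h,g,s\in G$ and $\sigma(g,s)=0$; those of type II are the sets $\{h,hg,hgs,hgst\}$ with $h,g,s,t\in G$ and $\sigma(g,st)\sigma(s,t)\neq\sigma(g,s)\sigma(gs,t)$. $\mathcal{P}_\sigma$ is the set of all $\sigma$-prohibitions, and $\Omega_\sigma=\{\xi\in\Omega: V\nsubseteq\xi\text{ for all }V\in\mathcal{P}_\sigma\}$ with the subspace topology (a compact space). If $\Omega_\sigma$ is discrete, then it is finite and all its elements are finite sets. $\mathcal{R}^\sigma(G)$ is the $\kappa$-vector space with basis $\{(g,A):A\in\Omega_\sigma,\ g^{-1}\in A\}$, with the bilinear product $(g,B)*(h,A)=\sigma(g,h)(gh,A)$ if $B=hA$, and $0$ otherwise. When $\Omega_\sigma$ is discrete it is an associative $\kappa$-algebra with unit $\sum_{A\in\Omega_\sigma}(1,A)$.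
   Formalization: The relation that the generator at the identity of G equals the unit of the twisted partial group algebra is added to the listed relations; read literally for unital algebras they do not imply it, and the claim fails already for the trivial group. *)

theory Defs
  imports "HOL-Analysis.Abstract_Topology" "HOL-Analysis.Function_Topology"
    "HOL-Algebra.Group" "HOL-Algebra.Coset" "HOL-Algebra.Module" "HOL-Algebra.QuotRing"
begin

section \<open>Associative unital algebras\<close>

text \<open>The locale \<^locale>\<open>algebra\<close> of HOL-Algebra requires commutativity, so it cannot be used here.\<close>

locale unital_algebra = Module.module K A + Ring.ring A for K (structure) and A (structure) +
  assumes smult_mult_left:
      "\<lbrakk>a \<in> carrier K; x \<in> carrier A; y \<in> carrier A\<rbrakk> \<Longrightarrow>
        (a \<odot>\<^bsub>A\<^esub> x) \<otimes>\<^bsub>A\<^esub> y = a \<odot>\<^bsub>A\<^esub> (x \<otimes>\<^bsub>A\<^esub> y)"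
    and smult_mult_right:
      "\<lbrakk>a \<in> carrier K; x \<in> carrier A; y \<in> carrier A\<rbrakk> \<Longrightarrow>
        x \<otimes>\<^bsub>A\<^esub> (a \<odot>\<^bsub>A\<^esub> y) = a \<odot>\<^bsub>A\<^esub> (x \<otimes>\<^bsub>A\<^esub> y)"

definition alg_hom ::
  "('k, 'm) ring_scheme \<Rightarrow> ('k, 'a, 'p) module_scheme \<Rightarrow> ('k, 'b, 'q) module_scheme \<Rightarrow> ('a \<Rightarrow> 'b) set"
  where "alg_hom K A B =
    {f \<in> ring_hom A B. \<forall>a\<in>carrier K. \<forall>x\<in>carrier A. f (a \<odot>\<^bsub>A\<^esub> x) = a \<odot>\<^bsub>B\<^esub> f x}"

definition alg_iso ::
  "('k, 'm) ring_scheme \<Rightarrow> ('k, 'a, 'p) module_scheme \<Rightarrow> ('k, 'b, 'q) module_scheme \<Rightarrow> ('a \<Rightarrow> 'b) set"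
  where "alg_iso K A B = {f \<in> alg_hom K A B. bij_betw f (carrier A) (carrier B)}"

text \<open>The quotient of an algebra by a two-sided ideal: the quotient ring \<^const>\<open>FactRing\<close>,
  with the induced scalar multiplication on cosets.\<close>

definition quot_alg :: "('k, 'a, 'p) module_scheme \<Rightarrow> 'a set \<Rightarrow> ('k, 'a set) module"
  where "quot_alg A I =
    \<lparr>carrier = carrier (A Quot I), mult = mult (A Quot I), one = one (A Quot I),
     zero = zero (A Quot I), add = add (A Quot I),
     smult = (\<lambda>a X. \<Union>x\<in>X. I +>\<^bsub>A\<^esub> (a \<odot>\<^bsub>A\<^esub> x))\<rparr>"


section \<open>Algebras given by a basis and structure constants\<close>

text \<open>Vectors are finitely supported coordinate functions; \<open>ind K S\<close> is the (formal) sum of the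
  basis elements in \<open>S\<close>, so \<open>ind K {b}\<close> is the basis element \<open>b\<close>.\<close>

definition ind :: "('k, 'm) ring_scheme \<Rightarrow> 'b set \<Rightarrow> 'b \<Rightarrow> 'k"
  where "ind K S = (\<lambda>x. if x \<in> S then \<one>\<^bsub>K\<^esub> else \<zero>\<^bsub>K\<^esub>)"

definition supp :: "('k, 'm) ring_scheme \<Rightarrow> ('b \<Rightarrow> 'k) \<Rightarrow> 'b set"
  where "supp K f = {x. f x \<noteq> \<zero>\<^bsub>K\<^esub>}"

text \<open>The product is the bilinear extension of the product \<open>\<mu> p q\<close> of basis elements \<open>p\<close>, \<open>q\<close>.\<close>

definition basis_alg ::
  "('k, 'm) ring_scheme \<Rightarrow> 'b set \<Rightarrow> ('b \<Rightarrow> 'b \<Rightarrow> 'b \<Rightarrow> 'k) \<Rightarrow> ('b \<Rightarrow> 'k) \<Rightarrow> ('k, 'b \<Rightarrow> 'k) module"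
  where "basis_alg K B \<mu> u =
    \<lparr>carrier = {f. range f \<subseteq> carrier K \<and> supp K f \<subseteq> B \<and> finite (supp K f)},
     mult = (\<lambda>f f' x. \<Oplus>\<^bsub>K\<^esub>p\<in>supp K f. \<Oplus>\<^bsub>K\<^esub>q\<in>supp K f'. f p \<otimes>\<^bsub>K\<^esub> f' q \<otimes>\<^bsub>K\<^esub> \<mu> p q x),
     one = u,
     zero = (\<lambda>x. \<zero>\<^bsub>K\<^esub>),
     add = (\<lambda>f f' x. f x \<oplus>\<^bsub>K\<^esub> f' x),
     smult = (\<lambda>a f x. a \<otimes>\<^bsub>K\<^esub> f x)\<rparr>"

text \<open>The free associative unital algebra on a set \<open>X\<close> has the words over \<open>X\<close> as a basis.\<close>

definition free_alg :: "('k, 'm) ring_scheme \<Rightarrow> 'x set \<Rightarrow> ('k, 'x list \<Rightarrow> 'k) module"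
  where "free_alg K X = basis_alg K (lists X) (\<lambda>v w. ind K {v @ w}) (ind K {[]})"


section \<open>Partial projective representations and factor sets\<close>

definition partial_projective_rep ::
  "('k, 'm) ring_scheme \<Rightarrow> ('g, 'n) monoid_scheme \<Rightarrow> ('k, 'r, 'p) module_scheme \<Rightarrow>
    ('g \<Rightarrow> 'g \<Rightarrow> 'k) \<Rightarrow> ('g \<Rightarrow> 'r) \<Rightarrow> bool"
  where "partial_projective_rep K G R \<sigma> \<Gamma> \<longleftrightarrow>
    \<sigma> \<in> carrier G \<rightarrow> carrier G \<rightarrow> carrier K \<and>
    \<Gamma> \<in> carrier G \<rightarrow> carrier R \<and>
    \<Gamma> \<one>\<^bsub>G\<^esub> = \<one>\<^bsub>R\<^esub> \<and>
    (\<forall>g\<in>carrier G. \<forall>h\<in>carrier G.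
      (\<sigma> g h = \<zero>\<^bsub>K\<^esub> \<longrightarrow>
        \<Gamma> (inv\<^bsub>G\<^esub> g) \<otimes>\<^bsub>R\<^esub> \<Gamma> (g \<otimes>\<^bsub>G\<^esub> h) = \<zero>\<^bsub>R\<^esub> \<and>
        \<Gamma> (g \<otimes>\<^bsub>G\<^esub> h) \<otimes>\<^bsub>R\<^esub> \<Gamma> (inv\<^bsub>G\<^esub> h) = \<zero>\<^bsub>R\<^esub>) \<and>
      (\<Gamma> g \<otimes>\<^bsub>R\<^esub> \<Gamma> h = \<zero>\<^bsub>R\<^esub> \<longrightarrow> \<sigma> g h = \<zero>\<^bsub>K\<^esub>) \<and>
      \<Gamma> (inv\<^bsub>G\<^esub> g) \<otimes>\<^bsub>R\<^esub> \<Gamma> g \<otimes>\<^bsub>R\<^esub> \<Gamma> h =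
        \<sigma> g h \<odot>\<^bsub>R\<^esub> (\<Gamma> (inv\<^bsub>G\<^esub> g) \<otimes>\<^bsub>R\<^esub> \<Gamma> (g \<otimes>\<^bsub>G\<^esub> h)) \<and>
      \<Gamma> g \<otimes>\<^bsub>R\<^esub> \<Gamma> h \<otimes>\<^bsub>R\<^esub> \<Gamma> (inv\<^bsub>G\<^esub> h) =
        \<sigma> g h \<odot>\<^bsub>R\<^esub> (\<Gamma> (g \<otimes>\<^bsub>G\<^esub> h) \<otimes>\<^bsub>R\<^esub> \<Gamma> (inv\<^bsub>G\<^esub> h)))"

text \<open>HOL cannot quantify over all types inside a formula, so the set of factor sets is indexed by
  the type \<open>'r\<close> of elements of the algebra \<open>R\<close>.  A theorem that assumes \<open>\<sigma> \<in> pm TYPE('r) K G\<close>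
  for a free type variable \<open>'r\<close> that does not occur in its conclusion
  covers the factor sets of representations in algebras of every type.\<close>

definition pm ::
  "'r itself \<Rightarrow> ('k, 'm) ring_scheme \<Rightarrow> ('g, 'n) monoid_scheme \<Rightarrow> ('g \<Rightarrow> 'g \<Rightarrow> 'k) set"
  where "pm (_ :: 'r itself) K G =
    {\<sigma>. \<exists>(R :: ('k, 'r) module) \<Gamma>. unital_algebra K R \<and> \<one>\<^bsub>R\<^esub> \<noteq> \<zero>\<^bsub>R\<^esub> \<and>
      partial_projective_rep K G R \<sigma> \<Gamma>}"


section \<open>The twisted partial group algebra\<close>

definition free_gen :: "('k, 'm) ring_scheme \<Rightarrow> 'x \<Rightarrow> 'x list \<Rightarrow> 'k"
  where "free_gen K x = ind K {[x]}"

text \<open>The relations \<open>[g][1] = [1][g] = [g]\<close> make \<open>[1]\<close> the unit of the algebra generated by the symbols.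
  Inside the free unital algebra, whose unit is the empty word, this has to be said by the extra
  relation \<open>[1] = 1\<close>: without it the quotient would acquire a spurious direct factor \<open>K\<close>,
  spanned by \<open>1 - [1]\<close>.\<close>

definition tpg_relators ::
  "('k, 'm) ring_scheme \<Rightarrow> ('g, 'n) monoid_scheme \<Rightarrow> ('g \<Rightarrow> 'g \<Rightarrow> 'k) \<Rightarrow> ('g list \<Rightarrow> 'k) set"
  where "tpg_relators K G \<sigma> =
    (let F = free_alg K (carrier G); x = free_gen K in
      {x (inv\<^bsub>G\<^esub> g) \<otimes>\<^bsub>F\<^esub> x (g \<otimes>\<^bsub>G\<^esub> h) | g h.
        g \<in> carrier G \<and> h \<in> carrier G \<and> \<sigma> g h = \<zero>\<^bsub>K\<^esub>} \<union>
      {x (g \<otimes>\<^bsub>G\<^esub> h) \<otimes>\<^bsub>F\<^esub> x (inv\<^bsub>G\<^esub> h) | g h.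
        g \<in> carrier G \<and> h \<in> carrier G \<and> \<sigma> g h = \<zero>\<^bsub>K\<^esub>} \<union>
      {(x (inv\<^bsub>G\<^esub> g) \<otimes>\<^bsub>F\<^esub> x g \<otimes>\<^bsub>F\<^esub> x h) \<ominus>\<^bsub>F\<^esub>
        (\<sigma> g h \<odot>\<^bsub>F\<^esub> (x (inv\<^bsub>G\<^esub> g) \<otimes>\<^bsub>F\<^esub> x (g \<otimes>\<^bsub>G\<^esub> h))) | g h.
        g \<in> carrier G \<and> h \<in> carrier G} \<union>
      {(x g \<otimes>\<^bsub>F\<^esub> x h \<otimes>\<^bsub>F\<^esub> x (inv\<^bsub>G\<^esub> h)) \<ominus>\<^bsub>F\<^esub>
        (\<sigma> g h \<odot>\<^bsub>F\<^esub> (x (g \<otimes>\<^bsub>G\<^esub> h) \<otimes>\<^bsub>F\<^esub> x (inv\<^bsub>G\<^esub> h))) | g h.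
        g \<in> carrier G \<and> h \<in> carrier G} \<union>
      {(x g \<otimes>\<^bsub>F\<^esub> x \<one>\<^bsub>G\<^esub>) \<ominus>\<^bsub>F\<^esub> x g | g. g \<in> carrier G} \<union>
      {(x \<one>\<^bsub>G\<^esub> \<otimes>\<^bsub>F\<^esub> x g) \<ominus>\<^bsub>F\<^esub> x g | g. g \<in> carrier G} \<union>
      {x \<one>\<^bsub>G\<^esub> \<ominus>\<^bsub>F\<^esub> \<one>\<^bsub>F\<^esub>})"

definition tpg_ideal ::
  "('k, 'm) ring_scheme \<Rightarrow> ('g, 'n) monoid_scheme \<Rightarrow> ('g \<Rightarrow> 'g \<Rightarrow> 'k) \<Rightarrow> ('g list \<Rightarrow> 'k) set"
  where "tpg_ideal K G \<sigma> = Idl\<^bsub>free_alg K (carrier G)\<^esub> (tpg_relators K G \<sigma>)"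

definition tpg_alg ::
  "('k, 'm) ring_scheme \<Rightarrow> ('g, 'n) monoid_scheme \<Rightarrow> ('g \<Rightarrow> 'g \<Rightarrow> 'k) \<Rightarrow>
    ('k, ('g list \<Rightarrow> 'k) set) module"
  where "tpg_alg K G \<sigma> = quot_alg (free_alg K (carrier G)) (tpg_ideal K G \<sigma>)"

definition tpg_gen ::
  "('k, 'm) ring_scheme \<Rightarrow> ('g, 'n) monoid_scheme \<Rightarrow> ('g \<Rightarrow> 'g \<Rightarrow> 'k) \<Rightarrow> 'g \<Rightarrow> ('g list \<Rightarrow> 'k) set"
  where "tpg_gen K G \<sigma> g = tpg_ideal K G \<sigma> +>\<^bsub>free_alg K (carrier G)\<^esub> free_gen K g"


section \<open>The space of a factor set\<close>

definition Omega :: "('g, 'n) monoid_scheme \<Rightarrow> 'g set set"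
  where "Omega G = {\<xi>. \<xi> \<subseteq> carrier G \<and> \<one>\<^bsub>G\<^esub> \<in> \<xi>}"

text \<open>The product topology is transported along the bijection sending \<open>\<xi>\<close> to its indicator function
  on \<open>G - {1}\<close>; the type \<^typ>\<open>bool\<close> plays the role of \<open>{0, 1}\<close>.\<close>

definition Omega_topology :: "('g, 'n) monoid_scheme \<Rightarrow> 'g set topology"
  where "Omega_topology G =
    pullback_topology (Omega G) (\<lambda>\<xi>. \<lambda>g\<in>carrier G - {\<one>\<^bsub>G\<^esub>}. g \<in> \<xi>)
      (product_topology (\<lambda>_. discrete_topology (UNIV :: bool set)) (carrier G - {\<one>\<^bsub>G\<^esub>}))"

definition prohibitions ::
  "('k, 'm) ring_scheme \<Rightarrow> ('g, 'n) monoid_scheme \<Rightarrow> ('g \<Rightarrow> 'g \<Rightarrow> 'k) \<Rightarrow> 'g set set"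
  where "prohibitions K G \<sigma> =
    {{h, h \<otimes>\<^bsub>G\<^esub> g, h \<otimes>\<^bsub>G\<^esub> g \<otimes>\<^bsub>G\<^esub> s} | h g s.
      h \<in> carrier G \<and> g \<in> carrier G \<and> s \<in> carrier G \<and> \<sigma> g s = \<zero>\<^bsub>K\<^esub>} \<union>
    {{h, h \<otimes>\<^bsub>G\<^esub> g, h \<otimes>\<^bsub>G\<^esub> g \<otimes>\<^bsub>G\<^esub> s, h \<otimes>\<^bsub>G\<^esub> g \<otimes>\<^bsub>G\<^esub> s \<otimes>\<^bsub>G\<^esub> t} | h g s t.
      h \<in> carrier G \<and> g \<in> carrier G \<and> s \<in> carrier G \<and> t \<in> carrier G \<and>
      \<sigma> g (s \<otimes>\<^bsub>G\<^esub> t) \<otimes>\<^bsub>K\<^esub> \<sigma> s t \<noteq> \<sigma> g s \<otimes>\<^bsub>K\<^esub> \<sigma> (g \<otimes>\<^bsub>G\<^esub> s) t}"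

definition Omega_sigma ::
  "('k, 'm) ring_scheme \<Rightarrow> ('g, 'n) monoid_scheme \<Rightarrow> ('g \<Rightarrow> 'g \<Rightarrow> 'k) \<Rightarrow> 'g set set"
  where "Omega_sigma K G \<sigma> = {\<xi> \<in> Omega G. \<forall>V\<in>prohibitions K G \<sigma>. \<not> V \<subseteq> \<xi>}"

definition Omega_sigma_topology ::
  "('k, 'm) ring_scheme \<Rightarrow> ('g, 'n) monoid_scheme \<Rightarrow> ('g \<Rightarrow> 'g \<Rightarrow> 'k) \<Rightarrow> 'g set topology"
  where "Omega_sigma_topology K G \<sigma> = subtopology (Omega_topology G) (Omega_sigma K G \<sigma>)"


section \<open>The algebra \<open>\<R>\<^sup>\<sigma>(G)\<close>\<close>

definition R_basis ::
  "('k, 'm) ring_scheme \<Rightarrow> ('g, 'n) monoid_scheme \<Rightarrow> ('g \<Rightarrow> 'g \<Rightarrow> 'k) \<Rightarrow> ('g \<times> 'g set) set"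
  where "R_basis K G \<sigma> =
    {(g, A). g \<in> carrier G \<and> A \<in> Omega_sigma K G \<sigma> \<and> inv\<^bsub>G\<^esub> g \<in> A}"

definition R_basis_mult ::
  "('k, 'm) ring_scheme \<Rightarrow> ('g, 'n) monoid_scheme \<Rightarrow> ('g \<Rightarrow> 'g \<Rightarrow> 'k) \<Rightarrow>
    'g \<times> 'g set \<Rightarrow> 'g \<times> 'g set \<Rightarrow> 'g \<times> 'g set \<Rightarrow> 'k"
  where "R_basis_mult K G \<sigma> = (\<lambda>(g, B) (h, A) x.
    if B = h <#\<^bsub>G\<^esub> A then \<sigma> g h \<otimes>\<^bsub>K\<^esub> ind K {(g \<otimes>\<^bsub>G\<^esub> h, A)} x else \<zero>\<^bsub>K\<^esub>)"

text \<open>The unit is the sum of the basis elements \<open>(1, A)\<close>; it has finite support when \<open>\<Omega>\<^sub>\<sigma>\<close> is discrete.\<close>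

definition R_alg ::
  "('k, 'm) ring_scheme \<Rightarrow> ('g, 'n) monoid_scheme \<Rightarrow> ('g \<Rightarrow> 'g \<Rightarrow> 'k) \<Rightarrow>
    ('k, 'g \<times> 'g set \<Rightarrow> 'k) module"
  where "R_alg K G \<sigma> =
    basis_alg K (R_basis K G \<sigma>) (R_basis_mult K G \<sigma>) (ind K ({\<one>\<^bsub>G\<^esub>} \<times> Omega_sigma K G \<sigma>))"

end

theory Submission
  imports Defs
begin

text \<open>Write \<open>c g = \<sigma>(g, g\<inverse>)\<close>.  In every algebra with elements \<open>x g\<close> satisfying the relations
  of \<open>[g]\<^sup>\<sigma>\<close>, the elements \<open>e g = c g\<inverse> x g x g\<inverse>\<close> (zero if \<open>c g = 0\<close>, since then \<open>x g = 0\<close>)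
  are commuting idempotents with \<open>x g e h = e (gh) x g\<close> and \<open>x g x h = \<sigma>(g, h) e g x (gh)\<close>, and
  the product of the \<open>e v\<close> over a prohibition vanishes.  If \<open>\<Omega>\<^sub>\<sigma>\<close> is discrete, it is finite with
  finite members, so with \<open>Y\<close> the union of \<open>\<Omega>\<^sub>\<sigma>\<close> the idempotents
  \<open>p A = (\<Prod>y\<in>A. e y) (\<Prod>y\<in>Y - A. 1 - e y)\<close> for \<open>A \<in> \<Omega>\<^sub>\<sigma>\<close> add up to \<open>1\<close>.
  The linear map \<open>\<phi>\<close> that sends \<open>(g, A)\<close> to \<open>[g] p A\<close> is inverse to \<open>\<psi>\<close>: the image of
  \<open>[g] p A\<close> under \<open>\<psi>\<close> is \<open>(g, A)\<close>, and the fixed points of \<open>\<phi> \<circ> \<psi>\<close> form a subspace that contains \<open>1\<close>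
  and is stable under left multiplication by the generators.\<close>


section \<open>Algebras with a basis\<close>

text \<open>The factor set may vanish and is not assumed to be a cocycle, so products of generators
  cannot simply be normalized to multiples of single generators. One calculus of idempotents is
  therefore developed for arbitrary elements \<open>x g\<close> subject to the relations, and it is
  applied both to \<open>gen\<close> in the presented algebra and to \<open>R_gen\<close> in
  \<open>R\<close>. A prohibition annihilates for one of two reasons: a zero of \<sigma> makes two
  idempotents orthogonal, and a defect in the cocycle identity clashes with associativity, since a
  product of three generators then equals one vector with two different coefficients. Expanding the
  product of all \<open>e y + (1 - e y)\<close> gives a sum over all subsets of Y, of which only the
  members of \<open>Omega_sigma\<close> can survive. Discreteness enters through compactness of the
  space. Conversely, associativity of \<open>R\<close> rests on the type II prohibitions and has to
  be settled before the universal property yields \<psi>. Since \<psi> is a homomorphism, a linear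
  two-sided inverse suffices, and multiplicativity of \<phi> is never verified.\<close>

locale based_bilinear = cring K for K :: "('k, 'm) ring_scheme" (structure) +
  fixes B :: "'b set" and \<mu> :: "'b \<Rightarrow> 'b \<Rightarrow> 'b \<Rightarrow> 'k" and u :: "'b \<Rightarrow> 'k"
    and A :: "('k, 'b \<Rightarrow> 'k) module"
  assumes A_def: "A = basis_alg K B \<mu> u"
    and mult_basis_closed: "\<lbrakk>p \<in> B; q \<in> B\<rbrakk> \<Longrightarrow> \<mu> p q \<in> carrier A"
begin

lemma carrier_iff:
  "f \<in> carrier A \<longleftrightarrow> (\<forall>x. f x \<in> carrier K) \<and> supp K f \<subseteq> B \<and> finite (supp K f)"
  by (auto simp: A_def basis_alg_def)

lemma basis_alg_simps:
  "f \<otimes>\<^bsub>A\<^esub> g = (\<lambda>x. \<Oplus>p\<in>supp K f. \<Oplus>q\<in>supp K g. f p \<otimes> g q \<otimes> \<mu> p q x)"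
  "\<one>\<^bsub>A\<^esub> = u" "\<zero>\<^bsub>A\<^esub> = (\<lambda>x. \<zero>)" "f \<oplus>\<^bsub>A\<^esub> g = (\<lambda>x. f x \<oplus> g x)"
  "a \<odot>\<^bsub>A\<^esub> f = (\<lambda>x. a \<otimes> f x)"
  by (auto simp: A_def basis_alg_def)

lemma coeff_closed: "f \<in> carrier A \<Longrightarrow> f x \<in> carrier K"
  by (simp add: carrier_iff)

lemma coeff_zero: "x \<notin> supp K f \<Longrightarrow> f x = \<zero>"
  by (simp add: supp_def)

lemma ind_closed:
  assumes "S \<subseteq> B" "finite S" shows "ind K S \<in> carrier A"
proof -
  have "supp K (ind K S) \<subseteq> S" by (auto simp: supp_def ind_def)
  then show ?thesis using assms by (auto simp: carrier_iff ind_def intro: finite_subset)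
qed

lemma basis_closed: "p \<in> B \<Longrightarrow> ind K {p} \<in> carrier A"
  by (rule ind_closed) auto

lemma add_closed: "\<lbrakk>f \<in> carrier A; g \<in> carrier A\<rbrakk> \<Longrightarrow> f \<oplus>\<^bsub>A\<^esub> g \<in> carrier A"
proof -
  assume fg: "f \<in> carrier A" "g \<in> carrier A"
  have "supp K (f \<oplus>\<^bsub>A\<^esub> g) \<subseteq> supp K f \<union> supp K g"
    by (auto simp: supp_def basis_alg_simps)
  with fg show ?thesis unfolding carrier_iff
    by (auto simp: basis_alg_simps intro: finite_subset)
qed

lemma scal_closed: "\<lbrakk>a \<in> carrier K; f \<in> carrier A\<rbrakk> \<Longrightarrow> a \<odot>\<^bsub>A\<^esub> f \<in> carrier A"
proof -
  assume f: "a \<in> carrier K" "f \<in> carrier A"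
  have "supp K (a \<odot>\<^bsub>A\<^esub> f) \<subseteq> supp K f"
    using f(1) by (auto simp: supp_def basis_alg_simps)
  with f show ?thesis unfolding carrier_iff
    by (auto simp: basis_alg_simps intro: finite_subset)
qed

lemma zero_in_carrier: "\<zero>\<^bsub>A\<^esub> \<in> carrier A"
  by (auto simp: carrier_iff basis_alg_simps supp_def)

lemma abelian: "abelian_group A"
proof (rule abelian_groupI)
  fix f assume f: "f \<in> carrier A"
  show "\<exists>g\<in>carrier A. g \<oplus>\<^bsub>A\<^esub> f = \<zero>\<^bsub>A\<^esub>"
  proof
    show "(\<ominus> \<one>) \<odot>\<^bsub>A\<^esub> f \<in> carrier A" using f by (simp add: scal_closed)
    show "(\<ominus> \<one>) \<odot>\<^bsub>A\<^esub> f \<oplus>\<^bsub>A\<^esub> f = \<zero>\<^bsub>A\<^esub>"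
      using coeff_closed[OF f] by (auto simp: basis_alg_simps l_minus l_neg)
  qed
qed (simp_all add: add_closed zero_in_carrier,
    simp_all add: basis_alg_simps coeff_closed a_ac fun_eq_iff)

lemma module: "Module.module K A"
  by (rule moduleI)
    (simp_all add: cring_axioms abelian scal_closed,
      simp_all add: basis_alg_simps coeff_closed fun_eq_iff l_distr r_distr m_assoc)

text \<open>The principle behind nearly every linear identity below. The induction runs over a
  finite set containing the support instead of the support itself, so that erasing one coordinate
  stays within its scope.\<close>

lemma basis_induct [consumes 1, case_names zero basis add scal]:
  assumes f: "f \<in> carrier A"
    and zero: "P \<zero>\<^bsub>A\<^esub>"
    and basis: "\<And>p. p \<in> B \<Longrightarrow> P (ind K {p})"
    and add: "\<And>f g. \<lbrakk>f \<in> carrier A; g \<in> carrier A; P f; P g\<rbrakk> \<Longrightarrow> P (f \<oplus>\<^bsub>A\<^esub> g)"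
    and scal: "\<And>a f. \<lbrakk>a \<in> carrier K; f \<in> carrier A; P f\<rbrakk> \<Longrightarrow> P (a \<odot>\<^bsub>A\<^esub> f)"
  shows "P f"
proof -
  have "P f" if "finite S" "f \<in> carrier A" "supp K f \<subseteq> S" for S f
    using that
  proof (induction S arbitrary: f rule: finite_induct)
    case empty
    then have "f = \<zero>\<^bsub>A\<^esub>" by (auto simp: supp_def basis_alg_simps)
    then show ?case using zero by simp
  next
    case (insert p S)
    show ?case
    proof (cases "f p = \<zero>")
      case True
      then have "supp K f \<subseteq> S" using insert.prems by (auto simp: supp_def)
      then show ?thesis using insert by blast
    next
      case False
      let ?g = "f(p := \<zero>)"
      have g: "supp K ?g \<subseteq> supp K f \<inter> S" using insert.prems(2) by (auto simp: supp_def)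
      have gA: "?g \<in> carrier A" using insert.prems(1) g
        by (auto simp: carrier_iff intro: finite_subset)
      have pB: "p \<in> B" using False insert.prems(1) by (auto simp: carrier_iff supp_def)
      have "f = ?g \<oplus>\<^bsub>A\<^esub> f p \<odot>\<^bsub>A\<^esub> ind K {p}"
        using coeff_closed[OF insert.prems(1)]
        by (auto simp: basis_alg_simps ind_def fun_eq_iff)
      moreover have "P ?g" using insert.IH[OF gA] g by blast
      moreover have "P (f p \<odot>\<^bsub>A\<^esub> ind K {p})"
        using pB insert.prems(1) by (auto intro: scal basis basis_closed coeff_closed)
      ultimately show ?thesis
        by (metis add gA scal_closed basis_closed pB coeff_closed insert.prems(1))
    qed
  qed
  then show ?thesis using f by (auto simp: carrier_iff)
qed

lemma supp_B: "f \<in> carrier A \<Longrightarrow> supp K f \<subseteq> B" "f \<in> carrier A \<Longrightarrow> finite (supp K f)"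
  by (auto simp: carrier_iff)

text \<open>The product is defined by sums over the exact supports, and supports can shrink under
  addition and scaling. Allowing finite supersets gives products of different vectors a common index
  set, as the distributive laws require.\<close>

lemma mult_eq_sum:
  assumes f: "f \<in> carrier A" "supp K f \<subseteq> S" "S \<subseteq> B" "finite S"
    and g: "g \<in> carrier A" "supp K g \<subseteq> T" "T \<subseteq> B" "finite T"
  shows "(f \<otimes>\<^bsub>A\<^esub> g) x = (\<Oplus>p\<in>S. \<Oplus>q\<in>T. f p \<otimes> g q \<otimes> \<mu> p q x)"
proof -
  have mu: "\<mu> p q x \<in> carrier K" if "p \<in> S" "q \<in> T" for p q
    using that f g mult_basis_closed coeff_closed by blast
  note fc = coeff_closed[OF f(1)] coeff_closed[OF g(1)] supp_B(2)[OF f(1)] supp_B(2)[OF g(1)]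
  have "(\<Oplus>p\<in>S. \<Oplus>q\<in>T. f p \<otimes> g q \<otimes> \<mu> p q x) = (\<Oplus>p\<in>S. \<Oplus>q\<in>supp K g. f p \<otimes> g q \<otimes> \<mu> p q x)"
    using fc mu g f
    by (intro add.finprod_cong' refl add.finprod_mono_neutral_cong_right)
       (auto simp: coeff_zero intro!: finsum_closed)
  also have "\<dots> = (\<Oplus>p\<in>supp K f. \<Oplus>q\<in>supp K g. f p \<otimes> g q \<otimes> \<mu> p q x)"
    using fc mu g f
    by (intro add.finprod_mono_neutral_cong_right)
       (auto simp: coeff_zero subset_iff intro!: finsum_closed add.finprod_one_eqI)
  finally show ?thesis by (simp add: basis_alg_simps)
qed

lemma mu_coeff: "\<lbrakk>p \<in> B; q \<in> B\<rbrakk> \<Longrightarrow> \<mu> p q x \<in> carrier K"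
  using mult_basis_closed coeff_closed by blast

lemma basis_mult:
  assumes "p \<in> B" "q \<in> B" shows "ind K {p} \<otimes>\<^bsub>A\<^esub> ind K {q} = \<mu> p q"
proof
  fix x
  have "(ind K {p} \<otimes>\<^bsub>A\<^esub> ind K {q}) x = (\<Oplus>p'\<in>{p}. \<Oplus>q'\<in>{q}. ind K {p} p' \<otimes> ind K {q} q' \<otimes> \<mu> p' q' x)"
    using assms by (intro mult_eq_sum basis_closed) (auto simp: supp_def ind_def)
  also have "\<dots> = \<mu> p q x"
    using assms mu_coeff[OF assms] by (simp add: ind_def)
  finally show "(ind K {p} \<otimes>\<^bsub>A\<^esub> ind K {q}) x = \<mu> p q x" .
qed

lemma distr_left:
  assumes "f \<in> carrier A" "g \<in> carrier A" "h \<in> carrier A"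
  shows "(f \<oplus>\<^bsub>A\<^esub> g) \<otimes>\<^bsub>A\<^esub> h = f \<otimes>\<^bsub>A\<^esub> h \<oplus>\<^bsub>A\<^esub> g \<otimes>\<^bsub>A\<^esub> h"
proof
  fix x
  let ?S = "supp K f \<union> supp K g" and ?T = "supp K h"
  note b = supp_B[OF assms(1)] supp_B[OF assms(2)] supp_B[OF assms(3)]
    coeff_closed[OF assms(1)] coeff_closed[OF assms(2)] coeff_closed[OF assms(3)]
  have mu: "\<mu> p q x \<in> carrier K" if "p \<in> ?S" "q \<in> ?T" for p q
    using that b mu_coeff by blast
  have "((f \<oplus>\<^bsub>A\<^esub> g) \<otimes>\<^bsub>A\<^esub> h) x = (\<Oplus>p\<in>?S. \<Oplus>q\<in>?T. (f \<oplus>\<^bsub>A\<^esub> g) p \<otimes> h q \<otimes> \<mu> p q x)"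
    using b by (intro mult_eq_sum add_closed assms) (auto simp: supp_def basis_alg_simps)
  also have "\<dots> = (\<Oplus>p\<in>?S. \<Oplus>q\<in>?T. f p \<otimes> h q \<otimes> \<mu> p q x \<oplus> g p \<otimes> h q \<otimes> \<mu> p q x)"
    using b mu by (intro add.finprod_cong' refl) (auto simp: basis_alg_simps l_distr intro!: finsum_closed)
  also have "\<dots> = (\<Oplus>p\<in>?S. (\<Oplus>q\<in>?T. f p \<otimes> h q \<otimes> \<mu> p q x) \<oplus> (\<Oplus>q\<in>?T. g p \<otimes> h q \<otimes> \<mu> p q x))"
    using b mu by (intro add.finprod_cong' refl finsum_addf) (auto intro!: finsum_closed)
  also have "\<dots> = (\<Oplus>p\<in>?S. \<Oplus>q\<in>?T. f p \<otimes> h q \<otimes> \<mu> p q x) \<oplus> (\<Oplus>p\<in>?S. \<Oplus>q\<in>?T. g p \<otimes> h q \<otimes> \<mu> p q x)"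
    using b mu by (intro finsum_addf) (auto intro!: finsum_closed)
  also have "\<dots> = (f \<otimes>\<^bsub>A\<^esub> h) x \<oplus> (g \<otimes>\<^bsub>A\<^esub> h) x"
    using b by (intro arg_cong2[where f = "add K"] mult_eq_sum[symmetric] assms) auto
  finally show "((f \<oplus>\<^bsub>A\<^esub> g) \<otimes>\<^bsub>A\<^esub> h) x = (f \<otimes>\<^bsub>A\<^esub> h \<oplus>\<^bsub>A\<^esub> g \<otimes>\<^bsub>A\<^esub> h) x"
    by (simp add: basis_alg_simps(4))
qed

lemma distr_right:
  assumes "f \<in> carrier A" "g \<in> carrier A" "h \<in> carrier A"
  shows "h \<otimes>\<^bsub>A\<^esub> (f \<oplus>\<^bsub>A\<^esub> g) = h \<otimes>\<^bsub>A\<^esub> f \<oplus>\<^bsub>A\<^esub> h \<otimes>\<^bsub>A\<^esub> g"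
proof
  fix x
  let ?S = "supp K f \<union> supp K g" and ?T = "supp K h"
  note b = supp_B[OF assms(1)] supp_B[OF assms(2)] supp_B[OF assms(3)]
    coeff_closed[OF assms(1)] coeff_closed[OF assms(2)] coeff_closed[OF assms(3)]
  have mu: "\<mu> q p x \<in> carrier K" if "p \<in> ?S" "q \<in> ?T" for p q
    using that b mu_coeff by blast
  have "(h \<otimes>\<^bsub>A\<^esub> (f \<oplus>\<^bsub>A\<^esub> g)) x = (\<Oplus>p\<in>?T. \<Oplus>q\<in>?S. h p \<otimes> (f \<oplus>\<^bsub>A\<^esub> g) q \<otimes> \<mu> p q x)"
    using b by (intro mult_eq_sum add_closed assms) (auto simp: supp_def basis_alg_simps)
  also have "\<dots> = (\<Oplus>p\<in>?T. \<Oplus>q\<in>?S. h p \<otimes> f q \<otimes> \<mu> p q x \<oplus> h p \<otimes> g q \<otimes> \<mu> p q x)"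
    using b mu by (intro add.finprod_cong' refl) (auto simp: basis_alg_simps l_distr r_distr intro!: finsum_closed)
  also have "\<dots> = (\<Oplus>p\<in>?T. (\<Oplus>q\<in>?S. h p \<otimes> f q \<otimes> \<mu> p q x) \<oplus> (\<Oplus>q\<in>?S. h p \<otimes> g q \<otimes> \<mu> p q x))"
    using b mu by (intro add.finprod_cong' refl finsum_addf) (auto intro!: finsum_closed)
  also have "\<dots> = (\<Oplus>p\<in>?T. \<Oplus>q\<in>?S. h p \<otimes> f q \<otimes> \<mu> p q x) \<oplus> (\<Oplus>p\<in>?T. \<Oplus>q\<in>?S. h p \<otimes> g q \<otimes> \<mu> p q x)"
    using b mu by (intro finsum_addf) (auto intro!: finsum_closed)
  also have "\<dots> = (h \<otimes>\<^bsub>A\<^esub> f) x \<oplus> (h \<otimes>\<^bsub>A\<^esub> g) x"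
    using b by (intro arg_cong2[where f = "add K"] mult_eq_sum[symmetric] assms) auto
  finally show "(h \<otimes>\<^bsub>A\<^esub> (f \<oplus>\<^bsub>A\<^esub> g)) x = (h \<otimes>\<^bsub>A\<^esub> f \<oplus>\<^bsub>A\<^esub> h \<otimes>\<^bsub>A\<^esub> g) x"
    by (simp add: basis_alg_simps(4))
qed

lemma scal_mult:
  assumes a: "a \<in> carrier K" and f: "f \<in> carrier A" and g: "g \<in> carrier A"
  shows "(a \<odot>\<^bsub>A\<^esub> f) \<otimes>\<^bsub>A\<^esub> g = a \<odot>\<^bsub>A\<^esub> (f \<otimes>\<^bsub>A\<^esub> g)"
    and "f \<otimes>\<^bsub>A\<^esub> (a \<odot>\<^bsub>A\<^esub> g) = a \<odot>\<^bsub>A\<^esub> (f \<otimes>\<^bsub>A\<^esub> g)"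
proof -
  let ?S = "supp K f" and ?T = "supp K g"
  note b = supp_B[OF f] supp_B[OF g] coeff_closed[OF f] coeff_closed[OF g]
  have mu: "\<mu> p q x \<in> carrier K" if "p \<in> ?S" "q \<in> ?T" for p q x
    using that b mu_coeff by blast
  have *: "(a \<odot>\<^bsub>A\<^esub> (f \<otimes>\<^bsub>A\<^esub> g)) x = (\<Oplus>p\<in>?S. \<Oplus>q\<in>?T. a \<otimes> (f p \<otimes> g q \<otimes> \<mu> p q x))" for x
  proof -
    have "(a \<odot>\<^bsub>A\<^esub> (f \<otimes>\<^bsub>A\<^esub> g)) x = a \<otimes> (\<Oplus>p\<in>?S. \<Oplus>q\<in>?T. f p \<otimes> g q \<otimes> \<mu> p q x)"
      by (simp add: basis_alg_simps)
    also have "\<dots> = (\<Oplus>p\<in>?S. a \<otimes> (\<Oplus>q\<in>?T. f p \<otimes> g q \<otimes> \<mu> p q x))"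
      using a b mu by (intro finsum_rdistr) (auto intro!: finsum_closed)
    also have "\<dots> = (\<Oplus>p\<in>?S. \<Oplus>q\<in>?T. a \<otimes> (f p \<otimes> g q \<otimes> \<mu> p q x))"
      using a b mu by (intro add.finprod_cong' refl finsum_rdistr) (auto intro!: finsum_closed)
    finally show ?thesis .
  qed
  show "(a \<odot>\<^bsub>A\<^esub> f) \<otimes>\<^bsub>A\<^esub> g = a \<odot>\<^bsub>A\<^esub> (f \<otimes>\<^bsub>A\<^esub> g)"
  proof
    fix x
    have "((a \<odot>\<^bsub>A\<^esub> f) \<otimes>\<^bsub>A\<^esub> g) x = (\<Oplus>p\<in>?S. \<Oplus>q\<in>?T. (a \<odot>\<^bsub>A\<^esub> f) p \<otimes> g q \<otimes> \<mu> p q x)"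
      using a b by (intro mult_eq_sum scal_closed assms) (auto simp: supp_def basis_alg_simps)
    also have "\<dots> = (a \<odot>\<^bsub>A\<^esub> (f \<otimes>\<^bsub>A\<^esub> g)) x" unfolding *
      using a b mu by (intro add.finprod_cong' refl) (auto simp: basis_alg_simps m_ac intro!: finsum_closed)
    finally show "((a \<odot>\<^bsub>A\<^esub> f) \<otimes>\<^bsub>A\<^esub> g) x = (a \<odot>\<^bsub>A\<^esub> (f \<otimes>\<^bsub>A\<^esub> g)) x" .
  qed
  show "f \<otimes>\<^bsub>A\<^esub> (a \<odot>\<^bsub>A\<^esub> g) = a \<odot>\<^bsub>A\<^esub> (f \<otimes>\<^bsub>A\<^esub> g)"
  proof
    fix x
    have "(f \<otimes>\<^bsub>A\<^esub> (a \<odot>\<^bsub>A\<^esub> g)) x = (\<Oplus>p\<in>?S. \<Oplus>q\<in>?T. f p \<otimes> (a \<odot>\<^bsub>A\<^esub> g) q \<otimes> \<mu> p q x)"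
      using a b by (intro mult_eq_sum scal_closed assms) (auto simp: supp_def basis_alg_simps)
    also have "\<dots> = (a \<odot>\<^bsub>A\<^esub> (f \<otimes>\<^bsub>A\<^esub> g)) x" unfolding *
      using a b mu by (intro add.finprod_cong' refl) (auto simp: basis_alg_simps m_ac intro!: finsum_closed)
    finally show "(f \<otimes>\<^bsub>A\<^esub> (a \<odot>\<^bsub>A\<^esub> g)) x = (a \<odot>\<^bsub>A\<^esub> (f \<otimes>\<^bsub>A\<^esub> g)) x" .
  qed
qed

lemma zero_mult: "\<zero>\<^bsub>A\<^esub> \<otimes>\<^bsub>A\<^esub> f = \<zero>\<^bsub>A\<^esub>" and mult_zero: "f \<otimes>\<^bsub>A\<^esub> \<zero>\<^bsub>A\<^esub> = \<zero>\<^bsub>A\<^esub>"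
  by (auto simp: basis_alg_simps supp_def)

lemma mult_closed:
  assumes "f \<in> carrier A" "g \<in> carrier A" shows "f \<otimes>\<^bsub>A\<^esub> g \<in> carrier A"
  using assms(1)
proof (induction rule: basis_induct)
  case (basis p)
  show ?case using assms(2)
    by (induction rule: basis_induct)
       (simp_all add: basis basis_mult mult_basis_closed distr_right scal_mult basis_closed
         add_closed scal_closed mult_zero zero_in_carrier)
qed (simp_all add: zero_mult distr_left scal_mult add_closed scal_closed assms zero_in_carrier)

section \<open>Linear extension of a map given on the basis\<close>

definition lincomb :: "('k, 'c, 'p) module_scheme \<Rightarrow> ('b \<Rightarrow> 'c) \<Rightarrow> ('b \<Rightarrow> 'k) \<Rightarrow> 'c"
  where "lincomb M v f = (\<Oplus>\<^bsub>M\<^esub>p\<in>supp K f. f p \<odot>\<^bsub>M\<^esub> v p)"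

context
  fixes M :: "('k, 'c, 'p) module_scheme" and v :: "'b \<Rightarrow> 'c"
  assumes M: "Module.module K M" and v: "v \<in> B \<rightarrow> carrier M"
begin

interpretation M: Module.module K M by (rule M)

lemma lincomb_eq_sum:
  assumes "f \<in> carrier A" "supp K f \<subseteq> S" "S \<subseteq> B" "finite S"
  shows "lincomb M v f = (\<Oplus>\<^bsub>M\<^esub>p\<in>S. f p \<odot>\<^bsub>M\<^esub> v p)"
  unfolding lincomb_def using assms v coeff_closed[OF assms(1)]
  by (intro M.M.add.finprod_mono_neutral_cong_left) (auto simp: coeff_zero Pi_iff subset_iff)

lemma lincomb_closed: "f \<in> carrier A \<Longrightarrow> lincomb M v f \<in> carrier M"
  unfolding lincomb_def using v
  by (intro M.finsum_closed) (auto simp: carrier_iff Pi_iff subset_iff)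

lemma lincomb_basis: "p \<in> B \<Longrightarrow> lincomb M v (ind K {p}) = v p"
proof -
  assume p: "p \<in> B"
  have "lincomb M v (ind K {p}) = (\<Oplus>\<^bsub>M\<^esub>q\<in>{p}. ind K {p} q \<odot>\<^bsub>M\<^esub> v q)"
    using p by (intro lincomb_eq_sum basis_closed) (auto simp: supp_def ind_def)
  also have "\<dots> = v p" using v p by (auto simp: ind_def Pi_iff)
  finally show ?thesis .
qed

lemma lincomb_add:
  assumes "f \<in> carrier A" "g \<in> carrier A"
  shows "lincomb M v (f \<oplus>\<^bsub>A\<^esub> g) = lincomb M v f \<oplus>\<^bsub>M\<^esub> lincomb M v g"
proof -
  let ?S = "supp K f \<union> supp K g"
  note b = supp_B[OF assms(1)] supp_B[OF assms(2)] coeff_closed[OF assms(1)] coeff_closed[OF assms(2)]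
  have v': "v p \<in> carrier M" if "p \<in> ?S" for p using that b v by auto
  have "lincomb M v (f \<oplus>\<^bsub>A\<^esub> g) = (\<Oplus>\<^bsub>M\<^esub>p\<in>?S. (f \<oplus>\<^bsub>A\<^esub> g) p \<odot>\<^bsub>M\<^esub> v p)"
    using b by (intro lincomb_eq_sum add_closed assms) (auto simp: supp_def basis_alg_simps)
  also have "\<dots> = (\<Oplus>\<^bsub>M\<^esub>p\<in>?S. f p \<odot>\<^bsub>M\<^esub> v p \<oplus>\<^bsub>M\<^esub> g p \<odot>\<^bsub>M\<^esub> v p)"
    using b v' by (intro M.M.add.finprod_cong' refl) (auto simp: basis_alg_simps M.smult_l_distr)
  also have "\<dots> = (\<Oplus>\<^bsub>M\<^esub>p\<in>?S. f p \<odot>\<^bsub>M\<^esub> v p) \<oplus>\<^bsub>M\<^esub> (\<Oplus>\<^bsub>M\<^esub>p\<in>?S. g p \<odot>\<^bsub>M\<^esub> v p)"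
    using b v' by (intro M.finsum_addf) auto
  also have "\<dots> = lincomb M v f \<oplus>\<^bsub>M\<^esub> lincomb M v g"
    using b by (intro arg_cong2[where f = "add M"] lincomb_eq_sum[symmetric] assms) auto
  finally show ?thesis .
qed

lemma lincomb_scal:
  assumes "a \<in> carrier K" "f \<in> carrier A"
  shows "lincomb M v (a \<odot>\<^bsub>A\<^esub> f) = a \<odot>\<^bsub>M\<^esub> lincomb M v f"
proof -
  let ?S = "supp K f"
  note b = supp_B[OF assms(2)] coeff_closed[OF assms(2)]
  have v': "v p \<in> carrier M" if "p \<in> ?S" for p using that b v by auto
  have "lincomb M v (a \<odot>\<^bsub>A\<^esub> f) = (\<Oplus>\<^bsub>M\<^esub>p\<in>?S. (a \<odot>\<^bsub>A\<^esub> f) p \<odot>\<^bsub>M\<^esub> v p)"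
    using b assms(1) by (intro lincomb_eq_sum scal_closed assms) (auto simp: supp_def basis_alg_simps)
  also have "\<dots> = (\<Oplus>\<^bsub>M\<^esub>p\<in>?S. a \<odot>\<^bsub>M\<^esub> (f p \<odot>\<^bsub>M\<^esub> v p))"
    using b v' assms(1) by (intro M.M.add.finprod_cong' refl) (auto simp: basis_alg_simps M.smult_assoc1)
  also have "\<dots> = a \<odot>\<^bsub>M\<^esub> lincomb M v f"
    unfolding lincomb_def using b v' assms(1) by (intro M.finsum_smult_ldistr[symmetric]) auto
  finally show ?thesis .
qed

lemma lincomb_zero: "lincomb M v \<zero>\<^bsub>A\<^esub> = \<zero>\<^bsub>M\<^esub>"
  by (simp add: lincomb_def basis_alg_simps supp_def)

end

lemma ind_eq_finsum:
  assumes "finite S" "S \<subseteq> B"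
  shows "ind K S = (\<Oplus>\<^bsub>A\<^esub>p\<in>S. ind K {p})"
proof -
  interpret M: abelian_group A by (rule abelian)
  show ?thesis using assms
  proof (induction S rule: finite_induct)
    case empty
    then show ?case by (simp add: ind_def basis_alg_simps)
  next
    case (insert p S)
    have "ind K (insert p S) = ind K {p} \<oplus>\<^bsub>A\<^esub> ind K S"
      using insert.hyps(2) by (auto simp: basis_alg_simps(4) ind_def fun_eq_iff)
    also have "\<dots> = (\<Oplus>\<^bsub>A\<^esub>p\<in>insert p S. ind K {p})"
      using insert basis_closed by (subst M.finsum_insert) auto
    finally show ?case .
  qed
qed

end

text \<open>Kept apart from \<open>based_bilinear\<close> because the bilinear laws already serve to
  verify these axioms for \<open>R\<close>. By multilinearity, associativity and the unit laws are
  needed on basis vectors only.\<close>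

locale based_algebra = based_bilinear +
  assumes unit_closed: "u \<in> carrier A"
    and basis_assoc: "\<lbrakk>p \<in> B; q \<in> B; r \<in> B\<rbrakk> \<Longrightarrow>
      \<mu> p q \<otimes>\<^bsub>A\<^esub> ind K {r} = ind K {p} \<otimes>\<^bsub>A\<^esub> \<mu> q r"
    and basis_l_one: "p \<in> B \<Longrightarrow> u \<otimes>\<^bsub>A\<^esub> ind K {p} = ind K {p}"
    and basis_r_one: "p \<in> B \<Longrightarrow> ind K {p} \<otimes>\<^bsub>A\<^esub> u = ind K {p}"
begin

lemma mult_assoc:
  assumes f: "f \<in> carrier A" and g: "g \<in> carrier A" and h: "h \<in> carrier A"
  shows "(f \<otimes>\<^bsub>A\<^esub> g) \<otimes>\<^bsub>A\<^esub> h = f \<otimes>\<^bsub>A\<^esub> (g \<otimes>\<^bsub>A\<^esub> h)"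
  using f
proof (induction rule: basis_induct)
  case p: (basis p)
  show ?case using g
  proof (induction rule: basis_induct)
    case q: (basis q)
    show ?case using h
      by (induction rule: basis_induct)
       (simp_all add: p q basis_mult mult_basis_closed distr_right scal_mult basis_closed
         mult_closed mult_zero basis_assoc)
  qed (simp_all add: p h distr_left distr_right scal_mult basis_closed
         mult_closed mult_zero zero_mult)
qed (simp_all add: g h distr_left distr_right scal_mult basis_closed
         mult_closed mult_zero zero_mult)

lemma unital_algebra: "unital_algebra K A"
proof -
  have "Group.monoid A"
  proof (rule monoidI)
    fix f assume f: "f \<in> carrier A"
    show "\<one>\<^bsub>A\<^esub> \<otimes>\<^bsub>A\<^esub> f = f" unfolding basis_alg_simps(2) using f
      by (induction rule: basis_induct)
         (simp_all add: unit_closed mult_zero basis_l_one distr_right scal_mult)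
    show "f \<otimes>\<^bsub>A\<^esub> \<one>\<^bsub>A\<^esub> = f" unfolding basis_alg_simps(2) using f
      by (induction rule: basis_induct)
         (simp_all add: unit_closed zero_mult basis_r_one distr_left scal_mult)
  qed (simp_all add: mult_closed mult_assoc basis_alg_simps(2) unit_closed)
  then have "ring A" by (rule ringI[OF abelian]) (simp_all add: distr_left distr_right)
  then show ?thesis
    by (intro unital_algebra.intro module unital_algebra_axioms.intro) (simp_all add: scal_mult)
qed

text \<open>Both sides of the multiplicativity equation are bilinear, so pairs of basis vectors
  suffice as a test.\<close>

lemma lincomb_alg_hom:
  assumes C: "unital_algebra K C" and v: "v \<in> B \<rightarrow> carrier C"
    and mult: "\<And>p q. \<lbrakk>p \<in> B; q \<in> B\<rbrakk> \<Longrightarrow> lincomb C v (\<mu> p q) = v p \<otimes>\<^bsub>C\<^esub> v q"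
    and one: "lincomb C v u = \<one>\<^bsub>C\<^esub>"
  shows "lincomb C v \<in> alg_hom K A C"
proof -
  interpret C: unital_algebra K C by (rule C)
  have M: "Module.module K C" by (rule C.module_axioms)
  note L = lincomb_closed[OF M v] lincomb_add[OF M v] lincomb_scal[OF M v] lincomb_zero
    lincomb_basis[OF M v]
  have "lincomb C v (f \<otimes>\<^bsub>A\<^esub> g) = lincomb C v f \<otimes>\<^bsub>C\<^esub> lincomb C v g"
    if f: "f \<in> carrier A" and g: "g \<in> carrier A" for f g
    using f
  proof (induction rule: basis_induct)
    case p: (basis p)
    show ?case using g
      by (induction rule: basis_induct)
        (simp_all add: p L mult basis_mult distr_right scal_mult basis_closed mult_closed
          mult_zero funcset_mem[OF v] C.smult_mult_right C.r_distr lincomb_zero[OF M v])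
  qed (simp_all add: g L distr_left scal_mult basis_closed mult_closed
          zero_mult C.smult_mult_left C.l_distr lincomb_zero[OF M v])
  then show ?thesis unfolding alg_hom_def
    by (auto intro!: ring_hom_memI simp: L one basis_alg_simps(2))
qed

end


section \<open>Quotients, free algebras and the universal property\<close>

lemma alg_homD:
  assumes "f \<in> alg_hom K A C"
  shows "x \<in> carrier A \<Longrightarrow> f x \<in> carrier C"
    and "\<lbrakk>x \<in> carrier A; y \<in> carrier A\<rbrakk> \<Longrightarrow> f (x \<otimes>\<^bsub>A\<^esub> y) = f x \<otimes>\<^bsub>C\<^esub> f y"
    and "\<lbrakk>x \<in> carrier A; y \<in> carrier A\<rbrakk> \<Longrightarrow> f (x \<oplus>\<^bsub>A\<^esub> y) = f x \<oplus>\<^bsub>C\<^esub> f y"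
    and "f \<one>\<^bsub>A\<^esub> = \<one>\<^bsub>C\<^esub>"
    and "\<lbrakk>a \<in> carrier K; x \<in> carrier A\<rbrakk> \<Longrightarrow> f (a \<odot>\<^bsub>A\<^esub> x) = a \<odot>\<^bsub>C\<^esub> f x"
  using assms by (auto simp: alg_hom_def ring_hom_closed ring_hom_mult ring_hom_add ring_hom_one)

lemma alg_hom_ring_hom_ring:
  assumes "unital_algebra K A" "unital_algebra K C" "f \<in> alg_hom K A C"
  shows "ring_hom_ring A C f"
  using assms by (intro ring_hom_ringI2 unital_algebra.axioms(2)) (auto simp: alg_hom_def)

context unital_algebra begin

text \<open>\<open>Idl\<close> yields an ideal of the underlying ring; it is closed under scalars
  because these act through multiples of the unit.\<close>

lemma ideal_smult_closed:
  assumes "ideal I A" "a \<in> carrier K" "i \<in> I" shows "a \<odot>\<^bsub>A\<^esub> i \<in> I"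
proof -
  interpret I: ideal I A by (rule assms)
  have i: "i \<in> carrier A" using assms(3) by (rule I.a_Hcarr)
  have "a \<odot>\<^bsub>A\<^esub> i = (a \<odot>\<^bsub>A\<^esub> \<one>\<^bsub>A\<^esub>) \<otimes>\<^bsub>A\<^esub> i" using assms i by (simp add: smult_mult_left)
  then show ?thesis using assms by (simp add: I.I_l_closed)
qed

text \<open>The scalar multiple of a coset is defined as a union over all representatives. They all
  give the same coset, since two of them differ by an element of \<open>I\<close> and
  \<open>I\<close> is closed under scalars.\<close>

lemma quot_alg_smult:
  assumes "ideal I A" "a \<in> carrier K" "x \<in> carrier A"
  shows "a \<odot>\<^bsub>quot_alg A I\<^esub> (I +>\<^bsub>A\<^esub> x) = I +>\<^bsub>A\<^esub> (a \<odot>\<^bsub>A\<^esub> x)"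
proof -
  interpret I: ideal I A by (rule assms)
  have eq: "I +>\<^bsub>A\<^esub> (a \<odot>\<^bsub>A\<^esub> y) = I +>\<^bsub>A\<^esub> (a \<odot>\<^bsub>A\<^esub> x)" if y: "y \<in> I +>\<^bsub>A\<^esub> x" for y
  proof -
    obtain i where i: "i \<in> I" "y = i \<oplus>\<^bsub>A\<^esub> x" using y by (auto simp: a_r_coset_def r_coset_def)
    have "a \<odot>\<^bsub>A\<^esub> y = a \<odot>\<^bsub>A\<^esub> i \<oplus>\<^bsub>A\<^esub> a \<odot>\<^bsub>A\<^esub> x"
      using i assms I.a_Hcarr by (simp add: smult_r_distr)
    then have "a \<odot>\<^bsub>A\<^esub> y \<in> I +>\<^bsub>A\<^esub> (a \<odot>\<^bsub>A\<^esub> x)"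
      using ideal_smult_closed[OF assms(1,2) i(1)] by (auto simp: a_r_coset_def r_coset_def)
    then show ?thesis
      by (rule M.a_repr_independence[OF _ _ I.a_subgroup, symmetric]) (use assms in simp)
  qed
  have "x \<in> I +>\<^bsub>A\<^esub> x" using assms by (intro I.a_rcos_self)
  then have "(\<Union>y\<in>I +>\<^bsub>A\<^esub> x. I +>\<^bsub>A\<^esub> (a \<odot>\<^bsub>A\<^esub> y)) = I +>\<^bsub>A\<^esub> (a \<odot>\<^bsub>A\<^esub> x)"
    by (rule UN_constant_eq) (rule ballI, rule eq)
  then show ?thesis by (simp add: quot_alg_def)
qed

lemma quot_alg_unital_algebra:
  assumes "ideal I A"
  shows "unital_algebra K (quot_alg A I)" (is ?thesis1)
    and "(\<lambda>x. I +>\<^bsub>A\<^esub> x) \<in> alg_hom K A (quot_alg A I)" (is ?thesis2)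
    and "carrier (quot_alg A I) = (\<lambda>x. I +>\<^bsub>A\<^esub> x) ` carrier A" (is ?thesis3)
proof -
  interpret I: ideal I A by (rule assms)
  let ?Q = "quot_alg A I" and ?q = "\<lambda>x. I +>\<^bsub>A\<^esub> x"
  have ops: "mult ?Q = mult (A Quot I)" "one ?Q = one (A Quot I)" "zero ?Q = zero (A Quot I)"
    "add ?Q = add (A Quot I)" "carrier ?Q = carrier (A Quot I)"
    by (simp_all add: quot_alg_def)
  show car: ?thesis3 unfolding ops by (auto simp: FactRing_def A_RCOSETS_def RCOSETS_def a_r_coset_def)
  interpret AI: ring "A Quot I" by (rule I.quotient_is_ring)
  have "ring ?Q"
  proof (rule ringI)
    show "abelian_group ?Q"
      by (rule abelian_groupI)
        (simp_all add: ops AI.a_assoc AI.a_comm AI.add.l_inv_ex AI.add.m_lcomm)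
    show "Group.monoid ?Q"
      by (rule monoidI) (simp_all add: ops AI.m_assoc)
  qed (simp_all add: ops AI.l_distr AI.r_distr)
  have qr: "?q \<in> ring_hom A ?Q"
    using I.rcos_ring_hom by (simp add: ring_hom_def ops)
  note q = ring_hom_mult[OF qr, symmetric] ring_hom_add[OF qr, symmetric] quot_alg_smult[OF assms]
  show ?thesis2 using qr q by (auto simp: alg_hom_def)
  interpret Q: ring ?Q by fact
  have "Module.module K ?Q"
    by (rule moduleI)
      (auto simp: car q smult_l_distr smult_r_distr smult_assoc1
        intro!: R.is_cring Q.is_abelian_group)
  then show ?thesis1
    by (intro unital_algebra.intro unital_algebra_axioms.intro \<open>ring ?Q\<close>)
      (auto simp: car q smult_mult_left smult_mult_right)
qed

lemma quot_alg_lift: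
  assumes "ideal I A" "unital_algebra K C" "f \<in> alg_hom K A C" "\<And>i. i \<in> I \<Longrightarrow> f i = \<zero>\<^bsub>C\<^esub>"
  shows "\<exists>\<psi>\<in>alg_hom K (quot_alg A I) C. \<forall>x\<in>carrier A. \<psi> (I +>\<^bsub>A\<^esub> x) = f x"
proof -
  interpret I: ideal I A by (rule assms)
  interpret C: unital_algebra K C by (rule assms)
  let ?Q = "quot_alg A I" and ?q = "\<lambda>x. I +>\<^bsub>A\<^esub> x"
  \<comment> \<open>An arbitrary representative is chosen; the value does not depend on it because
    \<open>f\<close> vanishes on \<open>I\<close>.\<close>
  define \<psi> where "\<psi> X = f (SOME x. x \<in> X)" for X
  note f = alg_homD[OF assms(3)]
  note Q = quot_alg_unital_algebra[OF assms(1)]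
  note q = alg_homD(2-5)[OF Q(2), symmetric]
  have \<psi>: "\<psi> (?q x) = f x" if x: "x \<in> carrier A" for x
  proof -
    have "x \<in> ?q x" using x by (rule I.a_rcos_self)
    then have "(SOME y. y \<in> ?q x) \<in> ?q x" by (rule someI)
    then obtain i where i: "i \<in> I" "(SOME y. y \<in> ?q x) = i \<oplus>\<^bsub>A\<^esub> x"
      by (auto simp: a_r_coset_def r_coset_def)
    have "f (i \<oplus>\<^bsub>A\<^esub> x) = f x" using i(1) x I.a_Hcarr assms(4) by (simp add: f)
    then show ?thesis by (simp add: \<psi>_def i(2))
  qed
  have "\<psi> \<in> alg_hom K ?Q C"
    unfolding alg_hom_def ring_hom_def Pi_iff
    by (auto simp: Q(3) q \<psi> f)
  then show ?thesis using \<psi> by blast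
qed

end

lemma free_alg_based:
  assumes "cring K"
  shows "based_algebra K (lists X) (\<lambda>v w. ind K {v @ w}) (ind K {[]}) (free_alg K X)"
proof -
  interpret K: cring K by (rule assms)
  have ind: "ind K {w} \<in> carrier (free_alg K X)" if "w \<in> lists X" for w
  proof -
    have "supp K (ind K {w}) \<subseteq> {w}" by (auto simp: supp_def ind_def)
    with that show ?thesis
      by (auto simp: free_alg_def basis_alg_def ind_def intro: finite_subset)
  qed
  \<comment> \<open>A \<open>cring\<close> may be the zero ring, where \<open>ind K {w}\<close> has
    empty support; otherwise the support is \<open>{w}\<close> and the sums have one term.\<close>
  have mult: "ind K {v} \<otimes>\<^bsub>free_alg K X\<^esub> ind K {w} = ind K {v @ w}" for v w
  proof (cases "\<one>\<^bsub>K\<^esub> = \<zero>\<^bsub>K\<^esub>")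
    case True
    then show ?thesis by (auto simp: free_alg_def basis_alg_def ind_def supp_def)
  next
    case False
    then have "supp K (ind K {w}) = {w}" for w :: "'c list" by (auto simp: supp_def ind_def)
    then show ?thesis by (simp add: free_alg_def basis_alg_def fun_eq_iff) (simp add: ind_def)
  qed
  show ?thesis
    by (intro based_algebra.intro based_bilinear.intro based_bilinear_axioms.intro
        based_algebra_axioms.intro assms free_alg_def) (simp_all add: ind mult)
qed

lemma free_alg_lift:
  assumes K: "cring K" and C: "unital_algebra K C" and x: "x \<in> X \<rightarrow> carrier C"
  shows "\<exists>f\<in>alg_hom K (free_alg K X) C. \<forall>a\<in>X. f (free_gen K a) = x a"
proof -
  interpret F: based_algebra K "lists X" "\<lambda>v w. ind K {v @ w}" "ind K {[]}" "free_alg K X"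
    by (rule free_alg_based[OF K])
  interpret C: unital_algebra K C by (rule C)
  define v where "v w = foldr (\<lambda>a z. x a \<otimes>\<^bsub>C\<^esub> z) w \<one>\<^bsub>C\<^esub>" for w
  have v: "v w \<in> carrier C" if "w \<in> lists X" for w
    using that x by (induction w) (auto simp: v_def Pi_iff)
  then have vB: "v \<in> lists X \<rightarrow> carrier C" by blast
  have app: "v (w @ w') = v w \<otimes>\<^bsub>C\<^esub> v w'" if "w \<in> lists X" "w' \<in> lists X" for w w'
    using that(1)
  proof (induction w)
    case Nil
    then show ?case using v[OF that(2)] by (simp add: v_def)
  next
    case (Cons a w)
    then show ?case using v[OF that(2)] v[OF Cons.hyps(2)] x by (simp add: v_def C.m_assoc Pi_iff)
  qed
  note basis = F.lincomb_basis[OF C.module_axioms vB]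
  have "F.lincomb C v \<in> alg_hom K (free_alg K X) C"
    by (intro F.lincomb_alg_hom C vB) (simp_all add: basis app, simp add: v_def)
  moreover have "F.lincomb C v (free_gen K a) = x a" if "a \<in> X" for a
    using that x by (auto simp: free_gen_def basis) (simp add: v_def Pi_iff)
  ultimately show ?thesis by blast
qed

text \<open>The relations are imposed on arbitrary elements of an arbitrary algebra, so that the
  results apply to the generators of the presented algebra as well as to their intended images in
  \<open>R\<close>.\<close>

locale tpg_rep = unital_algebra K A + G: group G
  for A :: "('k, 'a, 'p) module_scheme" (structure) and K :: "('k, 'm) ring_scheme"
    and G :: "('g, 'n) monoid_scheme" +
  fixes \<sigma> :: "'g \<Rightarrow> 'g \<Rightarrow> 'k" and x :: "'g \<Rightarrow> 'a"
  assumes sigma_closed: "\<lbrakk>g \<in> carrier G; h \<in> carrier G\<rbrakk> \<Longrightarrow> \<sigma> g h \<in> carrier K"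
    and x_closed: "g \<in> carrier G \<Longrightarrow> x g \<in> carrier A"
    and x_one: "x \<one>\<^bsub>G\<^esub> = \<one>"
    and zero_left: "\<lbrakk>g \<in> carrier G; h \<in> carrier G; \<sigma> g h = \<zero>\<^bsub>K\<^esub>\<rbrakk> \<Longrightarrow>
      x (inv\<^bsub>G\<^esub> g) \<otimes> x (g \<otimes>\<^bsub>G\<^esub> h) = \<zero>"
    and zero_right: "\<lbrakk>g \<in> carrier G; h \<in> carrier G; \<sigma> g h = \<zero>\<^bsub>K\<^esub>\<rbrakk> \<Longrightarrow>
      x (g \<otimes>\<^bsub>G\<^esub> h) \<otimes> x (inv\<^bsub>G\<^esub> h) = \<zero>"
    and rel_left: "\<lbrakk>g \<in> carrier G; h \<in> carrier G\<rbrakk> \<Longrightarrow>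
      x (inv\<^bsub>G\<^esub> g) \<otimes> x g \<otimes> x h = \<sigma> g h \<odot> (x (inv\<^bsub>G\<^esub> g) \<otimes> x (g \<otimes>\<^bsub>G\<^esub> h))"
    and rel_right: "\<lbrakk>g \<in> carrier G; h \<in> carrier G\<rbrakk> \<Longrightarrow>
      x g \<otimes> x h \<otimes> x (inv\<^bsub>G\<^esub> h) = \<sigma> g h \<odot> (x (g \<otimes>\<^bsub>G\<^esub> h) \<otimes> x (inv\<^bsub>G\<^esub> h))"

locale tpg_presentation = cring K + G: group G
  for K :: "('k, 'm) ring_scheme" and G :: "('g, 'n) monoid_scheme" +
  fixes \<sigma> :: "'g \<Rightarrow> 'g \<Rightarrow> 'k"
  assumes sigma_closed: "\<lbrakk>g \<in> carrier G; h \<in> carrier G\<rbrakk> \<Longrightarrow> \<sigma> g h \<in> carrier K"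
begin

abbreviation "F \<equiv> free_alg K (carrier G)"
abbreviation "I \<equiv> tpg_ideal K G \<sigma>"
abbreviation "P \<equiv> tpg_alg K G \<sigma>"
abbreviation "gen \<equiv> tpg_gen K G \<sigma>"

sublocale F: based_algebra K "lists (carrier G)" "\<lambda>v w. ind K {v @ w}" "ind K {[]}" F
  by (rule free_alg_based) (rule is_cring)

sublocale FA: unital_algebra K F
  by (rule F.unital_algebra)

lemma free_gen_closed: "g \<in> carrier G \<Longrightarrow> free_gen K g \<in> carrier F"
  by (simp add: free_gen_def F.basis_closed)

lemma relators_closed: "tpg_relators K G \<sigma> \<subseteq> carrier F"
  unfolding tpg_relators_def Let_def
  by (auto simp: free_gen_closed sigma_closed intro!: FA.m_closed FA.smult_closed FA.M.minus_closed)

lemma relatorsI: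
  assumes "g \<in> carrier G" "h \<in> carrier G"
  shows "\<sigma> g h = \<zero>\<^bsub>K\<^esub> \<Longrightarrow>
      free_gen K (inv\<^bsub>G\<^esub> g) \<otimes>\<^bsub>F\<^esub> free_gen K (g \<otimes>\<^bsub>G\<^esub> h) \<in> tpg_relators K G \<sigma>"
    and "\<sigma> g h = \<zero>\<^bsub>K\<^esub> \<Longrightarrow>
      free_gen K (g \<otimes>\<^bsub>G\<^esub> h) \<otimes>\<^bsub>F\<^esub> free_gen K (inv\<^bsub>G\<^esub> h) \<in> tpg_relators K G \<sigma>"
    and "(free_gen K (inv\<^bsub>G\<^esub> g) \<otimes>\<^bsub>F\<^esub> free_gen K g \<otimes>\<^bsub>F\<^esub> free_gen K h) \<ominus>\<^bsub>F\<^esub>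
      (\<sigma> g h \<odot>\<^bsub>F\<^esub> (free_gen K (inv\<^bsub>G\<^esub> g) \<otimes>\<^bsub>F\<^esub> free_gen K (g \<otimes>\<^bsub>G\<^esub> h)))
      \<in> tpg_relators K G \<sigma>"
    and "(free_gen K g \<otimes>\<^bsub>F\<^esub> free_gen K h \<otimes>\<^bsub>F\<^esub> free_gen K (inv\<^bsub>G\<^esub> h)) \<ominus>\<^bsub>F\<^esub>
      (\<sigma> g h \<odot>\<^bsub>F\<^esub> (free_gen K (g \<otimes>\<^bsub>G\<^esub> h) \<otimes>\<^bsub>F\<^esub> free_gen K (inv\<^bsub>G\<^esub> h)))
      \<in> tpg_relators K G \<sigma>"
    and "free_gen K \<one>\<^bsub>G\<^esub> \<ominus>\<^bsub>F\<^esub> \<one>\<^bsub>F\<^esub> \<in> tpg_relators K G \<sigma>"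
  unfolding tpg_relators_def Let_def using assms by blast+

lemma relators_cases:
  assumes r: "r \<in> tpg_relators K G \<sigma>"
    and 1: "\<And>g h. \<lbrakk>g \<in> carrier G; h \<in> carrier G; \<sigma> g h = \<zero>\<^bsub>K\<^esub>\<rbrakk> \<Longrightarrow>
      Q (free_gen K (inv\<^bsub>G\<^esub> g) \<otimes>\<^bsub>F\<^esub> free_gen K (g \<otimes>\<^bsub>G\<^esub> h))"
    and 2: "\<And>g h. \<lbrakk>g \<in> carrier G; h \<in> carrier G; \<sigma> g h = \<zero>\<^bsub>K\<^esub>\<rbrakk> \<Longrightarrow>
      Q (free_gen K (g \<otimes>\<^bsub>G\<^esub> h) \<otimes>\<^bsub>F\<^esub> free_gen K (inv\<^bsub>G\<^esub> h))"
    and 3: "\<And>g h. \<lbrakk>g \<in> carrier G; h \<in> carrier G\<rbrakk> \<Longrightarrow>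
      Q ((free_gen K (inv\<^bsub>G\<^esub> g) \<otimes>\<^bsub>F\<^esub> free_gen K g \<otimes>\<^bsub>F\<^esub> free_gen K h) \<ominus>\<^bsub>F\<^esub>
        (\<sigma> g h \<odot>\<^bsub>F\<^esub> (free_gen K (inv\<^bsub>G\<^esub> g) \<otimes>\<^bsub>F\<^esub> free_gen K (g \<otimes>\<^bsub>G\<^esub> h))))"
    and 4: "\<And>g h. \<lbrakk>g \<in> carrier G; h \<in> carrier G\<rbrakk> \<Longrightarrow>
      Q ((free_gen K g \<otimes>\<^bsub>F\<^esub> free_gen K h \<otimes>\<^bsub>F\<^esub> free_gen K (inv\<^bsub>G\<^esub> h)) \<ominus>\<^bsub>F\<^esub>
        (\<sigma> g h \<odot>\<^bsub>F\<^esub> (free_gen K (g \<otimes>\<^bsub>G\<^esub> h) \<otimes>\<^bsub>F\<^esub> free_gen K (inv\<^bsub>G\<^esub> h))))"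
    and 5: "\<And>g. g \<in> carrier G \<Longrightarrow>
      Q ((free_gen K g \<otimes>\<^bsub>F\<^esub> free_gen K \<one>\<^bsub>G\<^esub>) \<ominus>\<^bsub>F\<^esub> free_gen K g)"
    and 6: "\<And>g. g \<in> carrier G \<Longrightarrow>
      Q ((free_gen K \<one>\<^bsub>G\<^esub> \<otimes>\<^bsub>F\<^esub> free_gen K g) \<ominus>\<^bsub>F\<^esub> free_gen K g)"
    and 7: "Q (free_gen K \<one>\<^bsub>G\<^esub> \<ominus>\<^bsub>F\<^esub> \<one>\<^bsub>F\<^esub>)"
  shows "Q r"
  using r unfolding tpg_relators_def Let_def Un_iff mem_Collect_eq singleton_iff
  by - (elim disjE exE conjE; hypsubst, rule 1 2 3 4 5 6 7; assumption)

lemma tpg_ideal: "ideal I F"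
  unfolding tpg_ideal_def by (rule FA.genideal_ideal[OF relators_closed])

lemma relator_in_ideal: "r \<in> tpg_relators K G \<sigma> \<Longrightarrow> r \<in> I"
  unfolding tpg_ideal_def using FA.genideal_self[OF relators_closed] by blast

lemmas tpg_quot = FA.quot_alg_unital_algebra[OF tpg_ideal, folded tpg_alg_def]

sublocale PA: unital_algebra K P
  by (rule tpg_quot)

lemma gen_eq: "gen g = I +>\<^bsub>F\<^esub> free_gen K g"
  by (simp add: tpg_gen_def)

lemma tpg_alg_rep: "tpg_rep P K G \<sigma> gen"
proof -
  interpret I: ideal I F by (rule tpg_ideal)
  note q = alg_homD[OF tpg_quot(2)]
  have zero: "I +>\<^bsub>F\<^esub> r = \<zero>\<^bsub>P\<^esub>" if "r \<in> tpg_relators K G \<sigma>" for r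
    using relator_in_ideal[OF that] FA.M.a_coset_join2[of r] I.a_Hcarr
    by (simp add: tpg_alg_def quot_alg_def FactRing_def I.a_subgroup)
  have eq: "I +>\<^bsub>F\<^esub> a = I +>\<^bsub>F\<^esub> b"
    if ab: "a \<ominus>\<^bsub>F\<^esub> b \<in> tpg_relators K G \<sigma>" "a \<in> carrier F" "b \<in> carrier F" for a b
  proof -
    have "a = (a \<ominus>\<^bsub>F\<^esub> b) \<oplus>\<^bsub>F\<^esub> b"
      using ab(2,3) by (simp add: a_minus_def FA.M.a_assoc FA.M.l_neg)
    then have "I +>\<^bsub>F\<^esub> a = (I +>\<^bsub>F\<^esub> (a \<ominus>\<^bsub>F\<^esub> b)) \<oplus>\<^bsub>P\<^esub> (I +>\<^bsub>F\<^esub> b)"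
      using ab(2,3) q(3)[of "a \<ominus>\<^bsub>F\<^esub> b" b] by simp
    then show ?thesis using zero[OF ab(1)] q(1)[OF ab(3)] by simp
  qed
  show ?thesis
  proof unfold_locales
    show "gen \<one>\<^bsub>G\<^esub> = \<one>\<^bsub>P\<^esub>" unfolding gen_eq q(4)[symmetric]
      by (rule eq[OF relatorsI(5)[OF G.one_closed G.one_closed]]) (simp_all add: free_gen_closed)
    fix g h assume g: "g \<in> carrier G" and h: "h \<in> carrier G"
    show "gen (inv\<^bsub>G\<^esub> g) \<otimes>\<^bsub>P\<^esub> gen g \<otimes>\<^bsub>P\<^esub> gen h
        = \<sigma> g h \<odot>\<^bsub>P\<^esub> (gen (inv\<^bsub>G\<^esub> g) \<otimes>\<^bsub>P\<^esub> gen (g \<otimes>\<^bsub>G\<^esub> h))"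
      using g h eq[OF relatorsI(3)[OF g h]] by (simp add: gen_eq q free_gen_closed sigma_closed)
    show "gen g \<otimes>\<^bsub>P\<^esub> gen h \<otimes>\<^bsub>P\<^esub> gen (inv\<^bsub>G\<^esub> h)
        = \<sigma> g h \<odot>\<^bsub>P\<^esub> (gen (g \<otimes>\<^bsub>G\<^esub> h) \<otimes>\<^bsub>P\<^esub> gen (inv\<^bsub>G\<^esub> h))"
      using g h eq[OF relatorsI(4)[OF g h]] by (simp add: gen_eq q free_gen_closed sigma_closed)
    assume s: "\<sigma> g h = \<zero>\<^bsub>K\<^esub>"
    show "gen (inv\<^bsub>G\<^esub> g) \<otimes>\<^bsub>P\<^esub> gen (g \<otimes>\<^bsub>G\<^esub> h) = \<zero>\<^bsub>P\<^esub>"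
      using g h zero[OF relatorsI(1)[OF g h s]] by (simp add: gen_eq q free_gen_closed)
    show "gen (g \<otimes>\<^bsub>G\<^esub> h) \<otimes>\<^bsub>P\<^esub> gen (inv\<^bsub>G\<^esub> h) = \<zero>\<^bsub>P\<^esub>"
      using g h zero[OF relatorsI(2)[OF g h s]] by (simp add: gen_eq q free_gen_closed)
  qed (simp_all add: sigma_closed gen_eq q free_gen_closed)
qed

text \<open>The kernel of the induced map on the free algebra is an ideal that contains every
  relator, hence the ideal they generate, and the map descends to the quotient.\<close>

lemma tpg_lift:
  assumes "tpg_rep C K G \<sigma> x"
  shows "\<exists>\<psi>\<in>alg_hom K P C. \<forall>g\<in>carrier G. \<psi> (gen g) = x g"
proof -
  interpret C: tpg_rep C K G \<sigma> x by (rule assms)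
  have CA: "unital_algebra K C" by (rule C.unital_algebra_axioms)
  obtain f where f: "f \<in> alg_hom K F C" and fg: "\<And>g. g \<in> carrier G \<Longrightarrow> f (free_gen K g) = x g"
    using free_alg_lift[OF is_cring CA, of x "carrier G"] C.x_closed by blast
  interpret f: ring_hom_ring F C f
    by (rule alg_hom_ring_hom_ring[OF F.unital_algebra CA f])
  note fs = alg_homD[OF f]
  have sub: "f (a \<ominus>\<^bsub>F\<^esub> b) = \<zero>\<^bsub>C\<^esub>" if "a \<in> carrier F" "b \<in> carrier F" "f a = f b" for a b
    using that by (simp add: a_minus_def fs(3) C.M.r_neg)
  note cl = free_gen_closed sigma_closed fg fs(2,4,5) C.x_one
  have "f r = \<zero>\<^bsub>C\<^esub>" if "r \<in> tpg_relators K G \<sigma>" for r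
    using that
  proof (rule relators_cases)
    fix g h assume gh: "g \<in> carrier G" "h \<in> carrier G"
    note rels = C.rel_left[OF gh] C.rel_right[OF gh]
    show "f ((free_gen K (inv\<^bsub>G\<^esub> g) \<otimes>\<^bsub>F\<^esub> free_gen K g \<otimes>\<^bsub>F\<^esub> free_gen K h) \<ominus>\<^bsub>F\<^esub>
        (\<sigma> g h \<odot>\<^bsub>F\<^esub> (free_gen K (inv\<^bsub>G\<^esub> g) \<otimes>\<^bsub>F\<^esub> free_gen K (g \<otimes>\<^bsub>G\<^esub> h)))) = \<zero>\<^bsub>C\<^esub>"
      "f ((free_gen K g \<otimes>\<^bsub>F\<^esub> free_gen K h \<otimes>\<^bsub>F\<^esub> free_gen K (inv\<^bsub>G\<^esub> h)) \<ominus>\<^bsub>F\<^esub>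
        (\<sigma> g h \<odot>\<^bsub>F\<^esub> (free_gen K (g \<otimes>\<^bsub>G\<^esub> h) \<otimes>\<^bsub>F\<^esub> free_gen K (inv\<^bsub>G\<^esub> h)))) = \<zero>\<^bsub>C\<^esub>"
      by (rule sub; use gh rels in \<open>simp add: cl\<close>)+
    show "f ((free_gen K g \<otimes>\<^bsub>F\<^esub> free_gen K \<one>\<^bsub>G\<^esub>) \<ominus>\<^bsub>F\<^esub> free_gen K g) = \<zero>\<^bsub>C\<^esub>"
      "f ((free_gen K \<one>\<^bsub>G\<^esub> \<otimes>\<^bsub>F\<^esub> free_gen K g) \<ominus>\<^bsub>F\<^esub> free_gen K g) = \<zero>\<^bsub>C\<^esub>"
      by (rule sub; use gh C.x_closed[OF gh(1)] in \<open>simp add: cl\<close>)+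
    assume s: "\<sigma> g h = \<zero>\<^bsub>K\<^esub>"
    show "f (free_gen K (inv\<^bsub>G\<^esub> g) \<otimes>\<^bsub>F\<^esub> free_gen K (g \<otimes>\<^bsub>G\<^esub> h)) = \<zero>\<^bsub>C\<^esub>"
      "f (free_gen K (g \<otimes>\<^bsub>G\<^esub> h) \<otimes>\<^bsub>F\<^esub> free_gen K (inv\<^bsub>G\<^esub> h)) = \<zero>\<^bsub>C\<^esub>"
      using gh C.zero_left[OF gh s] C.zero_right[OF gh s] by (simp_all add: cl)
  next
    show "f (free_gen K \<one>\<^bsub>G\<^esub> \<ominus>\<^bsub>F\<^esub> \<one>\<^bsub>F\<^esub>) = \<zero>\<^bsub>C\<^esub>"
      by (rule sub; simp add: cl)
  qed
  then have "tpg_relators K G \<sigma> \<subseteq> a_kernel F C f"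
    using relators_closed unfolding a_kernel_def' by blast
  then have "I \<subseteq> a_kernel F C f" unfolding tpg_ideal_def
    by (rule FA.genideal_minimal[OF f.kernel_is_ideal])
  then have "f i = \<zero>\<^bsub>C\<^esub>" if "i \<in> I" for i
    using that unfolding a_kernel_def' by blast
  from FA.quot_alg_lift[OF tpg_ideal CA f this]
  obtain \<psi> where "\<psi> \<in> alg_hom K P C" "\<forall>y\<in>carrier F. \<psi> (I +>\<^bsub>F\<^esub> y) = f y"
    unfolding tpg_alg_def by blast
  then have "\<psi> (gen g) = x g" if "g \<in> carrier G" for g
    using that unfolding gen_eq by (simp add: free_gen_closed fg)
  with \<open>\<psi> \<in> alg_hom K P C\<close> show ?thesis by blast
qed

text \<open>Words arise by prepending letters to the empty word, whose coset is the unit. The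
  one-sided form suits \<open>\<phi> \<circ> \<psi>\<close>, because \<phi> is only known to respect
  left multiplication by generators.\<close>

lemma tpg_induct [consumes 1, case_names one gen_mult add scal]:
  assumes z: "z \<in> carrier P"
    and one: "Q \<one>\<^bsub>P\<^esub>"
    and gen_mult: "\<And>g z. \<lbrakk>g \<in> carrier G; z \<in> carrier P; Q z\<rbrakk> \<Longrightarrow> Q (gen g \<otimes>\<^bsub>P\<^esub> z)"
    and add: "\<And>y z. \<lbrakk>y \<in> carrier P; z \<in> carrier P; Q y; Q z\<rbrakk> \<Longrightarrow> Q (y \<oplus>\<^bsub>P\<^esub> z)"
    and scal: "\<And>a z. \<lbrakk>a \<in> carrier K; z \<in> carrier P; Q z\<rbrakk> \<Longrightarrow> Q (a \<odot>\<^bsub>P\<^esub> z)"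
  shows "Q z"
proof -
  note q = alg_homD[OF tpg_quot(2)]
  have "Q (I +>\<^bsub>F\<^esub> f)" if "f \<in> carrier F" for f
    using that
  proof (induction rule: F.basis_induct)
    case zero
    \<comment> \<open>The rule has no premise for the zero vector, which arises as zero times the
      unit.\<close>
    have "Q (\<zero>\<^bsub>K\<^esub> \<odot>\<^bsub>P\<^esub> \<one>\<^bsub>P\<^esub>)" by (rule scal) (auto intro: one)
    also have "\<zero>\<^bsub>K\<^esub> \<odot>\<^bsub>P\<^esub> \<one>\<^bsub>P\<^esub> = I +>\<^bsub>F\<^esub> (\<zero>\<^bsub>K\<^esub> \<odot>\<^bsub>F\<^esub> \<one>\<^bsub>F\<^esub>)" by (simp only: q FA.one_closed zero_closed)
    finally show ?case by simp
  next
    case (basis w)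
    then show ?case
    proof (induction w)
      case Nil
      then show ?case using one q(4) F.basis_alg_simps(2) by simp
    next
      case (Cons g w)
      have "ind K {g # w} = free_gen K g \<otimes>\<^bsub>F\<^esub> ind K {w}"
        using Cons F.basis_mult[of "[g]" w] by (simp add: free_gen_def)
      then have "I +>\<^bsub>F\<^esub> ind K {g # w} = gen g \<otimes>\<^bsub>P\<^esub> (I +>\<^bsub>F\<^esub> ind K {w})"
        using Cons by (simp add: q free_gen_closed gen_eq F.basis_closed)
      then show ?case using Cons by (auto intro!: gen_mult q F.basis_closed)
    qed
  qed (simp_all add: q add scal)
  then show ?thesis using z by (auto simp: tpg_quot(3))
qed

end


section \<open>The idempotents of a factor set representation\<close>

text \<open>Over a field the difference \<open>a \<ominus> b\<close> is invertible. This is how a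
  failure of the cocycle identity later turns into a vanishing vector.\<close>

lemma (in unital_algebra) smult_eq_imp_zero:
  assumes "field K" and ab: "a \<in> carrier K" "b \<in> carrier K" "a \<noteq> b" "z \<in> carrier A" "a \<odot>\<^bsub>A\<^esub> z = b \<odot>\<^bsub>A\<^esub> z"
  shows "z = \<zero>\<^bsub>A\<^esub>"
proof -
  interpret K: field K by (rule assms)
  let ?d = "a \<ominus>\<^bsub>K\<^esub> b"
  have "?d \<noteq> \<zero>\<^bsub>K\<^esub>"
  proof
    assume "?d = \<zero>\<^bsub>K\<^esub>"
    then have "?d \<oplus>\<^bsub>K\<^esub> b = b" using ab by simp
    then show False using ab by (simp add: R.minus_eq R.a_assoc R.l_neg)
  qed
  then have d: "?d \<in> Units K" using ab by (simp add: K.field_Units)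
  have "?d \<odot>\<^bsub>A\<^esub> z = \<zero>\<^bsub>A\<^esub>" using ab by (simp add: R.minus_eq smult_l_distr smult_l_minus M.r_neg)
  then have "inv\<^bsub>K\<^esub> ?d \<odot>\<^bsub>A\<^esub> (?d \<odot>\<^bsub>A\<^esub> z) = \<zero>\<^bsub>A\<^esub>" using d by simp
  then show ?thesis using ab d by (simp add: smult_assoc1[symmetric])
qed

text \<open>The first equation gives \<open>e g\<close> and \<open>e (inv g)\<close> the same
  normalizing constant; the second makes \<open>e\<close> at the identity equal to the unit.\<close>

locale factor_set_rep = tpg_rep + K: field K +
  assumes sigma_inv: "g \<in> carrier G \<Longrightarrow> \<sigma> g (inv\<^bsub>G\<^esub> g) = \<sigma> (inv\<^bsub>G\<^esub> g) g"
    and sigma_one_one: "\<sigma> \<one>\<^bsub>G\<^esub> \<one>\<^bsub>G\<^esub> = \<one>\<^bsub>K\<^esub>"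
begin

text \<open>In the zero relations for the pair \<open>g\<close>, \<open>inv g\<close> one factor is
  \<open>x\<close> at the identity, which is the unit, so the other factor vanishes.\<close>

lemma x_zero:
  assumes g: "g \<in> carrier G" and s: "\<sigma> g (inv\<^bsub>G\<^esub> g) = \<zero>\<^bsub>K\<^esub>"
  shows "x g = \<zero>" and "x (inv\<^bsub>G\<^esub> g) = \<zero>"
  using zero_left[OF g _ s] zero_right[OF g _ s] g by (simp_all add: x_one x_closed)

lemma x_inv_x:
  assumes g: "g \<in> carrier G"
  shows "x g \<otimes> x (inv\<^bsub>G\<^esub> g) \<otimes> x g = \<sigma> g (inv\<^bsub>G\<^esub> g) \<odot> x g"
  using rel_left[of "inv\<^bsub>G\<^esub> g" g] g by (simp add: x_one x_closed sigma_inv)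

definition "e g = (if \<sigma> g (inv\<^bsub>G\<^esub> g) = \<zero>\<^bsub>K\<^esub> then \<zero>
    else inv\<^bsub>K\<^esub> \<sigma> g (inv\<^bsub>G\<^esub> g) \<odot> (x g \<otimes> x (inv\<^bsub>G\<^esub> g)))"

lemma sigma_unit:
  assumes "g \<in> carrier G" "h \<in> carrier G" "\<sigma> g h \<noteq> \<zero>\<^bsub>K\<^esub>"
  shows "inv\<^bsub>K\<^esub> \<sigma> g h \<in> carrier K" "\<sigma> g h \<otimes>\<^bsub>K\<^esub> inv\<^bsub>K\<^esub> \<sigma> g h = \<one>\<^bsub>K\<^esub>" "inv\<^bsub>K\<^esub> \<sigma> g h \<otimes>\<^bsub>K\<^esub> \<sigma> g h = \<one>\<^bsub>K\<^esub>"
  using assms sigma_closed[of g h] by (auto simp: K.field_Units)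

lemma e_closed: "g \<in> carrier G \<Longrightarrow> e g \<in> carrier A"
  by (auto simp: e_def x_closed sigma_unit)

lemma e_inv: "g \<in> carrier G \<Longrightarrow> \<sigma> g (inv\<^bsub>G\<^esub> g) \<noteq> \<zero>\<^bsub>K\<^esub> \<Longrightarrow>
   e (inv\<^bsub>G\<^esub> g) = inv\<^bsub>K\<^esub> \<sigma> g (inv\<^bsub>G\<^esub> g) \<odot> (x (inv\<^bsub>G\<^esub> g) \<otimes> x g)"
  by (simp add: e_def sigma_inv)

lemma e_x: 
  assumes g: "g \<in> carrier G" shows "e g \<otimes> x g = x g"
proof (cases "\<sigma> g (inv\<^bsub>G\<^esub> g) = \<zero>\<^bsub>K\<^esub>")
  case False
  then show ?thesis using g
    by (simp add: e_def smult_mult_left x_closed sigma_unit sigma_closed x_inv_x smult_assoc1[symmetric])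
qed (simp add: g x_zero e_closed)

lemma x_e:
  assumes g: "g \<in> carrier G" shows "x g \<otimes> e (inv\<^bsub>G\<^esub> g) = x g"
proof (cases "\<sigma> g (inv\<^bsub>G\<^esub> g) = \<zero>\<^bsub>K\<^esub>")
  case False
  then show ?thesis using g
    by (simp add: e_inv smult_mult_right x_closed sigma_unit sigma_closed m_assoc[symmetric]
        x_inv_x smult_assoc1[symmetric])
qed (simp add: g x_zero e_closed)

lemma e_idem:
  assumes g: "g \<in> carrier G" shows "e g \<otimes> e g = e g"
proof (cases "\<sigma> g (inv\<^bsub>G\<^esub> g) = \<zero>\<^bsub>K\<^esub>")
  case False
  have "e g \<otimes> e g = inv\<^bsub>K\<^esub> \<sigma> g (inv\<^bsub>G\<^esub> g) \<odot> ((e g \<otimes> x g) \<otimes> x (inv\<^bsub>G\<^esub> g))"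
    using False g by (subst (2) e_def) (simp add: smult_mult_right x_closed sigma_unit e_closed m_assoc)
  then show ?thesis using False g by (simp add: e_x, simp add: e_def)
qed (simp add: g e_def)

lemma e_one: "e \<one>\<^bsub>G\<^esub> = \<one>"
  by (simp add: e_def sigma_one_one x_one)

text \<open>Writing \<open>x g\<close> as \<open>e g \<otimes> x g\<close> exposes the triple
  product \<open>x (inv g) \<otimes> x g \<otimes> x h\<close>, to which \<open>rel_left\<close>
  applies. If the constant of \<open>e g\<close> is zero, then so is \<open>x g\<close>.\<close>

lemma x_mult:
  assumes g: "g \<in> carrier G" and h: "h \<in> carrier G"
  shows "x g \<otimes> x h = \<sigma> g h \<odot> (e g \<otimes> x (g \<otimes>\<^bsub>G\<^esub> h))"
proof (cases "\<sigma> g (inv\<^bsub>G\<^esub> g) = \<zero>\<^bsub>K\<^esub>")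
  case False
  let ?c = "inv\<^bsub>K\<^esub> \<sigma> g (inv\<^bsub>G\<^esub> g)"
  note cl = x_closed sigma_unit sigma_closed e_closed g h
  have "x g \<otimes> x h = (e g \<otimes> x g) \<otimes> x h" using g by (simp add: e_x)
  also have "\<dots> = ?c \<odot> (x g \<otimes> (x (inv\<^bsub>G\<^esub> g) \<otimes> x g \<otimes> x h))"
    using False by (simp add: e_def cl smult_mult_left m_assoc)
  also have "\<dots> = ?c \<odot> (\<sigma> g h \<odot> (x g \<otimes> (x (inv\<^bsub>G\<^esub> g) \<otimes> x (g \<otimes>\<^bsub>G\<^esub> h))))"
    by (simp add: rel_left cl smult_mult_right)
  also have "\<dots> = \<sigma> g h \<odot> (?c \<odot> (x g \<otimes> (x (inv\<^bsub>G\<^esub> g) \<otimes> x (g \<otimes>\<^bsub>G\<^esub> h))))"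
    using False by (simp add: cl smult_assoc1[symmetric] R.m_comm)
  also have "?c \<odot> (x g \<otimes> (x (inv\<^bsub>G\<^esub> g) \<otimes> x (g \<otimes>\<^bsub>G\<^esub> h))) = e g \<otimes> x (g \<otimes>\<^bsub>G\<^esub> h)"
    using False by (simp add: e_def cl smult_mult_left m_assoc)
  finally show ?thesis .
qed (use g h in \<open>simp add: x_zero x_closed e_def sigma_closed\<close>)

text \<open>Both \<open>e g \<otimes> e h\<close> and \<open>e h \<otimes> e g\<close> are multiples of \<open>x h \<otimes> x (h\<inverse>g) \<otimes> x g\<inverse>\<close>, and
  idempotents that are proportional in this way commute.\<close>

lemma e_mult_proportional:
  assumes g: "g \<in> carrier G" and h: "h \<in> carrier G"
  obtains a where "a \<in> carrier K" "e g \<otimes> e h = a \<odot> (e h \<otimes> e g)"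
proof -
  \<comment> \<open>With this choice the products of \<open>g\<close> with \<open>z\<close> and of
    \<open>z\<close> with \<open>inv h\<close> are \<open>h\<close> and \<open>inv g\<close>, the
    outer indices of the word \<open>?u\<close> to be reached.\<close>
  define z where "z = inv\<^bsub>G\<^esub> g \<otimes>\<^bsub>G\<^esub> h"
  have z: "z \<in> carrier G" "inv\<^bsub>G\<^esub> z = inv\<^bsub>G\<^esub> h \<otimes>\<^bsub>G\<^esub> g" "g \<otimes>\<^bsub>G\<^esub> z = h" "z \<otimes>\<^bsub>G\<^esub> inv\<^bsub>G\<^esub> h = inv\<^bsub>G\<^esub> g"
    using g h by (auto simp: z_def G.inv_mult_group G.m_assoc[symmetric])
      (simp add: G.m_assoc)
  note cl = x_closed sigma_unit sigma_closed e_closed g h z(1)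
  show thesis
  proof (cases "\<sigma> g (inv\<^bsub>G\<^esub> g) = \<zero>\<^bsub>K\<^esub> \<or> \<sigma> h (inv\<^bsub>G\<^esub> h) = \<zero>\<^bsub>K\<^esub>")
    case True
    then have "e g \<otimes> e h = \<zero>\<^bsub>K\<^esub> \<odot> (e h \<otimes> e g)" using cl by (auto simp: e_def)
    then show ?thesis using that by blast
  next
    case False
    then have gh: "\<sigma> g (inv\<^bsub>G\<^esub> g) \<noteq> \<zero>\<^bsub>K\<^esub>" "\<sigma> h (inv\<^bsub>G\<^esub> h) \<noteq> \<zero>\<^bsub>K\<^esub>" by auto
    let ?u = "x h \<otimes> (x (inv\<^bsub>G\<^esub> z) \<otimes> x (inv\<^bsub>G\<^esub> g))"
    let ?c = "inv\<^bsub>K\<^esub> \<sigma> g (inv\<^bsub>G\<^esub> g) \<otimes>\<^bsub>K\<^esub> inv\<^bsub>K\<^esub> \<sigma> h (inv\<^bsub>G\<^esub> h)"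
    have c: "?c \<in> carrier K" using cl gh by simp
    have c': "?c = inv\<^bsub>K\<^esub> \<sigma> h (inv\<^bsub>G\<^esub> h) \<otimes>\<^bsub>K\<^esub> inv\<^bsub>K\<^esub> \<sigma> g (inv\<^bsub>G\<^esub> g)" using cl gh by (simp add: R.m_comm)
    \<comment> \<open>The inner triple \<open>x a \<otimes> x (inv a) \<otimes> x b\<close> is an
      instance of \<open>rel_left\<close> at \<open>inv a\<close>; a word of three letters
      remains.\<close>
    have prod: "e a \<otimes> e b = (inv\<^bsub>K\<^esub> \<sigma> a (inv\<^bsub>G\<^esub> a) \<otimes>\<^bsub>K\<^esub> inv\<^bsub>K\<^esub> \<sigma> b (inv\<^bsub>G\<^esub> b) \<otimes>\<^bsub>K\<^esub> \<sigma> (inv\<^bsub>G\<^esub> a) b) \<odot>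
        (x a \<otimes> (x (inv\<^bsub>G\<^esub> a \<otimes>\<^bsub>G\<^esub> b) \<otimes> x (inv\<^bsub>G\<^esub> b)))"
      if a: "a \<in> carrier G" "\<sigma> a (inv\<^bsub>G\<^esub> a) \<noteq> \<zero>\<^bsub>K\<^esub>" and b: "b \<in> carrier G" "\<sigma> b (inv\<^bsub>G\<^esub> b) \<noteq> \<zero>\<^bsub>K\<^esub>" for a b
    proof -
      have "e a \<otimes> e b = (inv\<^bsub>K\<^esub> \<sigma> a (inv\<^bsub>G\<^esub> a) \<otimes>\<^bsub>K\<^esub> inv\<^bsub>K\<^esub> \<sigma> b (inv\<^bsub>G\<^esub> b)) \<odot>
          ((x (inv\<^bsub>G\<^esub> (inv\<^bsub>G\<^esub> a)) \<otimes> x (inv\<^bsub>G\<^esub> a) \<otimes> x b) \<otimes> x (inv\<^bsub>G\<^esub> b))"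
        using a b by (simp add: e_def cl smult_mult_left smult_mult_right smult_assoc1[symmetric] m_assoc R.m_comm)
      also have "\<dots> = (inv\<^bsub>K\<^esub> \<sigma> a (inv\<^bsub>G\<^esub> a) \<otimes>\<^bsub>K\<^esub> inv\<^bsub>K\<^esub> \<sigma> b (inv\<^bsub>G\<^esub> b)) \<odot>
          (\<sigma> (inv\<^bsub>G\<^esub> a) b \<odot> (x a \<otimes> (x (inv\<^bsub>G\<^esub> a \<otimes>\<^bsub>G\<^esub> b) \<otimes> x (inv\<^bsub>G\<^esub> b))))"
        using a b by (subst rel_left) (simp_all add: cl smult_mult_left m_assoc)
      also have "\<dots> = (inv\<^bsub>K\<^esub> \<sigma> a (inv\<^bsub>G\<^esub> a) \<otimes>\<^bsub>K\<^esub> inv\<^bsub>K\<^esub> \<sigma> b (inv\<^bsub>G\<^esub> b) \<otimes>\<^bsub>K\<^esub> \<sigma> (inv\<^bsub>G\<^esub> a) b) \<odot>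
        (x a \<otimes> (x (inv\<^bsub>G\<^esub> a \<otimes>\<^bsub>G\<^esub> b) \<otimes> x (inv\<^bsub>G\<^esub> b)))"
        using a b by (subst smult_assoc1) (simp_all add: cl)
      finally show ?thesis .
    qed
    have eg: "e g \<otimes> e h = (?c \<otimes>\<^bsub>K\<^esub> \<sigma> (inv\<^bsub>G\<^esub> g) h) \<odot> (x g \<otimes> (x z \<otimes> x (inv\<^bsub>G\<^esub> h)))"
      using prod[OF g gh(1) h gh(2)] by (simp add: z_def)
    have eh: "e h \<otimes> e g = (?c \<otimes>\<^bsub>K\<^esub> \<sigma> (inv\<^bsub>G\<^esub> h) g) \<odot> ?u"
      using prod[OF h gh(2) g gh(1)] unfolding c' z(2) .
    \<comment> \<open>The middle letter is replaced by a multiple of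
      \<open>x z \<otimes> x (inv z) \<otimes> x z\<close>. Then \<open>rel_right\<close> absorbs
      the left copy of \<open>x z\<close> into \<open>x g\<close>, and \<open>rel_left\<close>
      absorbs the right copy into \<open>x (inv h)\<close>.\<close>
    obtain b where b: "b \<in> carrier K" "x g \<otimes> (x z \<otimes> x (inv\<^bsub>G\<^esub> h)) = b \<odot> ?u"
    proof (cases "\<sigma> z (inv\<^bsub>G\<^esub> z) = \<zero>\<^bsub>K\<^esub>")
      case True
      then show ?thesis using that[of "\<zero>\<^bsub>K\<^esub>"] by (simp add: x_zero cl)
    next
      case zz: False
      let ?d = "inv\<^bsub>K\<^esub> \<sigma> z (inv\<^bsub>G\<^esub> z)"
      have "x z = ?d \<odot> (x z \<otimes> x (inv\<^bsub>G\<^esub> z) \<otimes> x z)"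
        using zz by (simp add: cl x_inv_x smult_assoc1[symmetric])
      then have "x g \<otimes> (x z \<otimes> x (inv\<^bsub>G\<^esub> h)) = x g \<otimes> (?d \<odot> (x z \<otimes> x (inv\<^bsub>G\<^esub> z) \<otimes> x z) \<otimes> x (inv\<^bsub>G\<^esub> h))"
        by simp
      also have "\<dots> = ?d \<odot> ((x g \<otimes> x z \<otimes> x (inv\<^bsub>G\<^esub> z)) \<otimes> (x z \<otimes> x (inv\<^bsub>G\<^esub> h)))"
        using zz by (simp add: cl smult_mult_left smult_mult_right m_assoc)
      also have "\<dots> = ?d \<odot> (\<sigma> g z \<odot> (x h \<otimes> (x (inv\<^bsub>G\<^esub> z) \<otimes> x z \<otimes> x (inv\<^bsub>G\<^esub> h))))"
        by (subst rel_right) (simp_all add: cl z(3) smult_mult_left m_assoc)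
      also have "\<dots> = ?d \<odot> (\<sigma> g z \<odot> (\<sigma> z (inv\<^bsub>G\<^esub> h) \<odot> ?u))"
        by (subst rel_left) (simp_all add: cl z(4) smult_mult_right)
      also have "\<dots> = (?d \<otimes>\<^bsub>K\<^esub> \<sigma> g z \<otimes>\<^bsub>K\<^esub> \<sigma> z (inv\<^bsub>G\<^esub> h)) \<odot> ?u"
        using zz by (simp add: cl smult_assoc1)
      finally show ?thesis using zz that[of "?d \<otimes>\<^bsub>K\<^esub> \<sigma> g z \<otimes>\<^bsub>K\<^esub> \<sigma> z (inv\<^bsub>G\<^esub> h)"] by (simp add: cl)
    qed
    \<comment> \<open>The factor sought has \<open>\<sigma> (inv h) g\<close> in its denominator. If
      that value is zero, a zero relation kills \<open>?u\<close>, because \<open>inv z\<close> is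
      \<open>inv h \<otimes> g\<close>, and both products vanish.\<close>
    show thesis
    proof (cases "\<sigma> (inv\<^bsub>G\<^esub> h) g = \<zero>\<^bsub>K\<^esub>")
      case True
      then have "?u = \<zero>" using zero_left[of "inv\<^bsub>G\<^esub> h" g] z by (simp add: cl m_assoc[symmetric])
      then have "e g \<otimes> e h = \<zero>\<^bsub>K\<^esub> \<odot> (e h \<otimes> e g)" using b c by (simp add: eg cl)
      then show ?thesis using that by blast
    next
      case hg: False
      let ?s = "\<sigma> (inv\<^bsub>G\<^esub> h) g" and ?t = "\<sigma> (inv\<^bsub>G\<^esub> g) h"
      have sc: "?s \<in> carrier K" "inv\<^bsub>K\<^esub> ?s \<in> carrier K" "?s \<otimes>\<^bsub>K\<^esub> inv\<^bsub>K\<^esub> ?s = \<one>\<^bsub>K\<^esub>" "?t \<in> carrier K" using hg by (simp_all add: cl)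
      have "(?t \<otimes>\<^bsub>K\<^esub> b \<otimes>\<^bsub>K\<^esub> inv\<^bsub>K\<^esub> ?s) \<odot> (e h \<otimes> e g)
          = ((?t \<otimes>\<^bsub>K\<^esub> b \<otimes>\<^bsub>K\<^esub> inv\<^bsub>K\<^esub> ?s) \<otimes>\<^bsub>K\<^esub> (?c \<otimes>\<^bsub>K\<^esub> ?s)) \<odot> ?u"
        unfolding eh using sc b c by (subst smult_assoc1) (simp_all add: cl)
      also have "(?t \<otimes>\<^bsub>K\<^esub> b \<otimes>\<^bsub>K\<^esub> inv\<^bsub>K\<^esub> ?s) \<otimes>\<^bsub>K\<^esub> (?c \<otimes>\<^bsub>K\<^esub> ?s) = (?c \<otimes>\<^bsub>K\<^esub> ?t \<otimes>\<^bsub>K\<^esub> b) \<otimes>\<^bsub>K\<^esub> (?s \<otimes>\<^bsub>K\<^esub> inv\<^bsub>K\<^esub> ?s)"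
        using sc(1,2,4) b(1) c by (simp only: R.m_ac R.m_closed)
      also have "\<dots> \<odot> ?u = e g \<otimes> e h" unfolding eg b(2) sc(3)
        using sc b c by (simp add: cl smult_assoc1)
      finally show ?thesis using that sc b by (metis R.m_closed)
    qed
  qed
qed

text \<open>Both products equal \<open>e g \<otimes> e h \<otimes> e g\<close>: in the
  proportionality for \<open>e g \<otimes> e h\<close> right multiplication by \<open>e g\<close>
  does not change the other side, and in the one for \<open>e h \<otimes> e g\<close> left
  multiplication by \<open>e g\<close> does not. The scalars need not be determined.\<close>

lemma e_comm:
  assumes g: "g \<in> carrier G" and h: "h \<in> carrier G"
  shows "e g \<otimes> e h = e h \<otimes> e g"
proof -
  have *: "e a \<otimes> e b \<otimes> e a = e a \<otimes> e b" if ab: "a \<in> carrier G" "b \<in> carrier G" for a b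
  proof -
    obtain s where s: "s \<in> carrier K" "e a \<otimes> e b = s \<odot> (e b \<otimes> e a)"
      by (rule e_mult_proportional[OF ab])
    have cl: "e a \<in> carrier A" "e b \<in> carrier A" using ab by (auto intro: e_closed)
    have "e a \<otimes> e b \<otimes> e a = s \<odot> (e b \<otimes> (e a \<otimes> e a))"
      using s cl by (simp add: smult_mult_left m_assoc)
    also have "\<dots> = e a \<otimes> e b" using that s by (simp add: e_idem)
    finally show ?thesis .
  qed
  obtain s where s: "s \<in> carrier K" "e g \<otimes> e h = s \<odot> (e h \<otimes> e g)"
    by (rule e_mult_proportional[OF g h])
  obtain t where t: "t \<in> carrier K" "e h \<otimes> e g = t \<odot> (e g \<otimes> e h)"
    by (rule e_mult_proportional[OF h g])
  have cl: "e g \<in> carrier A" "e h \<in> carrier A" using assms by (auto intro: e_closed)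
  have "e g \<otimes> e h \<otimes> e g = t \<odot> (e g \<otimes> (e g \<otimes> e h))"
    using t cl by (simp add: m_assoc smult_mult_right)
  also have "\<dots> = e h \<otimes> e g" using t(2) cl by (simp add: m_assoc[symmetric] e_idem g)
  finally show ?thesis using *[OF g h] by simp
qed

text \<open>Both sides are multiples of \<open>x (g \<otimes> h) \<otimes> x (inv h)\<close>, which
  is fixed by \<open>e (g \<otimes> h)\<close> on the left and by \<open>e h\<close> on the right.
  Hence both equal \<open>e (g \<otimes> h) \<otimes> x g \<otimes> e h\<close>.\<close>

lemma x_conj:
  assumes g: "g \<in> carrier G" and h: "h \<in> carrier G"
  shows "x g \<otimes> e h = e (g \<otimes>\<^bsub>G\<^esub> h) \<otimes> x g"
proof -
  let ?k = "g \<otimes>\<^bsub>G\<^esub> h"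
  have k: "?k \<in> carrier G" "inv\<^bsub>G\<^esub> ?k \<otimes>\<^bsub>G\<^esub> g = inv\<^bsub>G\<^esub> h"
    using g h by (auto simp: G.inv_mult_group G.m_assoc)
  note cl = x_closed sigma_unit sigma_closed e_closed g h k(1)
  have "x g \<otimes> e h = e ?k \<otimes> x g \<otimes> e h"
  proof (cases "\<sigma> h (inv\<^bsub>G\<^esub> h) = \<zero>\<^bsub>K\<^esub>")
    case True
    then show ?thesis by (simp add: e_def cl)
  next
    case False
    let ?c = "inv\<^bsub>K\<^esub> \<sigma> h (inv\<^bsub>G\<^esub> h) \<otimes>\<^bsub>K\<^esub> \<sigma> g h"
    have "x g \<otimes> e h = inv\<^bsub>K\<^esub> \<sigma> h (inv\<^bsub>G\<^esub> h) \<odot> (x g \<otimes> x h \<otimes> x (inv\<^bsub>G\<^esub> h))"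
      using False by (simp add: e_def cl smult_mult_right m_assoc)
    also have "\<dots> = ?c \<odot> (x ?k \<otimes> x (inv\<^bsub>G\<^esub> h))"
      using False by (simp add: rel_right cl smult_assoc1)
    finally have eq: "x g \<otimes> e h = ?c \<odot> (x ?k \<otimes> x (inv\<^bsub>G\<^esub> h))" .
    have "e ?k \<otimes> x g \<otimes> e h = e ?k \<otimes> (x g \<otimes> e h)" by (simp add: cl m_assoc)
    also have "\<dots> = ?c \<odot> ((e ?k \<otimes> x ?k) \<otimes> x (inv\<^bsub>G\<^esub> h))"
      unfolding eq using False by (simp add: cl smult_mult_right m_assoc)
    also have "\<dots> = x g \<otimes> e h" unfolding eq by (simp add: e_x cl)
    finally show ?thesis by simp
  qed
  also have "\<dots> = e ?k \<otimes> x g"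
  proof (cases "\<sigma> ?k (inv\<^bsub>G\<^esub> ?k) = \<zero>\<^bsub>K\<^esub>")
    case True
    then show ?thesis by (simp add: e_def[of ?k] cl)
  next
    case False
    let ?c = "inv\<^bsub>K\<^esub> \<sigma> ?k (inv\<^bsub>G\<^esub> ?k)"
    have c: "?c \<in> carrier K" using False by (simp add: cl)
    have "e ?k \<otimes> x g = ?c \<odot> (x (inv\<^bsub>G\<^esub> (inv\<^bsub>G\<^esub> ?k)) \<otimes> x (inv\<^bsub>G\<^esub> ?k) \<otimes> x g)"
      using False c by (simp add: e_def cl smult_mult_left)
    also have "\<dots> = ?c \<odot> (\<sigma> (inv\<^bsub>G\<^esub> ?k) g \<odot> (x ?k \<otimes> x (inv\<^bsub>G\<^esub> h)))"
      using k by (subst rel_left) (simp_all add: cl)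
    finally have eq: "e ?k \<otimes> x g = ?c \<odot> (\<sigma> (inv\<^bsub>G\<^esub> ?k) g \<odot> (x ?k \<otimes> x (inv\<^bsub>G\<^esub> h)))" .
    show ?thesis unfolding eq using c x_e[of "inv\<^bsub>G\<^esub> h"]
      by (simp add: cl smult_mult_left m_assoc)
  qed
  finally show ?thesis .
qed

text \<open>For nonzero \<open>z\<close> the translate \<open>?w = z \<otimes> x h\<close> is
  nonzero and reduces the base point to the identity. For type I two of the idempotents fixing
  \<open>?w\<close> are orthogonal. For type II the two bracketings of
  \<open>x g \<otimes> x s \<otimes> x t\<close>, multiplied by \<open>?w\<close>, give the vector
  \<open>?w \<otimes> x ?l\<close> with different coefficients; so it is zero, and with it
  \<open>?w \<otimes> e ?l = ?w\<close>.\<close>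

lemma prohibition_annihilates:
  assumes V: "V \<in> prohibitions K G \<sigma>" and z: "z \<in> carrier A"
    and fix_V: "\<And>v. v \<in> V \<Longrightarrow> z \<otimes> e v = z"
  shows "z = \<zero>"
proof -
  text \<open>Multiplying by \<open>x h\<close> translates \<open>V\<close> by \<open>h\<inverse>\<close>.\<close>
  have shift: "z = \<zero> \<or> (z \<otimes> x h \<in> carrier A \<and> z \<otimes> x h \<noteq> \<zero> \<and>
      (\<forall>k\<in>carrier G. h \<otimes>\<^bsub>G\<^esub> k \<in> V \<longrightarrow> z \<otimes> x h \<otimes> e k = z \<otimes> x h))"
    if h: "h \<in> carrier G" "h \<in> V" for h
  proof (cases "z = \<zero>")
    case False
    \<comment> \<open>\<open>e h\<close> is a multiple of \<open>x h \<otimes> x (inv h)\<close>, so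
      a vanishing \<open>z \<otimes> x h\<close> would force \<open>z = z \<otimes> e h\<close> to
      vanish.\<close>
    have "z \<otimes> x h \<noteq> \<zero>"
    proof
      assume "z \<otimes> x h = \<zero>"
      then have "z \<otimes> e h = \<zero>" using h z
        by (simp add: e_def smult_mult_right x_closed sigma_unit m_assoc[symmetric])
      then show False using fix_V[OF h(2)] False by simp
    qed
    moreover have "z \<otimes> x h \<otimes> e k = z \<otimes> x h" if "k \<in> carrier G" "h \<otimes>\<^bsub>G\<^esub> k \<in> V" for k
    proof -
      have "z \<otimes> x h \<otimes> e k = z \<otimes> e (h \<otimes>\<^bsub>G\<^esub> k) \<otimes> x h"
        using that h z by (simp add: m_assoc x_closed e_closed x_conj)
      then show ?thesis using fix_V[OF that(2)] by simp
    qed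
    ultimately show ?thesis using z h by (simp add: x_closed)
  qed simp
  show ?thesis using V unfolding prohibitions_def Un_iff mem_Collect_eq
  proof (elim disjE exE conjE)
    fix h g s
    assume I: "h \<in> carrier G" "g \<in> carrier G" "s \<in> carrier G" "\<sigma> g s = \<zero>\<^bsub>K\<^esub>"
      "V = {h, h \<otimes>\<^bsub>G\<^esub> g, h \<otimes>\<^bsub>G\<^esub> g \<otimes>\<^bsub>G\<^esub> s}"
    show ?thesis
    proof (rule ccontr)
      assume "z \<noteq> \<zero>"
      let ?w = "z \<otimes> x h" and ?k = "g \<otimes>\<^bsub>G\<^esub> s"
      have "h \<in> V" using I(5) by simp
      have sh: "?w \<in> carrier A" "?w \<noteq> \<zero>"
        "\<And>k. \<lbrakk>k \<in> carrier G; h \<otimes>\<^bsub>G\<^esub> k \<in> V\<rbrakk> \<Longrightarrow> ?w \<otimes> e k = ?w"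
        using shift[OF I(1)] \<open>h \<in> V\<close> \<open>z \<noteq> \<zero>\<close> by auto
      have w: "?w \<in> carrier A" "?w \<noteq> \<zero>" "?w \<otimes> e g = ?w" "?w \<otimes> e ?k = ?w"
        using sh(1,2) sh(3)[of "g"] sh(3)[of "?k"] I(1-3) by (simp_all add: I(5) G.m_assoc)
      note cl = x_closed sigma_unit sigma_closed e_closed I(2,3) w(1)
      \<comment> \<open>Spelled out, the product contains the adjacent factors
        \<open>x (inv g)\<close> and \<open>x ?k\<close>, which a zero relation annihilates.\<close>
      have "e g \<otimes> e ?k = \<zero>"
      proof (cases "\<sigma> g (inv\<^bsub>G\<^esub> g) = \<zero>\<^bsub>K\<^esub> \<or> \<sigma> ?k (inv\<^bsub>G\<^esub> ?k) = \<zero>\<^bsub>K\<^esub>")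
        case True
        then show ?thesis by (auto simp: e_def cl)
      next
        case False
        have "e g \<otimes> e ?k = inv\<^bsub>K\<^esub> \<sigma> ?k (inv\<^bsub>G\<^esub> ?k) \<odot> (inv\<^bsub>K\<^esub> \<sigma> g (inv\<^bsub>G\<^esub> g) \<odot>
            (x g \<otimes> ((x (inv\<^bsub>G\<^esub> g) \<otimes> x ?k) \<otimes> x (inv\<^bsub>G\<^esub> ?k))))"
          using False by (simp add: e_def cl smult_mult_left smult_mult_right m_assoc)
        then show ?thesis using False zero_left[OF I(2,3,4)] by (simp add: cl)
      qed
      then have "?w \<otimes> e g \<otimes> e ?k = \<zero>" using w(1) by (simp add: cl m_assoc)
      with w show False by simp
    qed
  next
    fix h g s t
    assume II: "h \<in> carrier G" "g \<in> carrier G" "s \<in> carrier G" "t \<in> carrier G"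
      "\<sigma> g (s \<otimes>\<^bsub>G\<^esub> t) \<otimes>\<^bsub>K\<^esub> \<sigma> s t \<noteq> \<sigma> g s \<otimes>\<^bsub>K\<^esub> \<sigma> (g \<otimes>\<^bsub>G\<^esub> s) t"
      "V = {h, h \<otimes>\<^bsub>G\<^esub> g, h \<otimes>\<^bsub>G\<^esub> g \<otimes>\<^bsub>G\<^esub> s, h \<otimes>\<^bsub>G\<^esub> g \<otimes>\<^bsub>G\<^esub> s \<otimes>\<^bsub>G\<^esub> t}"
    show ?thesis
    proof (rule ccontr)
      assume "z \<noteq> \<zero>"
      let ?w = "z \<otimes> x h" and ?k = "g \<otimes>\<^bsub>G\<^esub> s" and ?l = "g \<otimes>\<^bsub>G\<^esub> s \<otimes>\<^bsub>G\<^esub> t"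
      have "h \<in> V" using II(6) by simp
      have sh: "?w \<in> carrier A" "?w \<noteq> \<zero>"
        "\<And>k. \<lbrakk>k \<in> carrier G; h \<otimes>\<^bsub>G\<^esub> k \<in> V\<rbrakk> \<Longrightarrow> ?w \<otimes> e k = ?w"
        using shift[OF II(1)] \<open>h \<in> V\<close> \<open>z \<noteq> \<zero>\<close> by auto
      have w: "?w \<in> carrier A" "?w \<noteq> \<zero>" "?w \<otimes> e g = ?w" "?w \<otimes> e ?k = ?w" "?w \<otimes> e ?l = ?w"
        using sh(1,2) sh(3)[of "g"] sh(3)[of "?k"] sh(3)[of "?l"] II(1-4) by (simp_all add: II(6) G.m_assoc)
      note cl = x_closed sigma_unit sigma_closed e_closed II(2-4) w(1)
      define y where "y = ?w \<otimes> x ?l"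
      have y: "y \<in> carrier A" by (simp add: y_def cl)
      have "?w \<otimes> (x g \<otimes> x s \<otimes> x t) = \<sigma> g s \<odot> (?w \<otimes> e g \<otimes> (x ?k \<otimes> x t))"
        using w(1) by (simp add: cl x_mult[of g s] smult_mult_left smult_mult_right m_assoc)
      also have "\<dots> = \<sigma> g s \<odot> (\<sigma> ?k t \<odot> (?w \<otimes> e ?k \<otimes> x ?l))"
        using w(1) unfolding w(3) x_mult[OF G.m_closed[OF II(2,3)] II(4)]
        by (simp add: cl smult_mult_right m_assoc)
      also have "\<dots> = (\<sigma> g s \<otimes>\<^bsub>K\<^esub> \<sigma> ?k t) \<odot> y"
        unfolding w(4) y_def[symmetric] using y by (simp add: cl smult_assoc1)
      finally have 1: "?w \<otimes> (x g \<otimes> x s \<otimes> x t) = (\<sigma> g s \<otimes>\<^bsub>K\<^esub> \<sigma> ?k t) \<odot> y" .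
      have "?w \<otimes> (x g \<otimes> x s \<otimes> x t) = ?w \<otimes> (x g \<otimes> (x s \<otimes> x t))"
        by (simp add: cl m_assoc)
      also have "\<dots> = \<sigma> s t \<odot> (?w \<otimes> ((x g \<otimes> e s) \<otimes> x (s \<otimes>\<^bsub>G\<^esub> t)))"
        using w(1) unfolding x_mult[OF II(3,4)] by (simp add: cl smult_mult_left smult_mult_right m_assoc)
      \<comment> \<open>Moving \<open>e s\<close> to the left across \<open>x g\<close> turns it
        into \<open>e ?k\<close>, which \<open>?w\<close> absorbs.\<close>
      also have "\<dots> = \<sigma> s t \<odot> (?w \<otimes> e ?k \<otimes> (x g \<otimes> x (s \<otimes>\<^bsub>G\<^esub> t)))"
        using w(1) unfolding x_conj[OF II(2,3)] by (simp add: cl m_assoc)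
      also have "\<dots> = \<sigma> s t \<odot> (\<sigma> g (s \<otimes>\<^bsub>G\<^esub> t) \<odot> (?w \<otimes> e g \<otimes> x ?l))"
        using w(1) unfolding w(4) x_mult[OF II(2) G.m_closed[OF II(3,4)]]
        by (simp add: cl smult_mult_right m_assoc G.m_assoc)
      also have "\<dots> = (\<sigma> g (s \<otimes>\<^bsub>G\<^esub> t) \<otimes>\<^bsub>K\<^esub> \<sigma> s t) \<odot> y"
        unfolding w(3) y_def[symmetric] using y by (simp add: cl smult_assoc1[symmetric] R.m_comm)
      finally have "(\<sigma> g (s \<otimes>\<^bsub>G\<^esub> t) \<otimes>\<^bsub>K\<^esub> \<sigma> s t) \<odot> y = (\<sigma> g s \<otimes>\<^bsub>K\<^esub> \<sigma> ?k t) \<odot> y"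
        using 1 by simp
      with II(5) y have "y = \<zero>"
        by (intro smult_eq_imp_zero[OF K.field_axioms _ _ II(5) y]) (simp_all add: cl)
      then have "?w \<otimes> e ?l = \<zero>"
        using w(1) by (simp add: y_def e_def cl smult_mult_right m_assoc[symmetric])
      with w show False by simp
    qed
  qed
qed

section \<open>Products of idempotents and complementary idempotents\<close>

text \<open>The product is taken along a list because \<open>A\<close> need not be commutative.\<close>

definition "cell ys S = foldr (\<lambda>y z. (if y \<in> S then e y else \<one> \<ominus> e y) \<otimes> z) ys \<one>"

lemma cell_simps:
  "cell [] S = \<one>"
  "cell (y # ys) S = (if y \<in> S then e y else \<one> \<ominus> e y) \<otimes> cell ys S"
  by (simp_all add: cell_def)

lemma cell_closed: "set ys \<subseteq> carrier G \<Longrightarrow> cell ys S \<in> carrier A"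
  by (induction ys) (auto simp: cell_simps e_closed)

lemma cell_cong: "S \<inter> set ys = T \<inter> set ys \<Longrightarrow> cell ys S = cell ys T"
proof (induction ys)
  case (Cons y ys)
  then have "cell ys S = cell ys T" "y \<in> S \<longleftrightarrow> y \<in> T" by auto
  then show ?case by (simp add: cell_simps)
qed (simp add: cell_simps)

lemma minus_distrib:
  assumes "a \<in> carrier A" "b \<in> carrier A"
  shows "(\<one> \<ominus> a) \<otimes> b = b \<ominus> a \<otimes> b" "b \<otimes> (\<one> \<ominus> a) = b \<ominus> b \<otimes> a"
  using assms by (simp_all add: minus_eq l_distr r_distr l_minus r_minus)

lemma factor_comm:
  assumes "g \<in> carrier G" "h \<in> carrier G"
  shows "(if b then e h else \<one> \<ominus> e h) \<otimes> e g = e g \<otimes> (if b then e h else \<one> \<ominus> e h)"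
  using assms by (simp add: minus_distrib e_closed e_comm)

lemma cell_comm:
  assumes "set ys \<subseteq> carrier G" "g \<in> carrier G"
  shows "cell ys S \<otimes> e g = e g \<otimes> cell ys S"
  using assms(1)
proof (induction ys)
  case (Cons y ys)
  define q where "q = (if y \<in> S then e y else \<one> \<ominus> e y)"
  have q: "q \<in> carrier A" "q \<otimes> e g = e g \<otimes> q"
    using factor_comm[of g y "y \<in> S"] Cons.prems assms(2) by (auto simp: q_def e_closed)
  have c: "cell ys S \<in> carrier A" using Cons.prems by (intro cell_closed) auto
  have g: "e g \<in> carrier A" using assms(2) by (rule e_closed)
  have "q \<otimes> cell ys S \<otimes> e g = q \<otimes> (cell ys S \<otimes> e g)" using q c g by (simp add: m_assoc)
  also have "cell ys S \<otimes> e g = e g \<otimes> cell ys S" using Cons by simp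
  also have "q \<otimes> (e g \<otimes> cell ys S) = q \<otimes> e g \<otimes> cell ys S" using q(1) c g by (simp only: m_assoc)
  also have "\<dots> = e g \<otimes> (q \<otimes> cell ys S)" unfolding q(2) using q(1) c g by (simp only: m_assoc)
  finally show ?case by (simp add: cell_simps q_def)
qed (simp add: cell_simps e_closed assms)

text \<open>A cell is a common eigenvector of the idempotents occurring in it: \<open>e g\<close>
  commutes to a factor with its own index, where \<open>e g\<close> absorbs it and
  \<open>\<one> \<ominus> e g\<close> annihilates it.\<close>

lemma cell_mult_e:
  assumes "set ys \<subseteq> carrier G" "g \<in> set ys"
  shows "cell ys S \<otimes> e g = (if g \<in> S then cell ys S else \<zero>)"
  using assms
proof (induction ys)
  case (Cons y ys)
  define q where "q = (if y \<in> S then e y else \<one> \<ominus> e y)"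
  have gG: "g \<in> carrier G" and yG: "y \<in> carrier G" and ysG: "set ys \<subseteq> carrier G" using Cons.prems by auto
  have q: "q \<in> carrier A" using yG by (auto simp: q_def e_closed)
  have c: "cell ys S \<in> carrier A" using ysG by (rule cell_closed)
  have g: "e g \<in> carrier A" using gG by (rule e_closed)
  have eq: "q \<otimes> cell ys S \<otimes> e g = q \<otimes> (cell ys S \<otimes> e g)" using q c g by (simp add: m_assoc)
  have "q \<otimes> cell ys S \<otimes> e g = (if g \<in> S then q \<otimes> cell ys S else \<zero>)"
  proof (cases "g \<in> set ys")
    case True
    then show ?thesis unfolding eq using Cons.IH ysG q by simp
  next
    case False
    then have y: "y = g" using Cons.prems by auto
    have "q \<otimes> cell ys S \<otimes> e g = q \<otimes> e g \<otimes> cell ys S"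
      unfolding eq cell_comm[OF ysG gG] using q c g by (simp add: m_assoc)
    also have "q \<otimes> e g = (if g \<in> S then q else \<zero>)"
      using gG g M.r_neg[OF g] by (simp add: q_def y e_idem minus_distrib minus_eq[symmetric])
    finally show ?thesis using c by simp
  qed
  then show ?case by (simp add: cell_simps q_def)
qed simp

text \<open>Expansion of the product of the factors
  \<open>e y \<oplus> (\<one> \<ominus> e y)\<close>, the subset recording the summand taken in each
  factor. Distinctness ensures that the choice at the head of the list does not affect the
  tail.\<close>

lemma sum_cells:
  assumes "set ys \<subseteq> carrier G" "distinct ys"
  shows "(\<Oplus>S\<in>Pow (set ys). cell ys S) = \<one>"
  using assms
proof (induction ys)
  case Nil
  then show ?case by (simp add: cell_simps)
next
  case (Cons y ys)
  have yG: "y \<in> carrier G" and ysG: "set ys \<subseteq> carrier G" and y: "y \<notin> set ys" using Cons.prems by auto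
  note cl = e_closed[OF yG] cell_closed[OF ysG]
  have 1: "cell (y # ys) S = (\<one> \<ominus> e y) \<otimes> cell ys S" if "S \<in> Pow (set ys)" for S
    using that y by (auto simp: cell_simps)
  have 2: "cell (y # ys) (insert y S) = e y \<otimes> cell ys S" if "S \<in> Pow (set ys)" for S
    using that y cell_cong[of "insert y S" ys S] by (auto simp: cell_simps)
  have c: "cell (y # ys) S \<in> carrier A" for S using Cons.prems by (intro cell_closed) auto
  have inj: "inj_on (insert y) (Pow (set ys))" using y by (auto simp: inj_on_def)
  have "(\<Oplus>S\<in>Pow (set (y # ys)). cell (y # ys) S)
      = (\<Oplus>S\<in>Pow (set ys). cell (y # ys) S) \<oplus> (\<Oplus>S\<in>insert y ` Pow (set ys). cell (y # ys) S)"
    unfolding list.simps Pow_insert using y c by (intro finsum_Un_disjoint) auto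
  also have "(\<Oplus>S\<in>insert y ` Pow (set ys). cell (y # ys) S) = (\<Oplus>S\<in>Pow (set ys). cell (y # ys) (insert y S))"
    using c inj by (intro finsum_reindex) auto
  also have "\<dots> = (\<Oplus>S\<in>Pow (set ys). e y \<otimes> cell ys S)"
    using cl 2 by (intro add.finprod_cong') auto
  also have "(\<Oplus>S\<in>Pow (set ys). cell (y # ys) S) = (\<Oplus>S\<in>Pow (set ys). (\<one> \<ominus> e y) \<otimes> cell ys S)"
    using cl 1 by (intro add.finprod_cong') auto
  also have "\<dots> = (\<one> \<ominus> e y) \<otimes> (\<Oplus>S\<in>Pow (set ys). cell ys S)"
    using cl by (intro finsum_rdistr[symmetric]) auto
  also have "(\<Oplus>S\<in>Pow (set ys). e y \<otimes> cell ys S) = e y \<otimes> (\<Oplus>S\<in>Pow (set ys). cell ys S)"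
    using cl by (intro finsum_rdistr[symmetric]) auto
  finally show ?case using Cons cl by (simp add: minus_eq M.a_assoc M.l_neg)
qed

lemma zero_by_cells:
  assumes ys: "set ys \<subseteq> carrier G" "distinct ys" and z: "z \<in> carrier A"
    and zero: "\<And>S. S \<subseteq> set ys \<Longrightarrow> z \<otimes> cell ys S = \<zero>"
  shows "z = \<zero>"
proof -
  have "z = z \<otimes> (\<Oplus>S\<in>Pow (set ys). cell ys S)" using z sum_cells[OF ys] by simp
  also have "\<dots> = (\<Oplus>S\<in>Pow (set ys). z \<otimes> cell ys S)"
    using z cell_closed[OF ys(1)] by (intro finsum_rdistr) auto
  also have "\<dots> = \<zero>" by (intro add.finprod_one_eqI) (auto simp: zero)
  finally show ?thesis .
qed

end


section \<open>The space of a factor set\<close>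

context group begin

lemma topspace_Omega: "topspace (Omega_topology G) = Omega G"
  by (auto simp: Omega_topology_def topspace_pullback_topology)

lemma openin_Omega_mem:
  assumes "h \<in> carrier G"
  shows "openin (Omega_topology G) {\<xi> \<in> Omega G. h \<in> \<xi>}"
\<comment> \<open>The identity is not a coordinate of the product; every member of
  \<open>Omega G\<close> contains it.\<close>
proof (cases "h = \<one>")
  case True
  then have "{\<xi> \<in> Omega G. h \<in> \<xi>} = topspace (Omega_topology G)"
    by (auto simp: topspace_Omega Omega_def)
  then show ?thesis by simp
next
  case False
  let ?X = "product_topology (\<lambda>_. discrete_topology (UNIV :: bool set)) (carrier G - {\<one>})"
  let ?f = "\<lambda>\<xi>. \<lambda>g\<in>carrier G - {\<one>}. g \<in> \<xi>"
  have "continuous_map ?X (discrete_topology UNIV) (\<lambda>q. q h)"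
    using False assms by (intro continuous_map_product_projection) auto
  then have "continuous_map (Omega_topology G) (discrete_topology UNIV) ((\<lambda>q. q h) \<circ> ?f)"
    unfolding Omega_topology_def by (rule continuous_map_pullback)
  from openin_continuous_map_preimage[OF this, of "{True}"]
  have "openin (Omega_topology G) {\<xi> \<in> topspace (Omega_topology G). ((\<lambda>q. q h) \<circ> ?f) \<xi> \<in> {True}}" by simp
  then show ?thesis using False assms by (simp add: topspace_Omega)
qed

text \<open>The product is compact by the Tychonoff theorem, and the map \<open>r\<close>, which
  reads a set off its indicator function and restores the identity, carries it onto the whole space.
  Continuity of \<open>r\<close> into a pullback topology asks for continuity of its composite with
  the indicator map, and that composite is the identity on the product.\<close>

lemma compact_space_Omega: "compact_space (Omega_topology G)"
proof -
  let ?X = "product_topology (\<lambda>_. discrete_topology (UNIV :: bool set)) (carrier G - {\<one>})"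
  let ?f = "\<lambda>\<xi>. \<lambda>g\<in>carrier G - {\<one>}. g \<in> \<xi>"
  define r where "r q = {g \<in> carrier G. g = \<one> \<or> q g}" for q
  have X: "compact_space ?X"
    by (simp add: compact_space_product_topology compact_space_discrete_topology)
  have "continuous_map ?X ?X (?f \<circ> r)"
  proof (rule continuous_map_eq)
    show "continuous_map ?X ?X id" by (rule continuous_map_id)
    show "id q = (?f \<circ> r) q" if "q \<in> topspace ?X" for q
      using that by (auto simp: r_def PiE_def extensional_def fun_eq_iff)
  qed
  then have "continuous_map ?X (Omega_topology G) r"
    unfolding Omega_topology_def by (rule continuous_map_pullback') (auto simp: r_def Omega_def)
  then have "compactin (Omega_topology G) (r ` topspace ?X)"
    using X unfolding compact_space_def by (rule image_compactin[rotated])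
  moreover have "Omega G \<subseteq> r ` topspace ?X"
  proof
    fix \<xi> assume \<xi>: "\<xi> \<in> Omega G"
    then have "r (?f \<xi>) = \<xi>" by (auto simp: r_def Omega_def)
    moreover have "?f \<xi> \<in> topspace ?X" by simp
    ultimately show "\<xi> \<in> r ` topspace ?X" by (metis imageI)
  qed
  moreover have "r ` topspace ?X \<subseteq> Omega G" by (auto simp: r_def Omega_def)
  ultimately show ?thesis by (metis compact_space_def topspace_Omega subset_antisym)
qed

lemma prohibition_subset:
  "V \<in> prohibitions K G \<sigma> \<Longrightarrow> V \<subseteq> carrier G \<and> finite V"
  by (auto simp: prohibitions_def)

lemma openin_Omega_superset:
  assumes "finite V" "V \<subseteq> carrier G"
  shows "openin (Omega_topology G) {\<xi> \<in> Omega G. V \<subseteq> \<xi>}"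
  using assms
proof (induction rule: finite_induct)
  case empty
  then show ?case using openin_topspace[of "Omega_topology G"] by (simp add: topspace_Omega)
next
  case (insert v V)
  have "{\<xi> \<in> Omega G. insert v V \<subseteq> \<xi>} = {\<xi> \<in> Omega G. v \<in> \<xi>} \<inter> {\<xi> \<in> Omega G. V \<subseteq> \<xi>}" by auto
  then show ?case using insert by (simp add: openin_Int openin_Omega_mem)
qed

text \<open>The complement is the union of the sets of all supersets of a prohibition, and these are
  open because prohibitions are finite.\<close>

lemma closedin_Omega_sigma: "closedin (Omega_topology G) (Omega_sigma K G \<sigma>)"
proof -
  have "Omega G - Omega_sigma K G \<sigma> = (\<Union>V\<in>prohibitions K G \<sigma>. {\<xi> \<in> Omega G. V \<subseteq> \<xi>})"
    by (auto simp: Omega_sigma_def)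
  moreover have "openin (Omega_topology G) (\<Union>V\<in>prohibitions K G \<sigma>. {\<xi> \<in> Omega G. V \<subseteq> \<xi>})"
    using prohibition_subset by (intro openin_Union) (fastforce intro: openin_Omega_superset)
  ultimately show ?thesis
    by (auto simp: closedin_def topspace_Omega Omega_sigma_def)
qed

lemma Omega_sigma_subset:
  "\<lbrakk>A \<in> Omega_sigma K G \<sigma>; B \<subseteq> A; \<one> \<in> B\<rbrakk> \<Longrightarrow> B \<in> Omega_sigma K G \<sigma>"
  unfolding Omega_sigma_def Omega_def by blast

text \<open>A closed subspace of a compact space is compact, and a compact discrete space is
  finite.\<close>

lemma finite_Omega_sigma:
  assumes "Omega_sigma_topology K G \<sigma> = discrete_topology (Omega_sigma K G \<sigma>)"
  shows "finite (Omega_sigma K G \<sigma>)"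
proof -
  have "compact_space (Omega_sigma_topology K G \<sigma>)"
    unfolding Omega_sigma_topology_def
    by (intro compact_space_subtopology closedin_compact_space compact_space_Omega closedin_Omega_sigma)
  then show ?thesis by (simp add: assms compact_space_discrete_topology)
qed

text \<open>The family is closed under passing to subsets with the identity, so an infinite member
  would contribute infinitely many sets \<open>{\<one>, a}\<close>.\<close>

lemma finite_Omega_sigma_member:
  assumes "finite (Omega_sigma K G \<sigma>)" "A \<in> Omega_sigma K G \<sigma>"
  shows "finite A"
proof (rule ccontr)
  assume "infinite A"
  then have "infinite ((\<lambda>a. {\<one>, a}) ` A)"
  proof (rule contrapos_nn)
    assume fin: "finite ((\<lambda>a. {\<one>, a}) ` A)"
    have "A \<subseteq> \<Union> ((\<lambda>a. {\<one>, a}) ` A)" by auto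
    then show "finite A" using fin by (rule finite_subset[OF _ finite_Union]) auto
  qed
  moreover have "(\<lambda>a. {\<one>, a}) ` A \<subseteq> Omega_sigma K G \<sigma>"
    using assms(2) by (auto intro!: Omega_sigma_subset[OF assms(2)] simp: Omega_sigma_def Omega_def)
  ultimately show False using assms(1) finite_subset by blast
qed

section \<open>The factor set along members of \<open>Omega_sigma\<close>, and translation of
  members\<close>

lemma Omega_sigma_nonzero:
  assumes "A \<in> Omega_sigma K G \<sigma>" "h \<in> carrier G" "g \<in> carrier G" "s \<in> carrier G"
    "h \<in> A" "h \<otimes> g \<in> A" "h \<otimes> g \<otimes> s \<in> A"
  shows "\<sigma> g s \<noteq> \<zero>\<^bsub>K\<^esub>"
proof
  assume "\<sigma> g s = \<zero>\<^bsub>K\<^esub>"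
  then have "{h, h \<otimes> g, h \<otimes> g \<otimes> s} \<in> prohibitions K G \<sigma>"
    unfolding prohibitions_def using assms by blast
  then show False using assms by (auto simp: Omega_sigma_def)
qed

lemma Omega_sigma_cocycle:
  assumes "A \<in> Omega_sigma K G \<sigma>" "h \<in> carrier G" "g \<in> carrier G" "s \<in> carrier G" "t \<in> carrier G"
    "h \<in> A" "h \<otimes> g \<in> A" "h \<otimes> g \<otimes> s \<in> A" "h \<otimes> g \<otimes> s \<otimes> t \<in> A"
  shows "\<sigma> g (s \<otimes> t) \<otimes>\<^bsub>K\<^esub> \<sigma> s t = \<sigma> g s \<otimes>\<^bsub>K\<^esub> \<sigma> (g \<otimes> s) t"
proof (rule ccontr)
  assume neq: "\<sigma> g (s \<otimes> t) \<otimes>\<^bsub>K\<^esub> \<sigma> s t \<noteq> \<sigma> g s \<otimes>\<^bsub>K\<^esub> \<sigma> (g \<otimes> s) t"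
  then have "{h, h \<otimes> g, h \<otimes> g \<otimes> s, h \<otimes> g \<otimes> s \<otimes> t} \<in> prohibitions K G \<sigma>"
    unfolding prohibitions_def using assms(2-5) by blast
  then show False using assms by (auto simp: Omega_sigma_def)
qed

lemma mem_l_coset_iff:
  assumes "g \<in> carrier G" "h \<in> carrier G" "A \<subseteq> carrier G"
  shows "h \<in> g <# A \<longleftrightarrow> inv g \<otimes> h \<in> A"
proof
  assume "inv g \<otimes> h \<in> A"
  moreover have "h = g \<otimes> (inv g \<otimes> h)" using assms by (simp add: m_assoc[symmetric])
  ultimately show "h \<in> g <# A" unfolding l_coset_def by blast
next
  assume "h \<in> g <# A"
  then obtain a where "a \<in> A" "h = g \<otimes> a" unfolding l_coset_def by blast
  then show "inv g \<otimes> h \<in> A" using assms by (simp add: m_assoc[symmetric] subset_iff)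
qed

text \<open>The base point \<open>h\<close> of a prohibition is arbitrary, and the condition on
  \<sigma> does not involve it.\<close>

lemma prohibition_translate:
  assumes "V \<in> prohibitions K G \<sigma>" "k \<in> carrier G"
  shows "(\<otimes>) k ` V \<in> prohibitions K G \<sigma>"
  using assms(1) unfolding prohibitions_def Un_iff mem_Collect_eq
proof (elim disjE exE conjE)
  fix h g s assume h: "h \<in> carrier G" "g \<in> carrier G" "s \<in> carrier G" "\<sigma> g s = \<zero>\<^bsub>K\<^esub>"
    "V = {h, h \<otimes> g, h \<otimes> g \<otimes> s}"
  then have "(\<otimes>) k ` V = {k \<otimes> h, k \<otimes> h \<otimes> g, k \<otimes> h \<otimes> g \<otimes> s}"
    using assms(2) by (simp add: m_assoc)
  then show "(\<exists>h g s. (\<otimes>) k ` V = {h, h \<otimes> g, h \<otimes> g \<otimes> s} \<and> h \<in> carrier G \<and> g \<in> carrier G \<and>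
      s \<in> carrier G \<and> \<sigma> g s = \<zero>\<^bsub>K\<^esub>) \<or>
    (\<exists>h g s t. (\<otimes>) k ` V = {h, h \<otimes> g, h \<otimes> g \<otimes> s, h \<otimes> g \<otimes> s \<otimes> t} \<and> h \<in> carrier G \<and>
      g \<in> carrier G \<and> s \<in> carrier G \<and> t \<in> carrier G \<and>
      \<sigma> g (s \<otimes> t) \<otimes>\<^bsub>K\<^esub> \<sigma> s t \<noteq> \<sigma> g s \<otimes>\<^bsub>K\<^esub> \<sigma> (g \<otimes> s) t)"
    using h(1-4) assms(2) by (metis m_closed)
next
  fix h g s t assume h: "h \<in> carrier G" "g \<in> carrier G" "s \<in> carrier G" "t \<in> carrier G"
    "\<sigma> g (s \<otimes> t) \<otimes>\<^bsub>K\<^esub> \<sigma> s t \<noteq> \<sigma> g s \<otimes>\<^bsub>K\<^esub> \<sigma> (g \<otimes> s) t"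
    "V = {h, h \<otimes> g, h \<otimes> g \<otimes> s, h \<otimes> g \<otimes> s \<otimes> t}"
  then have "(\<otimes>) k ` V = {k \<otimes> h, k \<otimes> h \<otimes> g, k \<otimes> h \<otimes> g \<otimes> s, k \<otimes> h \<otimes> g \<otimes> s \<otimes> t}"
    using assms(2) by (simp add: m_assoc)
  then show "(\<exists>h g s. (\<otimes>) k ` V = {h, h \<otimes> g, h \<otimes> g \<otimes> s} \<and> h \<in> carrier G \<and> g \<in> carrier G \<and>
      s \<in> carrier G \<and> \<sigma> g s = \<zero>\<^bsub>K\<^esub>) \<or>
    (\<exists>h g s t. (\<otimes>) k ` V = {h, h \<otimes> g, h \<otimes> g \<otimes> s, h \<otimes> g \<otimes> s \<otimes> t} \<and> h \<in> carrier G \<and>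
      g \<in> carrier G \<and> s \<in> carrier G \<and> t \<in> carrier G \<and>
      \<sigma> g (s \<otimes> t) \<otimes>\<^bsub>K\<^esub> \<sigma> s t \<noteq> \<sigma> g s \<otimes>\<^bsub>K\<^esub> \<sigma> (g \<otimes> s) t)"
    using h(1-5) assms(2) by (metis m_closed)
qed

text \<open>This is the partial action of \<open>G\<close> on \<open>Omega_sigma\<close> along which
  basis vectors of \<open>R\<close> compose. Translation by \<open>g\<close> requires
  \<open>inv g \<in> A\<close>, since the translate has to contain the identity.\<close>

lemma Omega_sigma_translate:
  assumes A: "A \<in> Omega_sigma K G \<sigma>" and g: "g \<in> carrier G" "inv g \<in> A"
  shows "g <# A \<in> Omega_sigma K G \<sigma>"
proof -
  have AG: "A \<subseteq> carrier G" using A by (auto simp: Omega_sigma_def Omega_def)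
  have "g <# A \<subseteq> carrier G" using AG g by (intro l_coset_subset_G)
  moreover have "\<one> \<in> g <# A" using g AG by (simp add: mem_l_coset_iff)
  moreover have False if V: "V \<in> prohibitions K G \<sigma>" "V \<subseteq> g <# A" for V
  proof -
    have "(\<otimes>) (inv g) ` V \<subseteq> A"
      using V prohibition_subset[OF V(1)] mem_l_coset_iff[OF g(1) _ AG] by blast
    moreover have "(\<otimes>) (inv g) ` V \<in> prohibitions K G \<sigma>"
      using V(1) g by (intro prohibition_translate) auto
    ultimately show False using A by (auto simp: Omega_sigma_def)
  qed
  ultimately show ?thesis by (auto simp: Omega_sigma_def Omega_def)
qed

end


section \<open>The algebra \<open>\<R>\<^sup>\<sigma>(G)\<close>\<close>

text \<open>The consequences of membership in \<open>pm\<close> on which the proof rests. The last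
  two normalizations are conditional, because \<open>\<sigma> \<one> g\<close> and
  \<open>\<sigma> g \<one>\<close> are zero wherever the given representation vanishes at
  \<open>g\<close>.\<close>

locale factor_set = tpg_presentation + K: field K +
  assumes sigma_inv: "g \<in> carrier G \<Longrightarrow> \<sigma> g (inv\<^bsub>G\<^esub> g) = \<sigma> (inv\<^bsub>G\<^esub> g) g"
    and sigma_one_one: "\<sigma> \<one>\<^bsub>G\<^esub> \<one>\<^bsub>G\<^esub> = \<one>\<^bsub>K\<^esub>"
    and sigma_one_left: "\<lbrakk>g \<in> carrier G; \<sigma> \<one>\<^bsub>G\<^esub> g \<noteq> \<zero>\<^bsub>K\<^esub>\<rbrakk> \<Longrightarrow> \<sigma> \<one>\<^bsub>G\<^esub> g = \<one>\<^bsub>K\<^esub>"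
    and sigma_one_right: "\<lbrakk>g \<in> carrier G; \<sigma> g \<one>\<^bsub>G\<^esub> \<noteq> \<zero>\<^bsub>K\<^esub>\<rbrakk> \<Longrightarrow> \<sigma> g \<one>\<^bsub>G\<^esub> = \<one>\<^bsub>K\<^esub>"

text \<open>Two scalars agree if they act equally on a nonzero vector, here
  \<open>\<Gamma> g\<close> or the unit. The condition that a vanishing product forces a zero of
  \<sigma> deals with \<open>\<Gamma> g = 0\<close>. From here on the given representation and its
  algebra are out of the picture.\<close>

lemma pm_factor_set:
  fixes K :: "('k, 'm) ring_scheme" and G :: "('g, 'n) monoid_scheme"
  assumes K: "field K" and G: "group G" and pm: "\<sigma> \<in> pm TYPE('r) K G"
  shows "factor_set K G \<sigma>"
proof -
  interpret K: field K by (rule K)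
  interpret G: group G by (rule G)
  obtain R :: "('k, 'r) module" and \<Gamma> where R: "unital_algebra K R" and ne: "\<one>\<^bsub>R\<^esub> \<noteq> \<zero>\<^bsub>R\<^esub>"
    and rep: "partial_projective_rep K G R \<sigma> \<Gamma>"
    using pm unfolding pm_def by blast
  interpret R: unital_algebra K R by (rule R)
  have cl: "g \<in> carrier G \<Longrightarrow> h \<in> carrier G \<Longrightarrow> \<sigma> g h \<in> carrier K"
    "g \<in> carrier G \<Longrightarrow> \<Gamma> g \<in> carrier R" and one: "\<Gamma> \<one>\<^bsub>G\<^esub> = \<one>\<^bsub>R\<^esub>" for g h
    using rep unfolding partial_projective_rep_def by blast+
  have z: "\<sigma> g h = \<zero>\<^bsub>K\<^esub>" if "g \<in> carrier G" "h \<in> carrier G" "\<Gamma> g \<otimes>\<^bsub>R\<^esub> \<Gamma> h = \<zero>\<^bsub>R\<^esub>" for g h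
    using rep that unfolding partial_projective_rep_def by blast
  have l: "\<Gamma> (inv\<^bsub>G\<^esub> g) \<otimes>\<^bsub>R\<^esub> \<Gamma> g \<otimes>\<^bsub>R\<^esub> \<Gamma> h =
        \<sigma> g h \<odot>\<^bsub>R\<^esub> (\<Gamma> (inv\<^bsub>G\<^esub> g) \<otimes>\<^bsub>R\<^esub> \<Gamma> (g \<otimes>\<^bsub>G\<^esub> h))"
    and r: "\<Gamma> g \<otimes>\<^bsub>R\<^esub> \<Gamma> h \<otimes>\<^bsub>R\<^esub> \<Gamma> (inv\<^bsub>G\<^esub> h) =
        \<sigma> g h \<odot>\<^bsub>R\<^esub> (\<Gamma> (g \<otimes>\<^bsub>G\<^esub> h) \<otimes>\<^bsub>R\<^esub> \<Gamma> (inv\<^bsub>G\<^esub> h))"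
    if "g \<in> carrier G" "h \<in> carrier G" for g h
    using rep that unfolding partial_projective_rep_def by blast+
  have eq: "a = b" if "a \<in> carrier K" "b \<in> carrier K" "y \<in> carrier R" "y \<noteq> \<zero>\<^bsub>R\<^esub>"
    "a \<odot>\<^bsub>R\<^esub> y = b \<odot>\<^bsub>R\<^esub> y" for a b y
    using R.smult_eq_imp_zero[OF K that(1,2) _ that(3,5)] that(4) by blast
  have unit: "s = \<one>\<^bsub>K\<^esub>" if "s \<in> carrier K" "y \<in> carrier R" "y \<noteq> \<zero>\<^bsub>R\<^esub>" "y = s \<odot>\<^bsub>R\<^esub> y" for s y
    using eq[of s "\<one>\<^bsub>K\<^esub>" y] that by simp
  show ?thesis
  proof unfold_locales
    fix g assume g: "g \<in> carrier G"
    have gr: "\<Gamma> g \<otimes>\<^bsub>R\<^esub> \<Gamma> (inv\<^bsub>G\<^esub> g) \<otimes>\<^bsub>R\<^esub> \<Gamma> g = \<sigma> g (inv\<^bsub>G\<^esub> g) \<odot>\<^bsub>R\<^esub> \<Gamma> g"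
      using r[of g "inv\<^bsub>G\<^esub> g"] g by (simp add: one cl)
    have gl: "\<Gamma> g \<otimes>\<^bsub>R\<^esub> \<Gamma> (inv\<^bsub>G\<^esub> g) \<otimes>\<^bsub>R\<^esub> \<Gamma> g = \<sigma> (inv\<^bsub>G\<^esub> g) g \<odot>\<^bsub>R\<^esub> \<Gamma> g"
      using l[of "inv\<^bsub>G\<^esub> g" g] g by (simp add: one cl)
    show "\<sigma> g (inv\<^bsub>G\<^esub> g) = \<sigma> (inv\<^bsub>G\<^esub> g) g"
    proof (cases "\<Gamma> g = \<zero>\<^bsub>R\<^esub>")
      case True
      then show ?thesis using g z[of g "inv\<^bsub>G\<^esub> g"] z[of "inv\<^bsub>G\<^esub> g" g] by (simp add: cl)
    next
      case False
      then show ?thesis using g gr gl by (intro eq[of _ _ "\<Gamma> g"]) (simp_all add: cl)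
    qed
    assume "\<sigma> \<one>\<^bsub>G\<^esub> g \<noteq> \<zero>\<^bsub>K\<^esub>"
    then have "\<Gamma> g \<noteq> \<zero>\<^bsub>R\<^esub>" using z[of "\<one>\<^bsub>G\<^esub>" g] g by (auto simp: cl one)
    then show "\<sigma> \<one>\<^bsub>G\<^esub> g = \<one>\<^bsub>K\<^esub>"
      using g l[of "\<one>\<^bsub>G\<^esub>" g] by (intro unit[of _ "\<Gamma> g"]) (simp_all add: cl one)
  next
    fix g assume g: "g \<in> carrier G" "\<sigma> g \<one>\<^bsub>G\<^esub> \<noteq> \<zero>\<^bsub>K\<^esub>"
    then have "\<Gamma> g \<noteq> \<zero>\<^bsub>R\<^esub>" using z[of g "\<one>\<^bsub>G\<^esub>"] by (auto simp: cl one)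
    then show "\<sigma> g \<one>\<^bsub>G\<^esub> = \<one>\<^bsub>K\<^esub>"
      using g(1) r[of g "\<one>\<^bsub>G\<^esub>"] by (intro unit[of _ "\<Gamma> g"]) (simp_all add: cl one)
  next
    show "\<sigma> \<one>\<^bsub>G\<^esub> \<one>\<^bsub>G\<^esub> = \<one>\<^bsub>K\<^esub>"
      using ne l[of "\<one>\<^bsub>G\<^esub>" "\<one>\<^bsub>G\<^esub>"] by (intro unit[of _ "\<one>\<^bsub>R\<^esub>"]) (simp_all add: cl one)
  qed (simp_all add: cl)
qed

lemma (in factor_set) factor_set_repI:
  assumes "tpg_rep A K G \<sigma> x" shows "factor_set_rep A K G \<sigma> x"
  by (intro factor_set_rep.intro assms K.field_axioms factor_set_rep_axioms.intro)
    (simp_all add: sigma_inv sigma_one_one)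

locale finite_factor_set = factor_set +
  assumes finite_Omega: "finite (Omega_sigma K G \<sigma>)"
begin

abbreviation "\<Omega> \<equiv> Omega_sigma K G \<sigma>"
abbreviation "R \<equiv> R_alg K G \<sigma>"
abbreviation "\<mu> \<equiv> R_basis_mult K G \<sigma>"

lemma OmegaD: "A \<in> \<Omega> \<Longrightarrow> A \<subseteq> carrier G" "A \<in> \<Omega> \<Longrightarrow> \<one>\<^bsub>G\<^esub> \<in> A"
  by (auto simp: Omega_sigma_def Omega_def)

lemma R_basis_iff:
  "(g, A) \<in> R_basis K G \<sigma> \<longleftrightarrow> g \<in> carrier G \<and> A \<in> \<Omega> \<and> inv\<^bsub>G\<^esub> g \<in> A"
  by (auto simp: R_basis_def)

lemma mem_translate_iff:
  "\<lbrakk>g \<in> carrier G; h \<in> carrier G; A \<in> \<Omega>\<rbrakk> \<Longrightarrow>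
    inv\<^bsub>G\<^esub> h \<in> g <#\<^bsub>G\<^esub> A \<longleftrightarrow> inv\<^bsub>G\<^esub> (h \<otimes>\<^bsub>G\<^esub> g) \<in> A"
  by (simp add: G.mem_l_coset_iff OmegaD G.inv_mult_group)

lemma translate_one: "A \<in> \<Omega> \<Longrightarrow> \<one>\<^bsub>G\<^esub> <#\<^bsub>G\<^esub> A = A"
  using OmegaD(1) by (force simp: l_coset_def)

lemma translate_mult:
  "\<lbrakk>g \<in> carrier G; h \<in> carrier G; A \<in> \<Omega>\<rbrakk> \<Longrightarrow> g <#\<^bsub>G\<^esub> (h <#\<^bsub>G\<^esub> A) = (g \<otimes>\<^bsub>G\<^esub> h) <#\<^bsub>G\<^esub> A"
  by (simp add: G.lcos_m_assoc OmegaD)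

text \<open>If \<open>\<sigma> g \<one>\<close> were zero, the type I prohibition with base point
  \<open>inv g\<close> would consist of \<open>inv g\<close> and the identity, both of which lie in
  \<open>A\<close>. The left-hand version uses the same base point.\<close>

lemma sigma_one_right_mem:
  assumes "A \<in> \<Omega>" "g \<in> carrier G" "inv\<^bsub>G\<^esub> g \<in> A" shows "\<sigma> g \<one>\<^bsub>G\<^esub> = \<one>\<^bsub>K\<^esub>"
  using G.Omega_sigma_nonzero[OF assms(1), of "inv\<^bsub>G\<^esub> g" g "\<one>\<^bsub>G\<^esub>"] assms
  by (intro sigma_one_right) (auto simp: OmegaD)

lemma sigma_one_left_mem:
  assumes "A \<in> \<Omega>" "g \<in> carrier G" "inv\<^bsub>G\<^esub> g \<in> A" shows "\<sigma> \<one>\<^bsub>G\<^esub> g = \<one>\<^bsub>K\<^esub>"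
  using G.Omega_sigma_nonzero[OF assms(1), of "inv\<^bsub>G\<^esub> g" "\<one>\<^bsub>G\<^esub>" g] assms
  by (intro sigma_one_left) (auto simp: OmegaD)

lemma R_basis_mult_eq:
  "\<mu> (g, B) (h, A) y = (if B = h <#\<^bsub>G\<^esub> A then \<sigma> g h \<otimes>\<^bsub>K\<^esub> ind K {(g \<otimes>\<^bsub>G\<^esub> h, A)} y else \<zero>\<^bsub>K\<^esub>)"
  by (auto simp: R_basis_mult_def)

text \<open>Closure of the span under the product: for \<open>B = h <# A\<close>, the condition
  \<open>inv g \<in> B\<close> says that the inverse of \<open>g \<otimes> h\<close> lies in
  \<open>A\<close>, so the resulting pair is again a basis index.\<close>

sublocale R: based_bilinear K "R_basis K G \<sigma>" \<mu> "ind K ({\<one>\<^bsub>G\<^esub>} \<times> \<Omega>)" R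
proof (unfold_locales, rule R_alg_def)
  fix p q assume "p \<in> R_basis K G \<sigma>" "q \<in> R_basis K G \<sigma>"
  then obtain g B h A where pq: "p = (g, B)" "q = (h, A)"
    and g: "g \<in> carrier G" "B \<in> \<Omega>" "inv\<^bsub>G\<^esub> g \<in> B" and h: "h \<in> carrier G" "A \<in> \<Omega>" "inv\<^bsub>G\<^esub> h \<in> A"
    by (auto simp: R_basis_def)
  show "\<mu> p q \<in> carrier R"
  proof (cases "B = h <#\<^bsub>G\<^esub> A")
    case True
    have "supp K (\<mu> p q) \<subseteq> {(g \<otimes>\<^bsub>G\<^esub> h, A)}"
      using g h by (auto simp: pq R_basis_mult_eq supp_def ind_def sigma_closed split: if_splits)
    moreover have "(g \<otimes>\<^bsub>G\<^esub> h, A) \<in> R_basis K G \<sigma>"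
      using g h True by (simp add: R_basis_iff mem_translate_iff)
    moreover have "range (\<mu> p q) \<subseteq> carrier K"
      using g h by (auto simp: pq R_basis_mult_eq ind_def sigma_closed)
    ultimately show ?thesis by (auto simp: R_alg_def basis_alg_def intro: finite_subset)
  next
    case False
    then show ?thesis by (auto simp: pq R_basis_mult_eq R_alg_def basis_alg_def supp_def)
  qed
qed

lemma basis_mult_eq:
  assumes "(g, B) \<in> R_basis K G \<sigma>" "(h, A) \<in> R_basis K G \<sigma>"
  shows "ind K {(g, B)} \<otimes>\<^bsub>R\<^esub> ind K {(h, A)} =
    (if B = h <#\<^bsub>G\<^esub> A then \<sigma> g h \<odot>\<^bsub>R\<^esub> ind K {(g \<otimes>\<^bsub>G\<^esub> h, A)} else \<zero>\<^bsub>R\<^esub>)"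
  unfolding R.basis_mult[OF assms] by (auto simp: R_basis_mult_eq R.basis_alg_simps(3,5) fun_eq_iff)

lemma finite_unit_support: "finite ({\<one>\<^bsub>G\<^esub>} \<times> \<Omega>)" "{\<one>\<^bsub>G\<^esub>} \<times> \<Omega> \<subseteq> R_basis K G \<sigma>"
  using finite_Omega by (auto simp: R_basis_iff OmegaD)

lemma R_unit_left:
  assumes p: "p \<in> R_basis K G \<sigma>"
  shows "ind K ({\<one>\<^bsub>G\<^esub>} \<times> \<Omega>) \<otimes>\<^bsub>R\<^esub> ind K {p} = ind K {p}"
proof
  fix y
  obtain g A where g: "p = (g, A)" "g \<in> carrier G" "A \<in> \<Omega>" "inv\<^bsub>G\<^esub> g \<in> A"
    using p by (auto simp: R_basis_def)
  \<comment> \<open>The only summand of the unit that composes with \<open>(g, A)\<close> from the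
    left.\<close>
  let ?q = "(\<one>\<^bsub>G\<^esub>, g <#\<^bsub>G\<^esub> A)"
  have q: "?q \<in> {\<one>\<^bsub>G\<^esub>} \<times> \<Omega>" using G.Omega_sigma_translate g by auto
  have "(ind K ({\<one>\<^bsub>G\<^esub>} \<times> \<Omega>) \<otimes>\<^bsub>R\<^esub> ind K {p}) y
      = (\<Oplus>\<^bsub>K\<^esub>q\<in>{\<one>\<^bsub>G\<^esub>} \<times> \<Omega>. \<Oplus>\<^bsub>K\<^esub>r\<in>{p}. ind K ({\<one>\<^bsub>G\<^esub>} \<times> \<Omega>) q \<otimes>\<^bsub>K\<^esub> ind K {p} r \<otimes>\<^bsub>K\<^esub> \<mu> q r y)"
    using p finite_unit_support
    by (intro R.mult_eq_sum R.ind_closed R.basis_closed) (auto simp: supp_def ind_def)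
  also have "\<dots> = (\<Oplus>\<^bsub>K\<^esub>q\<in>{\<one>\<^bsub>G\<^esub>} \<times> \<Omega>. if ?q = q then ind K {p} y else \<zero>\<^bsub>K\<^esub>)"
    using g by (intro add.finprod_cong')
      (auto simp: ind_def R_basis_mult_eq sigma_closed sigma_one_left_mem split: if_splits)
  also have "\<dots> = ind K {p} y"
    using q finite_unit_support(1) by (subst add.finprod_singleton[of ?q]) (auto simp: ind_def)
  finally show "(ind K ({\<one>\<^bsub>G\<^esub>} \<times> \<Omega>) \<otimes>\<^bsub>R\<^esub> ind K {p}) y = ind K {p} y" .
qed

lemma R_unit_right:
  assumes p: "p \<in> R_basis K G \<sigma>"
  shows "ind K {p} \<otimes>\<^bsub>R\<^esub> ind K ({\<one>\<^bsub>G\<^esub>} \<times> \<Omega>) = ind K {p}"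
proof
  fix y
  obtain g A where g: "p = (g, A)" "g \<in> carrier G" "A \<in> \<Omega>" "inv\<^bsub>G\<^esub> g \<in> A"
    using p by (auto simp: R_basis_def)
  let ?q = "(\<one>\<^bsub>G\<^esub>, A)"
  have q: "?q \<in> {\<one>\<^bsub>G\<^esub>} \<times> \<Omega>" using g by auto
  have "(ind K {p} \<otimes>\<^bsub>R\<^esub> ind K ({\<one>\<^bsub>G\<^esub>} \<times> \<Omega>)) y
      = (\<Oplus>\<^bsub>K\<^esub>r\<in>{p}. \<Oplus>\<^bsub>K\<^esub>q\<in>{\<one>\<^bsub>G\<^esub>} \<times> \<Omega>. ind K {p} r \<otimes>\<^bsub>K\<^esub> ind K ({\<one>\<^bsub>G\<^esub>} \<times> \<Omega>) q \<otimes>\<^bsub>K\<^esub> \<mu> r q y)"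
    using p finite_unit_support
    by (intro R.mult_eq_sum R.ind_closed R.basis_closed) (auto simp: supp_def ind_def)
  also have "\<dots> = (\<Oplus>\<^bsub>K\<^esub>r\<in>{p}. \<Oplus>\<^bsub>K\<^esub>q\<in>{\<one>\<^bsub>G\<^esub>} \<times> \<Omega>. if ?q = q then ind K {p} y else \<zero>\<^bsub>K\<^esub>)"
    using g by (intro add.finprod_cong' finsum_closed funcsetI)
      (auto simp: ind_def R_basis_mult_eq sigma_closed sigma_one_right_mem translate_one split: if_splits)
  also have "\<dots> = (\<Oplus>\<^bsub>K\<^esub>r\<in>{p}. ind K {p} y)"
    using q finite_unit_support(1) by (subst add.finprod_singleton[of ?q]) (auto simp: ind_def)
  also have "\<dots> = ind K {p} y" by (simp add: ind_def)
  finally show "(ind K {p} \<otimes>\<^bsub>R\<^esub> ind K ({\<one>\<^bsub>G\<^esub>} \<times> \<Omega>)) y = ind K {p} y" .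
qed

text \<open>Both bracketings vanish unless all three factors compose. Then they differ in their
  coefficients only, and equality of these is the cocycle identity, which holds because
  \<open>A\<close> contains no type II prohibition.\<close>

lemma R_basis_assoc:
  assumes "p \<in> R_basis K G \<sigma>" "q \<in> R_basis K G \<sigma>" "r \<in> R_basis K G \<sigma>"
  shows "\<mu> p q \<otimes>\<^bsub>R\<^esub> ind K {r} = ind K {p} \<otimes>\<^bsub>R\<^esub> \<mu> q r"
proof -
  obtain g C h B k A where pqr: "p = (g, C)" "q = (h, B)" "r = (k, A)"
    and g: "g \<in> carrier G" "C \<in> \<Omega>" "inv\<^bsub>G\<^esub> g \<in> C" and h: "h \<in> carrier G" "B \<in> \<Omega>" "inv\<^bsub>G\<^esub> h \<in> B"
    and k: "k \<in> carrier G" "A \<in> \<Omega>" "inv\<^bsub>G\<^esub> k \<in> A"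
    using assms by (auto simp: R_basis_def)
  note pq = assms[unfolded pqr]
  have left: "(ind K {p} \<otimes>\<^bsub>R\<^esub> ind K {q}) \<otimes>\<^bsub>R\<^esub> ind K {r} =
    (if C = h <#\<^bsub>G\<^esub> B \<and> B = k <#\<^bsub>G\<^esub> A
     then \<sigma> g h \<odot>\<^bsub>R\<^esub> (\<sigma> (g \<otimes>\<^bsub>G\<^esub> h) k \<odot>\<^bsub>R\<^esub> ind K {(g \<otimes>\<^bsub>G\<^esub> h \<otimes>\<^bsub>G\<^esub> k, A)}) else \<zero>\<^bsub>R\<^esub>)"
  proof (cases "C = h <#\<^bsub>G\<^esub> B")
    case True
    then have "(g \<otimes>\<^bsub>G\<^esub> h, B) \<in> R_basis K G \<sigma>" using g h by (simp add: R_basis_iff mem_translate_iff)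
    then show ?thesis using g h k pq True
      by (simp add: pqr basis_mult_eq R.scal_mult R.basis_closed sigma_closed)
        (simp add: R.basis_alg_simps sigma_closed)
  next
    case False
    then show ?thesis using pq by (simp add: pqr basis_mult_eq R.zero_mult)
  qed
  have right: "ind K {p} \<otimes>\<^bsub>R\<^esub> (ind K {q} \<otimes>\<^bsub>R\<^esub> ind K {r}) =
    (if C = h <#\<^bsub>G\<^esub> B \<and> B = k <#\<^bsub>G\<^esub> A
     then \<sigma> h k \<odot>\<^bsub>R\<^esub> (\<sigma> g (h \<otimes>\<^bsub>G\<^esub> k) \<odot>\<^bsub>R\<^esub> ind K {(g \<otimes>\<^bsub>G\<^esub> (h \<otimes>\<^bsub>G\<^esub> k), A)}) else \<zero>\<^bsub>R\<^esub>)"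
  proof (cases "B = k <#\<^bsub>G\<^esub> A")
    case True
    then have "(h \<otimes>\<^bsub>G\<^esub> k, A) \<in> R_basis K G \<sigma>" using k h by (simp add: R_basis_iff mem_translate_iff)
    then show ?thesis using g h k pq True
      by (simp add: pqr basis_mult_eq R.scal_mult R.basis_closed sigma_closed translate_mult)
        (simp add: R.basis_alg_simps sigma_closed)
  next
    case False
    then show ?thesis using pq by (simp add: pqr basis_mult_eq R.mult_zero)
  qed
  have "\<sigma> g (h \<otimes>\<^bsub>G\<^esub> k) \<otimes>\<^bsub>K\<^esub> \<sigma> h k = \<sigma> g h \<otimes>\<^bsub>K\<^esub> \<sigma> (g \<otimes>\<^bsub>G\<^esub> h) k"
    if "C = h <#\<^bsub>G\<^esub> B" "B = k <#\<^bsub>G\<^esub> A"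
  \<comment> \<open>From this base point the four points are the inverses of
    \<open>g \<otimes> h \<otimes> k\<close>, of \<open>h \<otimes> k\<close> and of
    \<open>k\<close>, and the identity. They belong to \<open>A\<close> because the factors
    compose.\<close>
  proof (rule G.Omega_sigma_cocycle[OF k(2) _ g(1) h(1) k(1), of "inv\<^bsub>G\<^esub> (g \<otimes>\<^bsub>G\<^esub> h \<otimes>\<^bsub>G\<^esub> k)"])
    have "inv\<^bsub>G\<^esub> (h \<otimes>\<^bsub>G\<^esub> k) \<in> A" using h that k by (simp add: mem_translate_iff)
    then show "inv\<^bsub>G\<^esub> (g \<otimes>\<^bsub>G\<^esub> h \<otimes>\<^bsub>G\<^esub> k) \<otimes>\<^bsub>G\<^esub> g \<in> A"
      using g h k by (simp add: G.inv_mult_group G.m_assoc)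
    have "inv\<^bsub>G\<^esub> g \<in> (h \<otimes>\<^bsub>G\<^esub> k) <#\<^bsub>G\<^esub> A" using g that h k by (simp add: translate_mult)
    then show "inv\<^bsub>G\<^esub> (g \<otimes>\<^bsub>G\<^esub> h \<otimes>\<^bsub>G\<^esub> k) \<in> A"
      using g h k by (simp add: mem_translate_iff G.m_assoc)
    show "inv\<^bsub>G\<^esub> (g \<otimes>\<^bsub>G\<^esub> h \<otimes>\<^bsub>G\<^esub> k) \<otimes>\<^bsub>G\<^esub> g \<otimes>\<^bsub>G\<^esub> h \<in> A"
      using g h k by (simp add: G.inv_mult_group G.m_assoc)
    show "inv\<^bsub>G\<^esub> (g \<otimes>\<^bsub>G\<^esub> h \<otimes>\<^bsub>G\<^esub> k) \<otimes>\<^bsub>G\<^esub> g \<otimes>\<^bsub>G\<^esub> h \<otimes>\<^bsub>G\<^esub> k \<in> A"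
      using g h k by (simp add: G.inv_mult_group G.m_assoc OmegaD)
  qed (use g h k in simp)
  then have "(ind K {p} \<otimes>\<^bsub>R\<^esub> ind K {q}) \<otimes>\<^bsub>R\<^esub> ind K {r} = ind K {p} \<otimes>\<^bsub>R\<^esub> (ind K {q} \<otimes>\<^bsub>R\<^esub> ind K {r})"
    unfolding left right using g h k
    by (auto simp: R.basis_alg_simps sigma_closed G.m_assoc m_assoc[symmetric] ind_def m_comm)
  then show ?thesis using assms by (simp add: R.basis_mult)
qed

sublocale R: based_algebra K "R_basis K G \<sigma>" \<mu> "ind K ({\<one>\<^bsub>G\<^esub>} \<times> \<Omega>)" R
  by unfold_locales
    (simp_all add: R_basis_assoc R_unit_left R_unit_right R.ind_closed finite_unit_support)

sublocale RA: unital_algebra K R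
  by (rule R.unital_algebra)

section \<open>The images of the generators in \<open>R\<close>\<close>

definition "R_gen h = (\<Oplus>\<^bsub>R\<^esub>A\<in>{A \<in> \<Omega>. inv\<^bsub>G\<^esub> h \<in> A}. ind K {(h, A)})"

lemma R_gen_closed: "h \<in> carrier G \<Longrightarrow> R_gen h \<in> carrier R"
  unfolding R_gen_def by (intro RA.M.finsum_closed) (auto simp: R_basis_iff intro!: R.basis_closed)

lemma R_gen_one: "R_gen \<one>\<^bsub>G\<^esub> = \<one>\<^bsub>R\<^esub>"
proof -
  have "\<one>\<^bsub>R\<^esub> = (\<Oplus>\<^bsub>R\<^esub>p\<in>{\<one>\<^bsub>G\<^esub>} \<times> \<Omega>. ind K {p})"
    by (simp add: R.basis_alg_simps(2) R.ind_eq_finsum finite_unit_support)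
  also have "{\<one>\<^bsub>G\<^esub>} \<times> \<Omega> = Pair \<one>\<^bsub>G\<^esub> ` \<Omega>" by auto
  also have "(\<Oplus>\<^bsub>R\<^esub>p\<in>Pair \<one>\<^bsub>G\<^esub> ` \<Omega>. ind K {p}) = (\<Oplus>\<^bsub>R\<^esub>A\<in>\<Omega>. ind K {(\<one>\<^bsub>G\<^esub>, A)})"
    by (intro RA.M.finsum_reindex) (auto simp: R_basis_iff OmegaD inj_on_def intro!: R.basis_closed)
  also have "\<dots> = R_gen \<one>\<^bsub>G\<^esub>" unfolding R_gen_def
    by (intro arg_cong2[where f = "finsum R"]) (auto simp: OmegaD)
  finally show ?thesis by simp
qed

text \<open>The only summand of \<open>R_gen h\<close> that can compose with \<open>(g, B)\<close>
  is \<open>(h, A)\<close> for the translate \<open>A = g <# B\<close>, and it is present exactly if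
  this translate contains \<open>inv h\<close>.\<close>

lemma R_gen_mult_basis:
  assumes h: "h \<in> carrier G" and b: "(g, B) \<in> R_basis K G \<sigma>"
  shows "R_gen h \<otimes>\<^bsub>R\<^esub> ind K {(g, B)} =
    (if inv\<^bsub>G\<^esub> (h \<otimes>\<^bsub>G\<^esub> g) \<in> B then \<sigma> h g \<odot>\<^bsub>R\<^esub> ind K {(h \<otimes>\<^bsub>G\<^esub> g, B)} else \<zero>\<^bsub>R\<^esub>)"
proof -
  let ?J = "{A \<in> \<Omega>. inv\<^bsub>G\<^esub> h \<in> A}" and ?A = "g <#\<^bsub>G\<^esub> B"
  let ?v = "\<sigma> h g \<odot>\<^bsub>R\<^esub> ind K {(h \<otimes>\<^bsub>G\<^esub> g, B)}"
  have g: "g \<in> carrier G" "B \<in> \<Omega>" "inv\<^bsub>G\<^esub> g \<in> B" using b by (auto simp: R_basis_iff)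
  have J: "finite ?J" using finite_Omega by auto
  have hb: "(h, A) \<in> R_basis K G \<sigma>" if "A \<in> ?J" for A using that h by (auto simp: R_basis_iff)
  have mem: "?A \<in> ?J \<longleftrightarrow> inv\<^bsub>G\<^esub> (h \<otimes>\<^bsub>G\<^esub> g) \<in> B"
    using g h G.Omega_sigma_translate[OF g(2,1,3)] by (simp add: mem_translate_iff)
  have v: "?v \<in> carrier R" if "?A \<in> ?J"
    using that mem g h by (auto intro!: R.scal_closed R.basis_closed sigma_closed simp: R_basis_iff)
  have "R_gen h \<otimes>\<^bsub>R\<^esub> ind K {(g, B)} = (\<Oplus>\<^bsub>R\<^esub>A\<in>?J. ind K {(h, A)} \<otimes>\<^bsub>R\<^esub> ind K {(g, B)})"
    unfolding R_gen_def using J hb b by (intro RA.finsum_ldistr) (auto intro!: R.basis_closed)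
  also have "\<dots> = (\<Oplus>\<^bsub>R\<^esub>A\<in>?J. if ?A = A then ?v else \<zero>\<^bsub>R\<^esub>)"
    using hb b v by (intro RA.M.add.finprod_cong') (auto simp: basis_mult_eq)
  also have "\<dots> = (if ?A \<in> ?J then ?v else \<zero>\<^bsub>R\<^esub>)"
  proof (cases "?A \<in> ?J")
    case True
    then show ?thesis using J v by (subst RA.M.add.finprod_singleton[of ?A]) auto
  next
    case False
    then show ?thesis by (auto intro!: RA.M.add.finprod_one_eqI)
  qed
  finally show ?thesis unfolding mem .
qed

lemma R_gen_basis:
  assumes "h \<in> carrier G" "B \<in> \<Omega>"
  shows "R_gen h \<otimes>\<^bsub>R\<^esub> ind K {(\<one>\<^bsub>G\<^esub>, B)} = (if inv\<^bsub>G\<^esub> h \<in> B then ind K {(h, B)} else \<zero>\<^bsub>R\<^esub>)"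
  using assms
  by (simp add: R_gen_mult_basis R_basis_iff OmegaD sigma_one_right_mem[OF assms(2,1)] R.basis_closed)

lemma one_basis: "B \<in> \<Omega> \<Longrightarrow> (\<one>\<^bsub>G\<^esub>, B) \<in> R_basis K G \<sigma>"
  by (simp add: R_basis_iff OmegaD)

text \<open>The vectors \<open>(\<one>, B)\<close> add up to the unit, so an element is the sum of
  its right multiples by them. This reduces relations between the \<open>R_gen\<close> to evaluation
  on basis vectors.\<close>

lemma R_eqI:
  assumes y: "y \<in> carrier R" and z: "z \<in> carrier R"
    and eq: "\<And>B. B \<in> \<Omega> \<Longrightarrow> y \<otimes>\<^bsub>R\<^esub> ind K {(\<one>\<^bsub>G\<^esub>, B)} = z \<otimes>\<^bsub>R\<^esub> ind K {(\<one>\<^bsub>G\<^esub>, B)}"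
  shows "y = z"
proof -
  let ?b = "\<lambda>B. ind K {(\<one>\<^bsub>G\<^esub>, B)}" and ?J = "{A \<in> \<Omega>. inv\<^bsub>G\<^esub> \<one>\<^bsub>G\<^esub> \<in> A}"
  have *: "w = (\<Oplus>\<^bsub>R\<^esub>B\<in>?J. w \<otimes>\<^bsub>R\<^esub> ?b B)" if w: "w \<in> carrier R" for w
  proof -
    have "w = w \<otimes>\<^bsub>R\<^esub> R_gen \<one>\<^bsub>G\<^esub>" using w by (simp add: R_gen_one)
    also have "\<dots> = (\<Oplus>\<^bsub>R\<^esub>B\<in>?J. w \<otimes>\<^bsub>R\<^esub> ?b B)" unfolding R_gen_def
      using w finite_Omega by (intro RA.finsum_rdistr) (auto intro!: R.basis_closed one_basis)
    finally show ?thesis .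
  qed
  have "(\<Oplus>\<^bsub>R\<^esub>B\<in>?J. y \<otimes>\<^bsub>R\<^esub> ?b B) = (\<Oplus>\<^bsub>R\<^esub>B\<in>?J. z \<otimes>\<^bsub>R\<^esub> ?b B)"
    using eq z by (intro RA.M.add.finprod_cong') (auto intro!: RA.m_closed R.basis_closed one_basis)
  then show ?thesis using *[OF y] *[OF z] by simp
qed

lemma R_gen_R_gen_basis:
  assumes "g \<in> carrier G" "h \<in> carrier G" "B \<in> \<Omega>"
  shows "R_gen g \<otimes>\<^bsub>R\<^esub> (R_gen h \<otimes>\<^bsub>R\<^esub> ind K {(\<one>\<^bsub>G\<^esub>, B)}) =
    (if inv\<^bsub>G\<^esub> h \<in> B \<and> inv\<^bsub>G\<^esub> (g \<otimes>\<^bsub>G\<^esub> h) \<in> B then \<sigma> g h \<odot>\<^bsub>R\<^esub> ind K {(g \<otimes>\<^bsub>G\<^esub> h, B)} else \<zero>\<^bsub>R\<^esub>)"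
  using assms by (simp add: R_gen_basis R_gen_mult_basis R_basis_iff R_gen_closed)

lemma R_rep: "tpg_rep R K G \<sigma> R_gen"
proof unfold_locales
  fix g h assume g: "g \<in> carrier G" and h: "h \<in> carrier G"
  note cl = R_gen_closed sigma_closed g h R.basis_closed one_basis
  have gh: "inv\<^bsub>G\<^esub> g \<otimes>\<^bsub>G\<^esub> (g \<otimes>\<^bsub>G\<^esub> h) = h" "g \<otimes>\<^bsub>G\<^esub> h \<otimes>\<^bsub>G\<^esub> inv\<^bsub>G\<^esub> h = g"
    using g h by (simp_all add: G.m_assoc[symmetric]) (simp add: G.m_assoc)
  have inv_gh: "inv\<^bsub>G\<^esub> (g \<otimes>\<^bsub>G\<^esub> h) \<otimes>\<^bsub>G\<^esub> g = inv\<^bsub>G\<^esub> h"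
    using g h by (simp add: G.inv_mult_group G.m_assoc)
  show "R_gen (inv\<^bsub>G\<^esub> g) \<otimes>\<^bsub>R\<^esub> R_gen g \<otimes>\<^bsub>R\<^esub> R_gen h = \<sigma> g h \<odot>\<^bsub>R\<^esub> (R_gen (inv\<^bsub>G\<^esub> g) \<otimes>\<^bsub>R\<^esub> R_gen (g \<otimes>\<^bsub>G\<^esub> h))"
  proof (rule R_eqI)
    fix B assume B: "B \<in> \<Omega>"
    have "R_gen (inv\<^bsub>G\<^esub> g) \<otimes>\<^bsub>R\<^esub> R_gen g \<otimes>\<^bsub>R\<^esub> R_gen h \<otimes>\<^bsub>R\<^esub> ind K {(\<one>\<^bsub>G\<^esub>, B)} =
        R_gen (inv\<^bsub>G\<^esub> g) \<otimes>\<^bsub>R\<^esub> (R_gen g \<otimes>\<^bsub>R\<^esub> (R_gen h \<otimes>\<^bsub>R\<^esub> ind K {(\<one>\<^bsub>G\<^esub>, B)}))"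
      using B by (simp add: cl RA.m_assoc)
    also have "\<dots> = (if inv\<^bsub>G\<^esub> h \<in> B \<and> inv\<^bsub>G\<^esub> (g \<otimes>\<^bsub>G\<^esub> h) \<in> B
        then \<sigma> g h \<odot>\<^bsub>R\<^esub> (\<sigma> (inv\<^bsub>G\<^esub> g) (g \<otimes>\<^bsub>G\<^esub> h) \<odot>\<^bsub>R\<^esub> ind K {(h, B)}) else \<zero>\<^bsub>R\<^esub>)"
      using B by (simp add: R_gen_R_gen_basis cl RA.smult_mult_right R_gen_mult_basis R_basis_iff gh)
    also have "\<dots> = \<sigma> g h \<odot>\<^bsub>R\<^esub> (R_gen (inv\<^bsub>G\<^esub> g) \<otimes>\<^bsub>R\<^esub> (R_gen (g \<otimes>\<^bsub>G\<^esub> h) \<otimes>\<^bsub>R\<^esub> ind K {(\<one>\<^bsub>G\<^esub>, B)}))"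
      using B by (simp add: R_gen_R_gen_basis cl gh)
    finally show "R_gen (inv\<^bsub>G\<^esub> g) \<otimes>\<^bsub>R\<^esub> R_gen g \<otimes>\<^bsub>R\<^esub> R_gen h \<otimes>\<^bsub>R\<^esub> ind K {(\<one>\<^bsub>G\<^esub>, B)} =
        \<sigma> g h \<odot>\<^bsub>R\<^esub> (R_gen (inv\<^bsub>G\<^esub> g) \<otimes>\<^bsub>R\<^esub> R_gen (g \<otimes>\<^bsub>G\<^esub> h)) \<otimes>\<^bsub>R\<^esub> ind K {(\<one>\<^bsub>G\<^esub>, B)}"
      using B by (simp add: cl RA.smult_mult_left RA.m_assoc)
  qed (simp_all add: cl)
  show "R_gen g \<otimes>\<^bsub>R\<^esub> R_gen h \<otimes>\<^bsub>R\<^esub> R_gen (inv\<^bsub>G\<^esub> h) = \<sigma> g h \<odot>\<^bsub>R\<^esub> (R_gen (g \<otimes>\<^bsub>G\<^esub> h) \<otimes>\<^bsub>R\<^esub> R_gen (inv\<^bsub>G\<^esub> h))"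
  proof (rule R_eqI)
    fix B assume B: "B \<in> \<Omega>"
    have "R_gen g \<otimes>\<^bsub>R\<^esub> R_gen h \<otimes>\<^bsub>R\<^esub> R_gen (inv\<^bsub>G\<^esub> h) \<otimes>\<^bsub>R\<^esub> ind K {(\<one>\<^bsub>G\<^esub>, B)} =
        R_gen g \<otimes>\<^bsub>R\<^esub> (R_gen h \<otimes>\<^bsub>R\<^esub> (R_gen (inv\<^bsub>G\<^esub> h) \<otimes>\<^bsub>R\<^esub> ind K {(\<one>\<^bsub>G\<^esub>, B)}))"
      using B by (simp add: cl RA.m_assoc)
    also have "\<dots> = (if h \<in> B \<and> inv\<^bsub>G\<^esub> g \<in> B
        then (\<sigma> g \<one>\<^bsub>G\<^esub> \<otimes>\<^bsub>K\<^esub> \<sigma> h (inv\<^bsub>G\<^esub> h)) \<odot>\<^bsub>R\<^esub> ind K {(g, B)} else \<zero>\<^bsub>R\<^esub>)"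
      using B by (simp add: cl RA.smult_mult_right R_gen_mult_basis OmegaD R_basis_iff
          sigma_one_right_mem[OF B g] sigma_one_right_mem[OF B G.inv_closed[OF h]])
    \<comment> \<open>The cocycle identity for \<open>g\<close>, \<open>h\<close>,
      \<open>inv h\<close> with base point \<open>inv g\<close>; the points passed are
      \<open>inv g\<close>, the identity, \<open>h\<close> and the identity again.\<close>
    also have "\<dots> = (if h \<in> B \<and> inv\<^bsub>G\<^esub> g \<in> B
        then (\<sigma> g h \<otimes>\<^bsub>K\<^esub> \<sigma> (g \<otimes>\<^bsub>G\<^esub> h) (inv\<^bsub>G\<^esub> h)) \<odot>\<^bsub>R\<^esub> ind K {(g, B)} else \<zero>\<^bsub>R\<^esub>)"
      using B g h G.Omega_sigma_cocycle[OF B _ g h, of "inv\<^bsub>G\<^esub> g" "inv\<^bsub>G\<^esub> h"]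
      by (simp add: OmegaD)
    also have "\<dots> = \<sigma> g h \<odot>\<^bsub>R\<^esub> (R_gen (g \<otimes>\<^bsub>G\<^esub> h) \<otimes>\<^bsub>R\<^esub> (R_gen (inv\<^bsub>G\<^esub> h) \<otimes>\<^bsub>R\<^esub> ind K {(\<one>\<^bsub>G\<^esub>, B)}))"
      using B by (simp add: R_gen_R_gen_basis cl gh RA.smult_assoc1 R_basis_iff)
    finally show "R_gen g \<otimes>\<^bsub>R\<^esub> R_gen h \<otimes>\<^bsub>R\<^esub> R_gen (inv\<^bsub>G\<^esub> h) \<otimes>\<^bsub>R\<^esub> ind K {(\<one>\<^bsub>G\<^esub>, B)} =
        \<sigma> g h \<odot>\<^bsub>R\<^esub> (R_gen (g \<otimes>\<^bsub>G\<^esub> h) \<otimes>\<^bsub>R\<^esub> R_gen (inv\<^bsub>G\<^esub> h)) \<otimes>\<^bsub>R\<^esub> ind K {(\<one>\<^bsub>G\<^esub>, B)}"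
      using B by (simp add: cl RA.smult_mult_left RA.m_assoc)
  qed (simp_all add: cl)
  assume s: "\<sigma> g h = \<zero>\<^bsub>K\<^esub>"
  show "R_gen (inv\<^bsub>G\<^esub> g) \<otimes>\<^bsub>R\<^esub> R_gen (g \<otimes>\<^bsub>G\<^esub> h) = \<zero>\<^bsub>R\<^esub>"
  proof (rule R_eqI)
    fix B assume B: "B \<in> \<Omega>"
    \<comment> \<open>Otherwise \<open>B\<close> would contain the type I prohibition formed by the
      inverse of \<open>g \<otimes> h\<close>, by \<open>inv h\<close> and by the identity.\<close>
    have "\<not> (inv\<^bsub>G\<^esub> (g \<otimes>\<^bsub>G\<^esub> h) \<in> B \<and> inv\<^bsub>G\<^esub> h \<in> B)"
      using G.Omega_sigma_nonzero[OF B _ g h, of "inv\<^bsub>G\<^esub> (g \<otimes>\<^bsub>G\<^esub> h)"] g h s B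
      by (auto simp: inv_gh OmegaD)
    then show "R_gen (inv\<^bsub>G\<^esub> g) \<otimes>\<^bsub>R\<^esub> R_gen (g \<otimes>\<^bsub>G\<^esub> h) \<otimes>\<^bsub>R\<^esub> ind K {(\<one>\<^bsub>G\<^esub>, B)} = \<zero>\<^bsub>R\<^esub> \<otimes>\<^bsub>R\<^esub> ind K {(\<one>\<^bsub>G\<^esub>, B)}"
      using B by (auto simp: cl RA.m_assoc R_gen_R_gen_basis gh)
  qed (simp_all add: cl)
  show "R_gen (g \<otimes>\<^bsub>G\<^esub> h) \<otimes>\<^bsub>R\<^esub> R_gen (inv\<^bsub>G\<^esub> h) = \<zero>\<^bsub>R\<^esub>"
  proof (rule R_eqI)
    fix B assume B: "B \<in> \<Omega>"
    \<comment> \<open>Here the prohibition is formed by \<open>inv g\<close>, the identity and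
      \<open>h\<close>.\<close>
    have "\<not> (h \<in> B \<and> inv\<^bsub>G\<^esub> g \<in> B)"
      using G.Omega_sigma_nonzero[OF B _ g h, of "inv\<^bsub>G\<^esub> g"] g h s B
      by (auto simp: OmegaD)
    then show "R_gen (g \<otimes>\<^bsub>G\<^esub> h) \<otimes>\<^bsub>R\<^esub> R_gen (inv\<^bsub>G\<^esub> h) \<otimes>\<^bsub>R\<^esub> ind K {(\<one>\<^bsub>G\<^esub>, B)} = \<zero>\<^bsub>R\<^esub> \<otimes>\<^bsub>R\<^esub> ind K {(\<one>\<^bsub>G\<^esub>, B)}"
      using B by (auto simp: cl RA.m_assoc R_gen_R_gen_basis gh)
  qed (simp_all add: cl)
qed (simp_all add: sigma_closed R_gen_closed R_gen_one)

sublocale RX: factor_set_rep R K G \<sigma> R_gen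
  by (rule factor_set_repI) (rule R_rep)

lemma e_basis:
  assumes g: "g \<in> carrier G" and B: "B \<in> \<Omega>"
  shows "RX.e g \<otimes>\<^bsub>R\<^esub> ind K {(\<one>\<^bsub>G\<^esub>, B)} = (if g \<in> B then ind K {(\<one>\<^bsub>G\<^esub>, B)} else \<zero>\<^bsub>R\<^esub>)"
proof -
  note cl = R_gen_closed sigma_closed g R.basis_closed one_basis[OF B]
  \<comment> \<open>Were this value zero, \<open>{\<one>, g}\<close> would be a type I prohibition
    with base point the identity.\<close>
  have ne: "\<sigma> g (inv\<^bsub>G\<^esub> g) \<noteq> \<zero>\<^bsub>K\<^esub>" if "g \<in> B"
    using G.Omega_sigma_nonzero[OF B, of "\<one>\<^bsub>G\<^esub>" g "inv\<^bsub>G\<^esub> g"] that g B by (auto simp: OmegaD)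
  show ?thesis
  proof (cases "\<sigma> g (inv\<^bsub>G\<^esub> g) = \<zero>\<^bsub>K\<^esub>")
    case True
    then show ?thesis using ne by (auto simp: RX.e_def cl)
  next
    case False
    note u = RX.sigma_unit[OF g _ False]
    have "RX.e g \<otimes>\<^bsub>R\<^esub> ind K {(\<one>\<^bsub>G\<^esub>, B)} =
        inv\<^bsub>K\<^esub> \<sigma> g (inv\<^bsub>G\<^esub> g) \<odot>\<^bsub>R\<^esub> (R_gen g \<otimes>\<^bsub>R\<^esub> (R_gen (inv\<^bsub>G\<^esub> g) \<otimes>\<^bsub>R\<^esub> ind K {(\<one>\<^bsub>G\<^esub>, B)}))"
      using False u by (simp add: RX.e_def cl RA.smult_mult_left RA.m_assoc)
    then show ?thesis using u B
      by (simp add: R_gen_R_gen_basis cl OmegaD RA.smult_assoc1[symmetric])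
  qed
qed

lemma cell_basis:
  assumes "set ys \<subseteq> carrier G" and B: "B \<in> \<Omega>"
  shows "RX.cell ys S \<otimes>\<^bsub>R\<^esub> ind K {(\<one>\<^bsub>G\<^esub>, B)} =
    (if B \<inter> set ys = S \<inter> set ys then ind K {(\<one>\<^bsub>G\<^esub>, B)} else \<zero>\<^bsub>R\<^esub>)"
  using assms(1)
proof (induction ys)
  case Nil
  then show ?case using B by (simp add: RX.cell_simps R.basis_closed one_basis)
next
  case (Cons y ys)
  define q where "q = (if y \<in> S then RX.e y else \<one>\<^bsub>R\<^esub> \<ominus>\<^bsub>R\<^esub> RX.e y)"
  have y: "y \<in> carrier G" and ys: "set ys \<subseteq> carrier G" using Cons.prems by auto
  have b: "ind K {(\<one>\<^bsub>G\<^esub>, B)} \<in> carrier R" using B by (intro R.basis_closed one_basis)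
  have q: "q \<in> carrier R" using RX.e_closed[OF y] by (simp add: q_def)
  have qb: "q \<otimes>\<^bsub>R\<^esub> ind K {(\<one>\<^bsub>G\<^esub>, B)} = (if y \<in> B \<longleftrightarrow> y \<in> S then ind K {(\<one>\<^bsub>G\<^esub>, B)} else \<zero>\<^bsub>R\<^esub>)"
  proof -
    have "ind K {(\<one>\<^bsub>G\<^esub>, B)} \<ominus>\<^bsub>R\<^esub> ind K {(\<one>\<^bsub>G\<^esub>, B)} = \<zero>\<^bsub>R\<^esub>"
      "ind K {(\<one>\<^bsub>G\<^esub>, B)} \<ominus>\<^bsub>R\<^esub> \<zero>\<^bsub>R\<^esub> = ind K {(\<one>\<^bsub>G\<^esub>, B)}"
      using b by (simp_all add: RA.minus_eq RA.M.r_neg)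
    then show ?thesis
      using b e_basis[OF y B] RX.e_closed[OF y] by (simp add: q_def RX.minus_distrib)
  qed
  have "RX.cell (y # ys) S \<otimes>\<^bsub>R\<^esub> ind K {(\<one>\<^bsub>G\<^esub>, B)} = q \<otimes>\<^bsub>R\<^esub> (RX.cell ys S \<otimes>\<^bsub>R\<^esub> ind K {(\<one>\<^bsub>G\<^esub>, B)})"
    unfolding RX.cell_simps q_def[symmetric] using q b RX.cell_closed[OF ys] by (intro RA.m_assoc)
  also have "\<dots> = (if B \<inter> set (y # ys) = S \<inter> set (y # ys) then ind K {(\<one>\<^bsub>G\<^esub>, B)} else \<zero>\<^bsub>R\<^esub>)"
  proof (cases "B \<inter> set ys = S \<inter> set ys")
    case True
    then have "B \<inter> set (y # ys) = S \<inter> set (y # ys) \<longleftrightarrow> (y \<in> B \<longleftrightarrow> y \<in> S)" by auto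
    then show ?thesis using Cons.IH[OF ys] True qb by simp
  next
    case False
    then have "B \<inter> set (y # ys) \<noteq> S \<inter> set (y # ys)" by auto
    then show ?thesis using Cons.IH[OF ys] False q by simp
  qed
  finally show ?case .
qed

end


section \<open>The isomorphism\<close>

context factor_set_rep begin

text \<open>The cell is fixed by \<open>e v\<close> for all \<open>v \<in> S\<close>, so a
  prohibition inside \<open>S\<close> annihilates it. If \<open>S\<close> misses the identity, the
  cell is killed by \<open>e\<close> at the identity, which is the unit.\<close>

lemma cell_eq_zero:
  assumes ys: "set ys \<subseteq> carrier G" "\<one>\<^bsub>G\<^esub> \<in> set ys" and S: "S \<subseteq> set ys" "S \<notin> Omega_sigma K G \<sigma>"
  shows "cell ys S = \<zero>"
proof (cases "\<one>\<^bsub>G\<^esub> \<in> S")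
  case True
  then have "S \<in> Omega G" using ys S by (auto simp: Omega_def)
  then obtain V where V: "V \<in> prohibitions K G \<sigma>" "V \<subseteq> S" using S(2) by (auto simp: Omega_sigma_def)
  show ?thesis
  proof (rule prohibition_annihilates[OF V(1) cell_closed[OF ys(1)]])
    fix v assume "v \<in> V"
    then have "v \<in> S" "v \<in> set ys" using V(2) S(1) by auto
    then show "cell ys S \<otimes> e v = cell ys S" by (simp add: cell_mult_e[OF ys(1)])
  qed
next
  case False
  then show ?thesis using cell_mult_e[OF ys, of S] cell_closed[OF ys(1), of S] by (simp add: e_one)
qed

text \<open>Since \<open>\<Omega>\<^sub>\<sigma>\<close> is closed under smaller sets containing \<open>1\<close>, the set \<open>{1, g}\<close>
  already contains a prohibition.\<close>

lemma e_eq_zero: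
  assumes g: "g \<in> carrier G" "g \<notin> \<Union> (Omega_sigma K G \<sigma>)"
  shows "e g = \<zero>"
proof -
  \<comment> \<open>The cells of just these two points suffice as a test: subsets with
    \<open>g\<close> are not in \<open>Omega_sigma\<close>, and the cells of subsets without
    \<open>g\<close> are killed by \<open>e g\<close>.\<close>
  obtain ys where ys: "set ys = {\<one>\<^bsub>G\<^esub>, g}" "distinct ys"
    using finite_distinct_list[of "{\<one>\<^bsub>G\<^esub>, g}"] by auto
  then have ysG: "set ys \<subseteq> carrier G" using g by auto
  show ?thesis
  proof (rule zero_by_cells[OF ysG ys(2) e_closed[OF g(1)]])
    fix S assume S: "S \<subseteq> set ys"
    show "e g \<otimes> cell ys S = \<zero>"
    proof (cases "g \<in> S")
      case True
      then have "S \<notin> Omega_sigma K G \<sigma>" using g(2) by auto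
      then show ?thesis using S ysG ys(1) g(1) by (simp add: cell_eq_zero e_closed)
    next
      case False
      then show ?thesis using ysG ys(1) g(1) by (simp add: cell_comm[symmetric] cell_mult_e)
    qed
  qed
qed

text \<open>Among all subsets of the listed points, those outside \<open>Omega_sigma\<close> have
  zero cells.\<close>

lemma sum_Omega_cells:
  assumes ys: "set ys \<subseteq> carrier G" "distinct ys" "insert \<one>\<^bsub>G\<^esub> (\<Union> (Omega_sigma K G \<sigma>)) \<subseteq> set ys"
  shows "(\<Oplus>A\<in>Omega_sigma K G \<sigma>. cell ys A) = \<one>"
proof -
  have "(\<Oplus>A\<in>Omega_sigma K G \<sigma>. cell ys A) = (\<Oplus>A\<in>Pow (set ys). cell ys A)"
    using ys cell_closed[OF ys(1)] cell_eq_zero[OF ys(1)]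
    by (intro add.finprod_mono_neutral_cong_left) auto
  then show ?thesis using sum_cells[OF ys(1,2)] by simp
qed

end

section \<open>The linear inverse \<phi>\<close>

context finite_factor_set begin

sublocale PX: factor_set_rep P K G \<sigma> gen
  by (rule factor_set_repI) (rule tpg_alg_rep)

text \<open>A list plays the role of Y because \<open>cell\<close> is indexed by lists. The identity
  is inserted explicitly to meet the hypothesis of \<open>cell_eq_zero\<close> without deciding
  whether \<Omega> is empty.\<close>

definition "points = (SOME points. distinct points \<and> set points = insert \<one>\<^bsub>G\<^esub> (\<Union> \<Omega>))"

lemma points: "distinct points" "set points = insert \<one>\<^bsub>G\<^esub> (\<Union> \<Omega>)" "set points \<subseteq> carrier G"
proof -
  have "finite (insert \<one>\<^bsub>G\<^esub> (\<Union> \<Omega>))"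
    using G.finite_Omega_sigma_member[OF finite_Omega] finite_Omega by auto
  then have "\<exists>points. distinct points \<and> set points = insert \<one>\<^bsub>G\<^esub> (\<Union> \<Omega>)"
    using finite_distinct_list by blast
  then have "distinct points \<and> set points = insert \<one>\<^bsub>G\<^esub> (\<Union> \<Omega>)" unfolding points_def by (rule someI_ex)
  then show "distinct points" "set points = insert \<one>\<^bsub>G\<^esub> (\<Union> \<Omega>)" by auto
  then show "set points \<subseteq> carrier G" using OmegaD(1) by auto
qed

definition "preimage = (\<lambda>(g, A). gen g \<otimes>\<^bsub>P\<^esub> PX.cell points A)"

definition "\<phi> = R.lincomb P preimage"

lemma cell_P_closed: "PX.cell points A \<in> carrier P"
  by (rule PX.cell_closed[OF points(3)])

lemma preimage_closed: "preimage \<in> R_basis K G \<sigma> \<rightarrow> carrier P"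
  by (auto simp: preimage_def R_basis_def PX.x_closed cell_P_closed)

lemmas phi = R.lincomb_closed[OF PA.module_axioms preimage_closed, folded \<phi>_def]
  R.lincomb_add[OF PA.module_axioms preimage_closed, folded \<phi>_def]
  R.lincomb_scal[OF PA.module_axioms preimage_closed, folded \<phi>_def]
  R.lincomb_zero[OF PA.module_axioms preimage_closed, folded \<phi>_def]
  R.lincomb_basis[OF PA.module_axioms preimage_closed, folded \<phi>_def]

text \<open>For \<open>g\<close> outside the listed points the formula persists, since
  \<open>e g\<close> is then zero and no member of \<Omega> contains \<open>g\<close>.\<close>

lemma e_cell:
  assumes "g \<in> carrier G" "A \<in> \<Omega>"
  shows "PX.e g \<otimes>\<^bsub>P\<^esub> PX.cell points A = (if g \<in> A then PX.cell points A else \<zero>\<^bsub>P\<^esub>)"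
proof (cases "g \<in> set points")
  case True
  then show ?thesis
    using assms by (simp add: PX.cell_comm[OF points(3), symmetric] PX.cell_mult_e[OF points(3)])
next
  case False
  then have "PX.e g = \<zero>\<^bsub>P\<^esub>" "g \<notin> A"
    using assms by (auto simp: points(2) intro!: PX.e_eq_zero)
  then show ?thesis by (simp add: cell_P_closed)
qed

text \<open>\<open>gen g\<close> absorbs \<open>e (inv g)\<close> on its right, and this idempotent
  annihilates the cell.\<close>

lemma gen_cell:
  assumes g: "g \<in> carrier G" and A: "A \<in> \<Omega>" "inv\<^bsub>G\<^esub> g \<notin> A"
  shows "gen g \<otimes>\<^bsub>P\<^esub> PX.cell points A = \<zero>\<^bsub>P\<^esub>"
proof -
  have "gen g \<otimes>\<^bsub>P\<^esub> PX.cell points A = gen g \<otimes>\<^bsub>P\<^esub> PX.e (inv\<^bsub>G\<^esub> g) \<otimes>\<^bsub>P\<^esub> PX.cell points A"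
    using g by (simp add: PX.x_e)
  also have "\<dots> = gen g \<otimes>\<^bsub>P\<^esub> (PX.e (inv\<^bsub>G\<^esub> g) \<otimes>\<^bsub>P\<^esub> PX.cell points A)"
    using g by (intro PA.m_assoc PX.x_closed PX.e_closed cell_P_closed) auto
  finally show ?thesis using g A by (simp add: e_cell PX.x_closed)
qed

lemma gen_preimage:
  assumes h: "h \<in> carrier G" and b: "(g, A) \<in> R_basis K G \<sigma>"
  shows "gen h \<otimes>\<^bsub>P\<^esub> preimage (g, A) = \<phi> (R_gen h \<otimes>\<^bsub>R\<^esub> ind K {(g, A)})"
proof -
  have g: "g \<in> carrier G" "A \<in> \<Omega>" "inv\<^bsub>G\<^esub> g \<in> A" using b by (auto simp: R_basis_iff)
  let ?k = "h \<otimes>\<^bsub>G\<^esub> g"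
  have k: "?k \<in> carrier G" "?k \<otimes>\<^bsub>G\<^esub> inv\<^bsub>G\<^esub> g = h" using g h by (auto simp: G.m_assoc)
  note cl = PX.x_closed PX.e_closed cell_P_closed sigma_closed h g(1) k(1)
  have "gen h \<otimes>\<^bsub>P\<^esub> preimage (g, A) = gen h \<otimes>\<^bsub>P\<^esub> gen g \<otimes>\<^bsub>P\<^esub> PX.cell points A"
    by (simp add: preimage_def cl PA.m_assoc)
  also have "\<dots> = \<sigma> h g \<odot>\<^bsub>P\<^esub> (PX.e h \<otimes>\<^bsub>P\<^esub> gen ?k \<otimes>\<^bsub>P\<^esub> PX.cell points A)"
    by (subst PX.x_mult) (simp_all add: cl PA.smult_mult_left)
  \<comment> \<open>Conjugation moves \<open>e h\<close> behind \<open>gen ?k\<close>, where it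
    becomes \<open>e (inv g)\<close>; the cell of \<open>A\<close> absorbs that factor because
    \<open>inv g \<in> A\<close>.\<close>
  also have "PX.e h \<otimes>\<^bsub>P\<^esub> gen ?k = gen ?k \<otimes>\<^bsub>P\<^esub> PX.e (inv\<^bsub>G\<^esub> g)"
    using PX.x_conj[of ?k "inv\<^bsub>G\<^esub> g"] k g by simp
  also have "gen ?k \<otimes>\<^bsub>P\<^esub> PX.e (inv\<^bsub>G\<^esub> g) \<otimes>\<^bsub>P\<^esub> PX.cell points A = gen ?k \<otimes>\<^bsub>P\<^esub> PX.cell points A"
    using g by (simp add: cl PA.m_assoc e_cell)
  finally have eq: "gen h \<otimes>\<^bsub>P\<^esub> preimage (g, A) = \<sigma> h g \<odot>\<^bsub>P\<^esub> (gen ?k \<otimes>\<^bsub>P\<^esub> PX.cell points A)" .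
  show ?thesis
  proof (cases "inv\<^bsub>G\<^esub> ?k \<in> A")
    case True
    then have "(?k, A) \<in> R_basis K G \<sigma>" using k g by (simp add: R_basis_iff)
    moreover have "preimage (?k, A) = gen ?k \<otimes>\<^bsub>P\<^esub> PX.cell points A" by (simp add: preimage_def)
    ultimately show ?thesis using True h g
      by (simp add: R_gen_mult_basis[OF h b] eq phi R.basis_closed sigma_closed)
  next
    case False
    then show ?thesis using k g h by (simp add: R_gen_mult_basis[OF h b] eq phi gen_cell sigma_closed)
  qed
qed

text \<open>Together with \<open>phi_one\<close>, this compatibility of \<phi> with products carries
  the induction in \<open>phi_psi\<close>.\<close>

lemma gen_phi:
  assumes h: "h \<in> carrier G" and f: "f \<in> carrier R"
  shows "gen h \<otimes>\<^bsub>P\<^esub> \<phi> f = \<phi> (R_gen h \<otimes>\<^bsub>R\<^esub> f)"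
  using f
proof (induction rule: R.basis_induct)
  case (basis p)
  then show ?case using gen_preimage[OF h] by (cases p) (simp add: phi)
qed (simp_all add: h PX.x_closed R_gen_closed phi PA.r_distr RA.r_distr PA.smult_mult_right RA.smult_mult_right)

lemma phi_one: "\<phi> \<one>\<^bsub>R\<^esub> = \<one>\<^bsub>P\<^esub>"
proof -
  have "\<phi> \<one>\<^bsub>R\<^esub> = (\<Oplus>\<^bsub>P\<^esub>p\<in>{\<one>\<^bsub>G\<^esub>} \<times> \<Omega>. ind K ({\<one>\<^bsub>G\<^esub>} \<times> \<Omega>) p \<odot>\<^bsub>P\<^esub> preimage p)"
    unfolding \<phi>_def R.basis_alg_simps(2) using finite_unit_support
    by (intro R.lincomb_eq_sum[OF PA.module_axioms preimage_closed] R.ind_closed) (auto simp: supp_def ind_def)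
  also have "\<dots> = (\<Oplus>\<^bsub>P\<^esub>p\<in>Pair \<one>\<^bsub>G\<^esub> ` \<Omega>. preimage p)"
    using finite_unit_support(2) preimage_closed
    by (intro PA.M.add.finprod_cong') (auto simp: ind_def Pi_iff subset_iff)
  also have "\<dots> = (\<Oplus>\<^bsub>P\<^esub>A\<in>\<Omega>. preimage (\<one>\<^bsub>G\<^esub>, A))"
    using finite_unit_support(2) preimage_closed
    by (intro PA.M.finsum_reindex) (auto simp: inj_on_def Pi_iff subset_iff)
  also have "\<dots> = (\<Oplus>\<^bsub>P\<^esub>A\<in>\<Omega>. PX.cell points A)"
    by (intro PA.M.add.finprod_cong') (auto simp: preimage_def PX.x_one cell_P_closed)
  also have "\<dots> = \<one>\<^bsub>P\<^esub>" by (intro PX.sum_Omega_cells points) (simp add: points(2))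
  finally show ?thesis .
qed

section \<open>The two compositions of \<phi> and \<psi>\<close>

context
  fixes \<psi>
  assumes psi: "\<psi> \<in> alg_hom K P R" and psi_gen: "\<And>g. g \<in> carrier G \<Longrightarrow> \<psi> (gen g) = R_gen g"
begin

interpretation \<psi>: ring_hom_ring P R \<psi>
  by (rule alg_hom_ring_hom_ring[OF PA.unital_algebra_axioms RA.unital_algebra_axioms psi])

text \<open>The idempotents, and hence the cells, are the same expressions in the generators with
  the same scalars in both algebras, so a homomorphism that matches the generators matches
  them.\<close>

lemma psi_e: "g \<in> carrier G \<Longrightarrow> \<psi> (PX.e g) = RX.e g"
  by (simp add: PX.e_def RX.e_def alg_homD(5)[OF psi] psi_gen PX.x_closed PX.sigma_unit)

lemma psi_cell: "set zs \<subseteq> carrier G \<Longrightarrow> \<psi> (PX.cell zs S) = RX.cell zs S"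
  by (induction zs)
    (simp_all add: PX.cell_simps RX.cell_simps psi_e PX.e_closed PX.cell_closed PA.minus_eq RA.minus_eq)

text \<open>In \<open>R\<close> the cell of \<open>A\<close> is the basis vector
  \<open>(\<one>, A)\<close>, which left multiplication by \<open>R_gen g\<close> moves to
  \<open>(g, A)\<close>.\<close>

lemma psi_preimage:
  assumes p: "(g, A) \<in> R_basis K G \<sigma>" shows "\<psi> (preimage (g, A)) = ind K {(g, A)}"
proof -
  have g: "g \<in> carrier G" "A \<in> \<Omega>" "inv\<^bsub>G\<^esub> g \<in> A" using p by (auto simp: R_basis_iff)
  have cell: "RX.cell points A = ind K {(\<one>\<^bsub>G\<^esub>, A)}"
  proof (rule R_eqI)
    fix B assume B: "B \<in> \<Omega>"
    \<comment> \<open>All members of \<Omega> lie within the listed points, so agreement on these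
      points is equality.\<close>
    have "A \<subseteq> set points" "B \<subseteq> set points" using B g(2) by (auto simp: points(2))
    then have "B \<inter> set points = A \<inter> set points \<longleftrightarrow> A = B" by auto
    then show "RX.cell points A \<otimes>\<^bsub>R\<^esub> ind K {(\<one>\<^bsub>G\<^esub>, B)} = ind K {(\<one>\<^bsub>G\<^esub>, A)} \<otimes>\<^bsub>R\<^esub> ind K {(\<one>\<^bsub>G\<^esub>, B)}"
      using B g(2)
      by (simp add: cell_basis[OF points(3) B] basis_mult_eq one_basis translate_one sigma_one_one R.basis_closed)
  qed (use g in \<open>simp_all add: RX.cell_closed[OF points(3)] R.basis_closed one_basis\<close>)
  show ?thesis
    using g by (simp add: preimage_def PX.x_closed cell_P_closed psi_gen psi_cell points(3) cell R_gen_basis)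
qed

lemma psi_phi: "f \<in> carrier R \<Longrightarrow> \<psi> (\<phi> f) = f"
proof (induction rule: R.basis_induct)
  case (basis p)
  then show ?case by (cases p) (simp add: phi psi_preimage)
qed (simp_all add: phi alg_homD(5)[OF psi])

lemma phi_psi: "z \<in> carrier P \<Longrightarrow> \<phi> (\<psi> z) = z"
proof (induction rule: tpg_induct)
  case (gen_mult g z)
  then show ?case
    using gen_phi[of g "\<psi> z", symmetric] by (simp add: PX.x_closed psi_gen)
qed (simp_all add: phi phi_one alg_homD(5)[OF psi])

lemma psi_iso: "\<psi> \<in> alg_iso K P R"
  unfolding alg_iso_def using psi phi_psi psi_phi phi(1)
  by (auto intro!: bij_betwI[where g = \<phi>])

end

lemma psi_unique:
  assumes "\<psi> \<in> alg_hom K P R" "\<psi>' \<in> alg_hom K P R"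
    "\<And>g. g \<in> carrier G \<Longrightarrow> \<psi> (gen g) = \<psi>' (gen g)" and z: "z \<in> carrier P"
  shows "\<psi> z = \<psi>' z"
  using z
  by (induction rule: tpg_induct) (simp_all add: assms alg_homD[OF assms(1)] alg_homD[OF assms(2)] PX.x_closed)

end

theorem proposition6p3:
  fixes K :: "('k, 'm) ring_scheme"
    and G :: "('g, 'n) monoid_scheme"
    and \<sigma> :: "'g \<Rightarrow> 'g \<Rightarrow> 'k"
  assumes "field K"
    and "group G"
    and "\<sigma> \<in> pm TYPE('r) K G"
    and "Omega_sigma_topology K G \<sigma> = discrete_topology (Omega_sigma K G \<sigma>)"
  shows "(\<exists>!\<psi>. \<psi> \<in> alg_hom K (tpg_alg K G \<sigma>) (R_alg K G \<sigma>) \<inter> extensional (carrier (tpg_alg K G \<sigma>)) \<and>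
            (\<forall>g\<in>carrier G. \<psi> (tpg_gen K G \<sigma> g) =
              (\<Oplus>\<^bsub>R_alg K G \<sigma>\<^esub>A\<in>{A \<in> Omega_sigma K G \<sigma>. inv\<^bsub>G\<^esub> g \<in> A}. ind K {(g, A)}))) \<and>
         (\<forall>\<psi> \<in> alg_hom K (tpg_alg K G \<sigma>) (R_alg K G \<sigma>).
            (\<forall>g\<in>carrier G. \<psi> (tpg_gen K G \<sigma> g) =
              (\<Oplus>\<^bsub>R_alg K G \<sigma>\<^esub>A\<in>{A \<in> Omega_sigma K G \<sigma>. inv\<^bsub>G\<^esub> g \<in> A}. ind K {(g, A)})) \<longrightarrow>
            \<psi> \<in> alg_iso K (tpg_alg K G \<sigma>) (R_alg K G \<sigma>))"
proof -
  interpret G: group G by (rule assms)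
  interpret finite_factor_set K G \<sigma>
    by (intro finite_factor_set.intro finite_factor_set_axioms.intro pm_factor_set[OF assms(1-3)]
        G.finite_Omega_sigma assms(4))
  obtain \<psi> where psi: "\<psi> \<in> alg_hom K P R" "\<forall>g\<in>carrier G. \<psi> (gen g) = R_gen g"
    using tpg_lift[OF R_rep] by blast
  \<comment> \<open>A homomorphism is constrained on the carrier only, so uniqueness as a function
    requires its values elsewhere to be fixed.\<close>
  define \<psi>0 where "\<psi>0 = restrict \<psi> (carrier P)"
  have hom: "\<psi>0 \<in> alg_hom K P R" and ext: "\<psi>0 \<in> extensional (carrier P)"
    using psi(1) by (auto simp: \<psi>0_def alg_hom_def ring_hom_def Pi_iff)
  have gen: "\<psi>0 (gen g) = R_gen g" if "g \<in> carrier G" for g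
    using that psi(2) by (simp add: \<psi>0_def PX.x_closed)
  have uniq: "\<psi>' = \<psi>0"
    if "\<psi>' \<in> alg_hom K P R" "\<psi>' \<in> extensional (carrier P)" "\<forall>g\<in>carrier G. \<psi>' (gen g) = R_gen g" for \<psi>'
    using that(2) ext
  proof (rule extensionalityI)
    fix z assume "z \<in> carrier P"
    then show "\<psi>' z = \<psi>0 z"
      by (rule psi_unique[OF that(1) hom, rotated]) (simp add: that(3) gen)
  qed
  have "\<exists>!\<psi>. \<psi> \<in> alg_hom K P R \<inter> extensional (carrier P) \<and> (\<forall>g\<in>carrier G. \<psi> (gen g) = R_gen g)"
  proof (rule ex1I[of _ \<psi>0])
    show "\<psi>0 \<in> alg_hom K P R \<inter> extensional (carrier P) \<and> (\<forall>g\<in>carrier G. \<psi>0 (gen g) = R_gen g)"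
      using hom ext gen by simp
  qed (elim conjE IntE, rule uniq)
  moreover have "\<forall>\<psi>\<in>alg_hom K P R. (\<forall>g\<in>carrier G. \<psi> (gen g) = R_gen g) \<longrightarrow> \<psi> \<in> alg_iso K P R"
    using psi_iso by simp
  ultimately show ?thesis unfolding R_gen_def by (rule conjI)
qed

end
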